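(* The following condition is equivalent to the Fermat-Wiles theorem (i.e. to the assertion that $x^n+y^n\ne z^n$ for all $x,y,z,n\in\mathbb{N}$ with $n\ge 3$): for all $x,y,z,n\in\mathbb{N}$ with $n\ge3$, $$\lim_{\tau\to\infty}\ln\left\{\frac{\Gamma\left(\left[\frac{x^n+y^n}{z^n}\frac{\tau}{1-c}\right]^1\right)}{\Gamma\left(\frac{x^n+y^n}{z^n}\frac{\tau}{1-c}\right)}\right\}^{\frac1\tau}\neq 1.$$
   Context: $\Gamma$ is Euler's Gamma-function, $c$ is Euler's constant ($c=0.5772\ldots$), $\zeta$ is the Riemann zeta-function, $\mathbb{N}=\{1,2,3,\dots\}$. The numbers $\frac{x^n+y^n}{z^n}$ with $x,y,z,n\in\mathbb{N}$, $n\ge 3$, are called Fermat's rationals. The expression $\ln\{A\}^{1/\tau}$ means $\ln(A^{1/\tau})=\frac1\tau\ln A$. Jacob's ladder: fix a smooth, increasing, unbounded function $\mu$ on a half-line $[y_0,\infty)$ with $\mu(y)\ge 7y\ln y$. For all sufficiently large $T$ let $\varphi(T)$ be the solution $X=\varphi(T)$ of $\int_0^{\mu(X)}|\zeta(\frac12+it)|^2e^{-2t/X}\,dt=\int_0^T|\zeta(\frac12+it)|^2\,dt$, and put $\varphi_1(T)=\frac12\varphi(T)$ (a Jacob's ladder). The function $\varphi_1$ is continuous, strictly increasing and unbounded for large $T$; for large $T$, $[T]^1=\varphi_1^{-1}(T)$ denotes the value of its inverse function. *)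

theory Defs
  imports "HOL-Analysis.Analysis"
begin

(* The analytic continuation of the Dirichlet series to the punctured plane; the
   value 0 at the pole is a convention that makes the description unique. *)
definition zeta :: "complex \<Rightarrow> complex" where
  "zeta = (THE f. f holomorphic_on (- {1}) \<and>
                  (\<forall>s. Re s > 1 \<longrightarrow> (\<lambda>n. 1 / (of_nat (Suc n) powr s)) sums f s) \<and>
                  f 1 = 0)"

definition critical_weight :: "real \<Rightarrow> real" where
  "critical_weight t = (cmod (zeta (1/2 + \<i> * complex_of_real t)))\<^sup>2"

(* Infinitely often differentiable on the closed half-line, with one-sided derivatives
   at the end point: D k is the k-th derivative. *)
definition smooth_on_halfline :: "real \<Rightarrow> (real \<Rightarrow> real) \<Rightarrow> bool" where
  "smooth_on_halfline y0 \<mu> \<longleftrightarrow>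
     (\<exists>D :: nat \<Rightarrow> real \<Rightarrow> real. (\<forall>y\<ge>y0. D 0 y = \<mu> y) \<and>
        (\<forall>k. \<forall>y\<ge>y0. (D k has_real_derivative D (Suc k) y) (at y within {y0..})))"

definition ladder_equation :: "real \<Rightarrow> (real \<Rightarrow> real) \<Rightarrow> real \<Rightarrow> real \<Rightarrow> bool" where
  "ladder_equation y0 \<mu> T X \<longleftrightarrow> X \<ge> y0 \<and>
     integral {0..\<mu> X} (\<lambda>t. critical_weight t * exp (- (2 * t / X))) =
     integral {0..T} critical_weight"

(* For admissible \<mu> this set contains all sufficiently large T. *)
definition ladder_domain :: "real \<Rightarrow> (real \<Rightarrow> real) \<Rightarrow> real set" where
  "ladder_domain y0 \<mu> = {T. T > 0 \<and> (\<exists>!X. ladder_equation y0 \<mu> T X)}"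

definition ladder_phi :: "real \<Rightarrow> (real \<Rightarrow> real) \<Rightarrow> real \<Rightarrow> real" where
  "ladder_phi y0 \<mu> T = (THE X. ladder_equation y0 \<mu> T X)"

definition jacob_ladder :: "real \<Rightarrow> (real \<Rightarrow> real) \<Rightarrow> real \<Rightarrow> real" where
  "jacob_ladder y0 \<mu> T = ladder_phi y0 \<mu> T / 2"

(* The inverse of the Jacob's ladder; meaningful for all sufficiently large arguments. *)
definition reverse_iterate :: "real \<Rightarrow> (real \<Rightarrow> real) \<Rightarrow> real \<Rightarrow> real" where
  "reverse_iterate y0 \<mu> = the_inv_into (ladder_domain y0 \<mu>) (jacob_ladder y0 \<mu>)"

definition fermat_rational :: "nat \<Rightarrow> nat \<Rightarrow> nat \<Rightarrow> nat \<Rightarrow> real" where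
  "fermat_rational x y z n = (real x ^ n + real y ^ n) / real z ^ n"

end

theory Submission
  imports Defs "HOL-Complex_Analysis.Complex_Analysis" "HOL-Real_Asymp.Real_Asymp"
begin

text \<open>
  Write \<open>s = 1/2 + \<i>t\<close>, \<open>w t\<close> for the squared modulus of \<open>\<zeta> s\<close>, and \<open>c\<close> for Euler's constant. Since
  \<open>- \<zeta> s / s\<close> is the Mellin transform of the fractional part, it is the Fourier transform of
  \<open>H u = frac (exp u) * exp (- u / 2)\<close>, so \<open>w t / (1/4 + t\<^sup>2)\<close> is the Fourier transform of the autocorrelation
  \<open>R\<close> of \<open>H\<close>. Counting integer parts gives \<open>R v = R 0 - (v ln (1/v) + b v) / 2 + O(v powr (3/2))\<close> as \<open>v\<close>
  decreases to 0. The functions \<open>E\<^sub>2\<bar>u\<bar>\<close> (exponential integral), \<open>exp (- \<bar>u\<bar>)\<close> and \<open>exp (- 2\<bar>u\<bar>)\<close> have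
  elementary Fourier transforms, and a combination of them has the same expansion. Averaging three times over
  windows of length \<open>\<Delta>\<close> multiplies a Fourier transform by a factor of size \<open>min 1 (1/(\<Delta>\<bar>u\<bar>)\<^sup>3)\<close>, so the averages of
  \<open>w t / (1/4 + t\<^sup>2)\<close> agree with those of the model up to \<open>O(\<Delta> powr (- 5/2))\<close>. As \<open>w\<close> is nonnegative, this yields
  \<open>\<integral> w = T ln T + A T + o(T)\<close> over \<open>[0, T]\<close>; the value of \<open>A\<close> is irrelevant.

  A Laplace transform then gives \<open>V ln V + (\<Gamma>'(2) + A) V + o(V)\<close>, with \<open>\<Gamma>'(2) = 1 - c\<close>, for the left side of the
  ladder equation at \<open>X = 2V\<close>. Comparing the two expansions, the value at \<open>V\<close> of the inverse ladder exceeds \<open>V\<close> by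
  \<open>(1 - c + o(1)) V / ln V\<close>, and by convexity of \<open>ln \<Gamma>\<close> the logarithm of the quotient of the two Gamma values
  is \<open>(1 - c + o(1)) V\<close>. Hence the limit in the theorem always exists and equals the Fermat rational.
\<close>

section \<open>Analytic continuation of the zeta function\<close>

text \<open>At argument V the moment and the smoothed moment are both V ln V + O(V), and they differ
  by (1 - c) V + o(V); the displacement V / ln V is read off from this difference. The leading term
  of the mean square is therefore not enough: an error o(T) is required, and this governs the
  exponents. After division by 1/4 + t^2 the error on a dyadic block at height Y must be o(1/Y). If
  the remainder of the autocorrelation is O(|u|^a), averages over windows of length D carry an error
  of order D^(-1-a). Y such errors add up over a block, and D has to be smaller than Y by a power of
  Y, so a > 1 is needed. Hence constant and linear term at 0 are matched along with v ln (1/v); the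
  counting yields a = 3/2. The multiplier of k averages decays like |u|^(-k), and integrability
  against |u|^(3/2) asks for k > 5/2, hence three averages. Nonnegativity of the weight encloses an
  integral between integrals of averages over slightly shorter and longer intervals. On the critical
  line the Dirichlet series diverges; zeta is reached there through corrected partial sums, which
  converge for Re s > 0 except at 1.\<close>

abbreviation npow :: "complex \<Rightarrow> nat \<Rightarrow> complex" where
  "npow z n \<equiv> exp (z * complex_of_real (ln (real (Suc n))))"

text \<open>With P extended with period 1, this is the integral of P(x) x^(-s-1) over [n+1, n+2];
  the sum over n is its Mellin transform on [1, \<infinity>). Cutting at the integers leaves
  parameter integrals over a fixed compact interval with a kernel smooth in both variables.\<close>

definition unit_mellin :: "(real \<Rightarrow> real) \<Rightarrow> nat \<Rightarrow> complex \<Rightarrow> complex" where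
  "unit_mellin P n s =
     integral {0..1} (\<lambda>x. of_real (P x) * exp (- (s + 1) * of_real (ln (real (Suc n) + x))))"

definition periodic_mellin :: "(real \<Rightarrow> real) \<Rightarrow> complex \<Rightarrow> complex" where
  "periodic_mellin P s = (\<Sum>n. unit_mellin P n s)"

lemma norm_exp_mult_ln:
  "x > 0 \<Longrightarrow> norm (exp (s * complex_of_real (ln x))) = x powr Re s"
  by (simp add: powr_def mult.commute)

lemma cexp_mult_has_vector_derivative:
  "((\<lambda>u. exp (z * complex_of_real u)) has_vector_derivative z * exp (z * of_real x)) (at x within S)"
proof -
  have "((\<lambda>u. z * complex_of_real u) has_vector_derivative z * of_real 1) (at x within S)"
    by (intro has_vector_derivative_mult_right has_vector_derivative_of_real) (auto intro!: derivative_eq_intros)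
  then have "(exp \<circ> (\<lambda>u. z * complex_of_real u) has_vector_derivative z * of_real 1 * exp (z * of_real x)) (at x within S)"
    by (rule field_vector_diff_chain_within) (rule has_field_derivative_at_within[OF DERIV_exp])
  then show ?thesis by (simp add: o_def)
qed

lemma exp_mult_ln_shift:
  assumes "x > 0"
  shows "exp ((z - 1) * complex_of_real (ln x)) = exp (z * complex_of_real (ln x)) / of_real x"
proof -
  have "exp (complex_of_real (ln x)) = of_real x"
    using assms by (metis exp_ln exp_of_real)
  then show ?thesis by (simp add: left_diff_distrib exp_diff)
qed

lemma exp_mult_ln_has_vector_derivative:
  assumes "c + x > 0"
  shows "((\<lambda>x. exp (z * complex_of_real (ln (c + x)))) has_vector_derivative
     z * exp ((z - 1) * complex_of_real (ln (c + x)))) (at x within S)"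
proof -
  have "((\<lambda>x. ln (c + x)) has_real_derivative 1 / (c + x)) (at x within S)"
    using assms by (auto intro!: derivative_eq_intros)
  then have "((\<lambda>x. z * complex_of_real (ln (c + x))) has_vector_derivative z * of_real (1 / (c + x))) (at x within S)"
    by (intro has_vector_derivative_mult_right has_vector_derivative_of_real)
  then have "(exp \<circ> (\<lambda>x. z * complex_of_real (ln (c + x))) has_vector_derivative
     z * of_real (1 / (c + x)) * exp (z * complex_of_real (ln (c + x)))) (at x within S)"
    by (rule field_vector_diff_chain_within) (rule has_field_derivative_at_within[OF DERIV_exp])
  then show ?thesis
    by (simp add: o_def exp_mult_ln_shift[OF assms])
qed

lemma unit_mellin_holomorphic:
  assumes "continuous_on {0..1} P"
  shows "unit_mellin P n holomorphic_on UNIV"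
proof -
  have "(\<lambda>s. integral (cbox 0 1) (\<lambda>x. of_real (P x) * exp (- (s + 1) * of_real (ln (real (Suc n) + x)))))
    holomorphic_on UNIV"
  proof (rule leibniz_rule_holomorphic[where fx = "\<lambda>s x. - of_real (P x) * of_real (ln (real (Suc n) + x))
        * exp (- (s + 1) * of_real (ln (real (Suc n) + x)))"])
    show "((\<lambda>s. of_real (P x) * exp (- (s + 1) * of_real (ln (real (Suc n) + x)))) has_field_derivative
      - of_real (P x) * of_real (ln (real (Suc n) + x)) * exp (- (s + 1) * of_real (ln (real (Suc n) + x))))
      (at s within UNIV)" for s :: complex and x
      by (auto intro!: derivative_eq_intros)
    have c: "continuous_on {0..1} (\<lambda>x. ln (real (Suc n) + x))"
      by (intro continuous_intros) auto
    show "(\<lambda>x. complex_of_real (P x) * exp (- (s + 1) * of_real (ln (real (Suc n) + x)))) integrable_on cbox 0 1" for s :: complex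
      by (rule integrable_continuous) (auto intro!: continuous_intros assms c simp: add_nonneg_eq_0_iff simp del: of_nat_Suc)
    have cP: "continuous_on (UNIV \<times> cbox 0 1) (\<lambda>y::complex\<times>real. P (snd y))"
      by (rule continuous_on_compose2[OF assms]) (auto intro: continuous_intros)
    have cl: "continuous_on (UNIV \<times> cbox 0 1) (\<lambda>y::complex\<times>real. ln (real (Suc n) + snd y))"
      by (rule continuous_on_compose2[OF c]) (auto intro: continuous_intros)
    show "continuous_on (UNIV \<times> cbox 0 1) (\<lambda>(s, x). - of_real (P x) * of_real (ln (real (Suc n) + x)) *
      exp (- (s + 1) * complex_of_real (ln (real (Suc n) + x))))"
      unfolding case_prod_unfold
      by (intro continuous_on_mult continuous_on_minus continuous_on_of_real continuous_on_exp continuous_on_add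
          continuous_on_const continuous_on_fst continuous_on_id cP cl)
  qed auto
  then show ?thesis unfolding unit_mellin_def[abs_def] by simp
qed

lemma norm_unit_mellin_le:
  assumes "continuous_on {0..1} P" and B: "\<And>x. x \<in> {0..1} \<Longrightarrow> \<bar>P x\<bar> \<le> B" and s: "Re s \<ge> d" "d \<ge> 0"
  shows "norm (unit_mellin P n s) \<le> B * real (Suc n) powr (- d - 1)"
proof -
  have c: "continuous_on {0..1} (\<lambda>x. ln (real (Suc n) + x))"
    by (intro continuous_intros) auto
  have "norm (integral (cbox 0 1) (\<lambda>x. of_real (P x) * exp (- (s + 1) * of_real (ln (real (Suc n) + x)))))
      \<le> integral (cbox 0 1) (\<lambda>x::real. B * real (Suc n) powr (- d - 1))"
  proof (rule integral_norm_bound_integral)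
    show "(\<lambda>x::real. B * real (Suc n) powr (- d - 1)) integrable_on cbox 0 1"
      by (rule integrable_const)
    show "(\<lambda>x. complex_of_real (P x) * exp (- (s + 1) * of_real (ln (real (Suc n) + x)))) integrable_on cbox 0 1"
      by (rule integrable_continuous) (auto intro!: continuous_intros assms c simp del: of_nat_Suc)
    fix x :: real assume x: "x \<in> cbox 0 1"
    have "norm (exp (- (s + 1) * complex_of_real (ln (real (Suc n) + x)))) = (real (Suc n) + x) powr (- Re s - 1)"
      by (subst norm_exp_mult_ln) (use x in auto)
    also have "\<dots> \<le> real (Suc n) powr (- Re s - 1)"
      by (rule powr_mono2') (use x s in auto)
    also have "\<dots> \<le> real (Suc n) powr (- d - 1)"
      by (rule powr_mono) (use s in auto)
    finally show "norm (of_real (P x) * exp (- (s + 1) * complex_of_real (ln (real (Suc n) + x))))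
      \<le> B * real (Suc n) powr (- d - 1)"
      unfolding norm_mult using B[of x] x by (intro mult_mono) auto
  qed
  then show ?thesis by (simp add: unit_mellin_def)
qed

lemma summable_Suc_powr: "d > 0 \<Longrightarrow> summable (\<lambda>n. real (Suc n) powr (- d - 1))"
  using summable_Suc_iff[of "\<lambda>n. real n powr (-d-1)"] summable_real_powr_iff[of "-d-1"] by simp

lemma continuous_unit_bound:
  fixes P :: "real \<Rightarrow> real"
  assumes "continuous_on {0..1} P"
  obtains B where "\<And>x. x \<in> {0..1} \<Longrightarrow> \<bar>P x\<bar> \<le> B"
proof -
  have "bounded (P ` {0..1})"
    using assms compact_continuous_image compact_imp_bounded by blast
  then obtain B where "\<forall>x\<in>{0..1}. \<bar>P x\<bar> \<le> B" by (auto simp: bounded_iff)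
  then show ?thesis using that by blast
qed

lemma summable_unit_mellin:
  assumes "continuous_on {0..1} P" "Re s > 0"
  shows "summable (\<lambda>n. unit_mellin P n s)"
proof -
  obtain B where B: "\<And>x. x \<in> {0..1} \<Longrightarrow> \<bar>P x\<bar> \<le> B"
    using continuous_unit_bound[OF assms(1)] by blast
  show ?thesis
    by (rule summable_comparison_test'[OF summable_mult[OF summable_Suc_powr[OF assms(2)]]])
      (rule norm_unit_mellin_le[OF assms(1) B], use assms in auto)
qed

lemma periodic_mellin_holomorphic:
  assumes "continuous_on {0..1} P"
  shows "periodic_mellin P holomorphic_on {s. Re s > 0}"
proof (rule holomorphic_uniform_sequence)
  obtain B where B: "\<And>x. x \<in> {0..1} \<Longrightarrow> \<bar>P x\<bar> \<le> B"
    using continuous_unit_bound[OF assms] by blast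
  show "open {s. 0 < Re s}" by (rule open_halfspace_Re_gt)
  show "(\<lambda>s. \<Sum>i<n. unit_mellin P i s) holomorphic_on {s. 0 < Re s}" for n
    by (intro holomorphic_on_sum holomorphic_on_subset[OF unit_mellin_holomorphic[OF assms]]) auto
  fix s0 assume s0: "s0 \<in> {s. 0 < Re s}"
  \<comment> \<open>With half of Re s0 as radius the closed disc stays in Re s \<ge> d, where all
    terms have one summable majorant.\<close>
  define d where "d = Re s0 / 2"
  have d: "d > 0" using s0 by (auto simp: d_def)
  have sub: "Re s \<ge> d" if "s \<in> cball s0 d" for s
  proof -
    have "\<bar>Re (s0 - s)\<bar> \<le> d" using that abs_Re_le_cmod[of "s0 - s"] by (simp add: dist_norm)
    then show ?thesis unfolding d_def minus_complex.sel by linarith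
  qed
  have "uniform_limit (cball s0 d) (\<lambda>n s. \<Sum>i<n. unit_mellin P i s) (\<lambda>s. \<Sum>i. unit_mellin P i s) sequentially"
    by (rule Weierstrass_m_test[OF _ summable_mult[OF summable_Suc_powr[OF d]]])
      (rule norm_unit_mellin_le[OF assms B], use sub d in auto)
  then show "\<exists>d>0. cball s0 d \<subseteq> {s. 0 < Re s} \<and>
      uniform_limit (cball s0 d) (\<lambda>n s. \<Sum>i<n. unit_mellin P i s) (periodic_mellin P) sequentially"
    using d sub unfolding periodic_mellin_def[abs_def] by force
qed

lemma unit_mellin_by_parts:
  assumes P: "continuous_on {0..1} P" and Q: "\<And>x. x \<in> {0..1} \<Longrightarrow> (Q has_real_derivative P x) (at x within {0..1})"
    and Q1: "Q 1 = Q 0"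
  shows "unit_mellin P n s = of_real (Q 0) * (npow (- (s + 1)) (Suc n)
     - npow (- (s + 1)) n) + (s + 1) * unit_mellin Q n (s + 1)"
proof -
  define e where "e = (\<lambda>x. exp (- (s + 1) * complex_of_real (ln (real (Suc n) + x))))"
  define e' where "e' = (\<lambda>x. exp (- (s + 2) * complex_of_real (ln (real (Suc n) + x))))"
  have cQ: "continuous_on {0..1} Q"
    using Q by (meson DERIV_continuous continuous_on_eq_continuous_within)
  have "((\<lambda>x. of_real (P x) * e x - (s + 1) * (of_real (Q x) * e' x)) has_integral
     of_real (Q 1) * e 1 - of_real (Q 0) * e 0) {0..1}"
  proof (rule fundamental_theorem_of_calculus)
    fix x :: real assume x: "x \<in> {0..1}"
    have pos: "real (Suc n) + x > 0" using x by auto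
    have "((\<lambda>x. complex_of_real (Q x)) has_vector_derivative of_real (P x)) (at x within {0..1})"
      using Q[OF x] has_vector_derivative_of_real by blast
    moreover have "(e has_vector_derivative (- (s + 1)) * e' x) (at x within {0..1})"
    proof -
      have "- (s + 1) - 1 = - (s + 2)" by simp
      then show ?thesis
        using exp_mult_ln_has_vector_derivative[OF pos, of "- (s + 1)" "{0..1}"] by (simp only: e_def e'_def)
    qed
    ultimately have "((\<lambda>x. of_real (Q x) * e x) has_vector_derivative
       of_real (Q x) * ((- (s + 1)) * e' x) + of_real (P x) * e x) (at x within {0..1})"
      by (rule has_vector_derivative_mult)
    moreover have "of_real (Q x) * ((- (s + 1)) * e' x) + of_real (P x) * e x
       = of_real (P x) * e x - (s + 1) * (of_real (Q x) * e' x)"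
      by (simp add: algebra_simps)
    ultimately show "((\<lambda>x. of_real (Q x) * e x) has_vector_derivative
       of_real (P x) * e x - (s + 1) * (of_real (Q x) * e' x)) (at x within {0..1})" by simp
  qed simp
  moreover have "((\<lambda>x. of_real (P x) * e x - (s + 1) * (of_real (Q x) * e' x)) has_integral
     unit_mellin P n s - (s + 1) * unit_mellin Q n (s + 1)) {0..1}"
  proof (intro has_integral_diff has_integral_mult_right)
    have c: "continuous_on {0..1} (\<lambda>x. ln (real (Suc n) + x))"
      by (intro continuous_intros) auto
    show "((\<lambda>x. of_real (P x) * e x) has_integral unit_mellin P n s) {0..1}"
      unfolding unit_mellin_def e_def
      by (intro integrable_integral integrable_continuous_interval continuous_intros P c)
    have "s + 1 + 1 = s + 2" by simp
    then show "((\<lambda>x. of_real (Q x) * e' x) has_integral unit_mellin Q n (s + 1)) {0..1}"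
      unfolding unit_mellin_def e'_def
      by (simp only:) (intro integrable_integral integrable_continuous_interval continuous_intros cQ c)
  qed
  ultimately have "unit_mellin P n s - (s + 1) * unit_mellin Q n (s + 1) = of_real (Q 1) * e 1 - of_real (Q 0) * e 0"
    by (rule has_integral_unique[symmetric])
  then show ?thesis by (simp add: e_def Q1 algebra_simps)
qed

lemma exp_ln_Suc_tendsto_0:
  assumes "Re z < 0"
  shows "(\<lambda>n. npow z n) \<longlonglongrightarrow> 0"
proof -
  have "(\<lambda>n. real (Suc n) powr Re z) \<longlonglongrightarrow> 0"
    by (rule tendsto_neg_powr[OF assms filterlim_compose[OF filterlim_real_sequentially filterlim_Suc]])
  then have "(\<lambda>n. norm (npow z n)) \<longlonglongrightarrow> 0"
    by (simp add: norm_exp_mult_ln del: of_nat_Suc norm_exp_eq_Re)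
  then show ?thesis by (rule tendsto_norm_zero_cancel)
qed

text \<open>Equal end values make the periodic extension of Q continuous, so the boundary terms
  telescope to the single one at 1. The right side is evaluated at s + 1: each integration by parts
  gains one unit of convergence.\<close>

lemma periodic_mellin_by_parts:
  assumes P: "continuous_on {0..1} P" and Q: "\<And>x. x \<in> {0..1} \<Longrightarrow> (Q has_real_derivative P x) (at x within {0..1})"
    and Q1: "Q 1 = Q 0" and s: "Re s > 0"
  shows "periodic_mellin P s = - of_real (Q 0) + (s + 1) * periodic_mellin Q (s + 1)"
proof -
  let ?e = "\<lambda>n. npow (- (s + 1)) n"
  have cQ: "continuous_on {0..1} Q"
    using Q by (meson DERIV_continuous continuous_on_eq_continuous_within)
  have "?e \<longlonglongrightarrow> 0" by (rule exp_ln_Suc_tendsto_0) (use s in auto)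
  then have "(\<lambda>n. ?e (Suc n) - ?e n) sums (0 - ?e 0)" by (rule telescope_sums)
  then have "(\<lambda>n. of_real (Q 0) * (?e (Suc n) - ?e n)) sums (of_real (Q 0) * (0 - ?e 0))" by (rule sums_mult)
  moreover have "(\<lambda>n. (s + 1) * unit_mellin Q n (s + 1)) sums ((s + 1) * periodic_mellin Q (s + 1))"
    unfolding periodic_mellin_def by (intro sums_mult summable_sums summable_unit_mellin cQ) (use s in auto)
  ultimately have "(\<lambda>n. unit_mellin P n s) sums (of_real (Q 0) * (0 - ?e 0) + (s + 1) * periodic_mellin Q (s + 1))"
    using sums_add by (simp only: unit_mellin_by_parts[OF P Q Q1]) blast
  then show ?thesis unfolding periodic_mellin_def by (simp add: sums_iff)
qed

text \<open>A primitive of P takes equal values at 0 and 1 because P has mean zero; subtracting the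
  mean of that primitive yields a Q that again satisfies the hypotheses. The induction thus
  integrates by parts k times.\<close>

lemma periodic_mellin_continuation_step:
  assumes "continuous_on {0..1} P" "integral {0..1} P = 0"
  shows "\<exists>f. f holomorphic_on {s. Re s > - real k} \<and> (\<forall>s. Re s > 0 \<longrightarrow> f s = periodic_mellin P s)"
  using assms
proof (induction k arbitrary: P)
  case 0
  then show ?case using periodic_mellin_holomorphic by auto
next
  case (Suc k)
  define Q0 where "Q0 = (\<lambda>x. integral {0..x} P)"
  define Q where "Q = (\<lambda>x. Q0 x - integral {0..1} Q0)"
  have D0: "(Q0 has_real_derivative P x) (at x within {0..1})" if "x \<in> {0..1}" for x
    unfolding Q0_def using Suc.prems(1) that
    by (metis has_real_derivative_iff_has_vector_derivative integral_has_vector_derivative)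
  have c0: "continuous_on {0..1} Q0"
    using D0 by (meson DERIV_continuous continuous_on_eq_continuous_within)
  have D: "(Q has_real_derivative P x) (at x within {0..1})" if "x \<in> {0..1}" for x
    unfolding Q_def using D0[OF that] by (auto intro!: derivative_eq_intros)
  have cQ: "continuous_on {0..1} Q" unfolding Q_def by (intro continuous_intros c0)
  have iQ: "integral {0..1} Q = 0" unfolding Q_def
    by (subst integral_diff) (auto intro!: integrable_continuous_interval c0)
  have Q01: "Q 1 = Q 0" using Suc.prems(2) by (simp add: Q_def Q0_def)
  obtain f where f: "f holomorphic_on {s. Re s > - real k}" "\<And>s. Re s > 0 \<Longrightarrow> f s = periodic_mellin Q s"
    using Suc.IH[OF cQ iQ] by blast
  have "(\<lambda>s. - of_real (Q 0) + (s + 1) * f (s + 1)) holomorphic_on {s. Re s > - real (Suc k)}"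
    by (intro holomorphic_intros holomorphic_on_compose_gen[OF _ f(1), of "\<lambda>s. s + 1", unfolded o_def]) auto
  moreover have "- of_real (Q 0) + (s + 1) * f (s + 1) = periodic_mellin P s" if "Re s > 0" for s
    using periodic_mellin_by_parts[OF Suc.prems(1) D Q01 that] f(2)[of "s + 1"] that by simp
  ultimately show ?case by blast
qed

text \<open>The extensions to the various half-planes agree for Re s > 0, hence by the identity
  theorem wherever both are defined, and glue to an entire function.\<close>

lemma periodic_mellin_continuation:
  assumes "continuous_on {0..1} P" "integral {0..1} P = 0"
  shows "\<exists>f. f holomorphic_on UNIV \<and> (\<forall>s. Re s > 0 \<longrightarrow> f s = periodic_mellin P s)"
proof -
  obtain f where f: "\<And>k. f k holomorphic_on {s. Re s > - real k}"
    "\<And>k s. Re s > 0 \<Longrightarrow> f k s = periodic_mellin P s"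
    using periodic_mellin_continuation_step[OF assms] by metis
  have agree: "f j s = f k s" if jk: "j \<le> k" and s: "Re s > - real j" for j k s
  proof -
    have "f j s - f k s = 0"
    proof (rule analytic_continuation[where S = "{s. Re s > - real j}" and U = "{s. Re s > 0}" and \<xi> = 1 and f = "\<lambda>s. f j s - f k s"])
      show "(\<lambda>s. f j s - f k s) holomorphic_on {s. - real j < Re s}"
        using jk by (intro holomorphic_intros f(1) holomorphic_on_subset[OF f(1)]) auto
      show "1 islimpt {s. 0 < Re s}"
        by (rule interior_limit_point) (simp add: interior_open open_halfspace_Re_gt)
    qed (use f(2) s in \<open>auto simp: open_halfspace_Re_gt intro: convex_connected convex_halfspace_Re_gt\<close>)
    then show ?thesis by simp
  qed
  define K where "K s = nat \<lceil>\<bar>Re s\<bar>\<rceil> + 1" for s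
  have K: "Re s > - real (K s)" for s unfolding K_def by linarith
  define F where "F s = f (K s) s" for s
  have F: "F s = f k s" if "Re s > - real k" for s k
    unfolding F_def using agree[of k "K s" s] agree[of "K s" k s] that K[of s]
    by (metis linorder_le_cases)
  have "F holomorphic_on UNIV"
    unfolding holomorphic_on_open[OF open_UNIV]
  proof
    fix s
    have "F holomorphic_on {z. Re z > - real (K s)}"
      using f(1)[of "K s"] by (rule holomorphic_transform) (use F in auto)
    then show "\<exists>f'. (F has_field_derivative f') (at s)"
      using K[of s] by (auto simp: holomorphic_on_open open_halfspace_Re_gt)
  qed
  moreover have "F s = periodic_mellin P s" if "Re s > 0" for s
    using F[of 0 s] f(2)[of s 0] that by simp
  ultimately show ?thesis by blast
qed


section \<open>Euler summation and the continuation of zeta\<close>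

lemma unit_mellin_sawtooth:
  assumes "Re s > 0" "s \<noteq> 1"
  shows "s * unit_mellin (\<lambda>x. x - 1/2) n s =
     (npow (1 - s) (Suc n) - npow (1 - s) n) * s / (1 - s)
     + (of_nat n + 3/2) * (npow (- s) (Suc n) - npow (- s) n)"
proof -
  \<comment> \<open>The primitive rests on x - 1/2 = (n + 1 + x) - (n + 3/2): the first summand
    raises the exponent of n + 1 + x by one, the second is constant.\<close>
  define F where "F = (\<lambda>x. exp ((1 - s) * complex_of_real (ln (real (Suc n) + x))) / (1 - s)
     + (of_nat n + 3/2) * (exp (- s * complex_of_real (ln (real (Suc n) + x))) / s))"
  have s0: "s \<noteq> 0" using assms by auto
  have "((\<lambda>x. of_real (x - 1/2) * exp (- (s + 1) * complex_of_real (ln (real (Suc n) + x)))) has_integral F 1 - F 0) {0..1}"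
  proof (rule fundamental_theorem_of_calculus)
    fix x :: real assume x: "x \<in> {0..1}"
    have pos: "real (Suc n) + x > 0" using x by auto
    define E where "E = exp (- s * complex_of_real (ln (real (Suc n) + x)))"
    have "(F has_vector_derivative ((1 - s) * exp ((1 - s - 1) * complex_of_real (ln (real (Suc n) + x)))) / (1 - s)
       + (of_nat n + 3/2) * ((- s * exp ((- s - 1) * complex_of_real (ln (real (Suc n) + x)))) / s)) (at x within {0..1})"
      unfolding F_def
      by (intro has_vector_derivative_add has_vector_derivative_mult_right has_vector_derivative_divide
          exp_mult_ln_has_vector_derivative pos)
    also have "((1 - s) * exp ((1 - s - 1) * complex_of_real (ln (real (Suc n) + x)))) / (1 - s) = E"
      using assms by (simp add: E_def)
    also have "(- s * exp ((- s - 1) * complex_of_real (ln (real (Suc n) + x)))) / s = - (E / of_real (real (Suc n) + x))"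
      using s0 by (subst exp_mult_ln_shift[OF pos]) (simp add: E_def)
    also have "E + (of_nat n + 3/2) * - (E / of_real (real (Suc n) + x)) = of_real (x - 1/2) * (E / of_real (real (Suc n) + x))"
    proof -
      have "E = of_real (real (Suc n) + x) * (E / of_real (real (Suc n) + x))"
        using pos by (metis less_numeral_extra(3) nonzero_mult_div_cancel_left of_real_eq_0_iff times_divide_eq_right)
      then have "E + (of_nat n + 3/2) * - (E / of_real (real (Suc n) + x))
         = (of_real (real (Suc n) + x) - (of_nat n + 3/2)) * (E / of_real (real (Suc n) + x))"
        by (metis (no_types, lifting) left_diff_distrib mult_minus_right uminus_add_conv_diff add.commute)
      also have "of_real (real (Suc n) + x) - (of_nat n + 3/2) = complex_of_real (x - 1/2)" by simp
      finally show ?thesis .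
    qed
    also have "E / of_real (real (Suc n) + x) = exp (- (s + 1) * complex_of_real (ln (real (Suc n) + x)))"
    proof -
      have "- s - 1 = - (s + 1)" by simp
      then show ?thesis using exp_mult_ln_shift[OF pos, of "- s"] by (simp only: E_def)
    qed
    finally show "(F has_vector_derivative of_real (x - 1/2) * exp (- (s + 1) * complex_of_real (ln (real (Suc n) + x))))
      (at x within {0..1})" .
  qed simp
  then have "unit_mellin (\<lambda>x. x - 1/2) n s = F 1 - F 0"
    unfolding unit_mellin_def by (rule integral_unique)
  moreover have "s * ((a / w + k * (b / s)) - (c / w + k * (d / s))) = (a - c) * s / w + k * (b - d)" for a b c d k w
    using s0 by (simp add: algebra_simps diff_divide_distrib)
  ultimately show ?thesis by (simp add: F_def)
qed

text \<open>Euler summation with the sawtooth {x} - 1/2, exact for every N. The left side converges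
  for Re s > 0, whereas the sum on the right does so only for Re s > 1; the quotient by 1 - s is the
  main term that has to be removed in the strip.\<close>

lemma zeta_partial_sum:
  assumes "Re s > 0" "s \<noteq> 1"
  shows "1 / (s - 1) + 1/2 - s * (\<Sum>n<N. unit_mellin (\<lambda>x. x - 1/2) n s) =
    (\<Sum>n<N. npow (- s) n) - npow (1 - s) N / (1 - s)
      + npow (- s) N / 2"
proof (induction N)
  case 0
  have "s - 1 \<noteq> 0" "1 - s \<noteq> 0" using assms by auto
  then show ?case by (simp add: field_simps)
next
  case (Suc N)
  define a where "a = npow (- s) N"
  define b where "b = npow (- s) (Suc N)"
  have A: "npow (1 - s) N = of_nat (Suc N) * a"
    using exp_mult_ln_shift[of "real (Suc N)" "1 - s"] by (simp add: a_def field_simps del: of_nat_Suc)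
  have B: "npow (1 - s) (Suc N) = of_nat (Suc (Suc N)) * b"
    using exp_mult_ln_shift[of "real (Suc (Suc N))" "1 - s"] by (simp add: b_def field_simps del: of_nat_Suc)
  define S where "S = (\<Sum>n<N. unit_mellin (\<lambda>x. x - 1/2) n s)"
  define Z where "Z = (\<Sum>n<N. npow (- s) n)"
  have IH: "1 / (s - 1) + 1/2 - s * S = Z - of_nat (Suc N) * a / (1 - s) + a / 2"
    using Suc.IH unfolding A S_def[symmetric] Z_def[symmetric] a_def[symmetric] .
  have U: "s * unit_mellin (\<lambda>x. x - 1/2) N s = (of_nat (Suc (Suc N)) * b - of_nat (Suc N) * a) * s / (1 - s)
     + (of_nat N + 3/2) * (b - a)"
    unfolding unit_mellin_sawtooth[OF assms] A B a_def[symmetric] b_def[symmetric] ..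
  have "1 / (s - 1) + 1/2 - s * (S + unit_mellin (\<lambda>x. x - 1/2) N s)
    = (Z - of_nat (Suc N) * a / (1 - s) + a / 2) - ((of_nat (Suc (Suc N)) * b - of_nat (Suc N) * a) * s / (1 - s)
     + (of_nat N + 3/2) * (b - a))"
    unfolding IH[symmetric] U[symmetric] by (simp add: algebra_simps)
  also have "\<dots> = Z + a - of_nat (Suc (Suc N)) * b / (1 - s) + b / 2"
  proof -
    have "1 - s \<noteq> 0" using assms by auto
    then show ?thesis by (simp add: divide_simps) (simp add: algebra_simps)
  qed
  finally show ?case
    unfolding sum.lessThan_Suc B S_def[symmetric] Z_def[symmetric] a_def[symmetric] b_def[symmetric] .
qed

text \<open>The continuation is 1/(s - 1) + 1/2 - s F(s), with F entire because {x} - 1/2 has mean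
  zero. The limit formula is recorded for Re s > 0 and not just the Dirichlet series, since it is
  the form available on the critical line.\<close>

lemma zeta_exists:
  "\<exists>f. f holomorphic_on (- {1}) \<and> (\<forall>s. Re s > 0 \<longrightarrow> s \<noteq> 1 \<longrightarrow>
     (\<lambda>N. (\<Sum>n<N. npow (- s) n) - npow (1 - s) N / (1 - s))
       \<longlonglongrightarrow> f s) \<and> f 1 = 0"
proof -
  have c: "continuous_on {0..1} (\<lambda>x::real. x - 1/2)" by (intro continuous_intros)
  have "((\<lambda>x::real. x - 1/2) has_integral ((1\<^sup>2 / 2 - 1/2) - (0\<^sup>2 / 2 - 0/2))) {0..1}"
    by (rule fundamental_theorem_of_calculus)
      (auto intro!: derivative_eq_intros simp: has_real_derivative_iff_has_vector_derivative[symmetric])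
  then have i0: "integral {0..1} (\<lambda>x::real. x - 1/2) = 0" by (simp add: integral_unique)
  obtain F where F: "F holomorphic_on UNIV" "\<And>s. Re s > 0 \<Longrightarrow> F s = periodic_mellin (\<lambda>x. x - 1/2) s"
    using periodic_mellin_continuation[OF c i0] by blast
  define f where "f = (\<lambda>s. if s = 1 then 0 else 1 / (s - 1) + 1/2 - s * F s)"
  have "(\<lambda>s. 1 / (s - 1) + 1/2 - s * F s) holomorphic_on (- {1})"
    by (intro holomorphic_intros holomorphic_on_subset[OF F(1)]) auto
  then have "f holomorphic_on (- {1})"
    by (rule holomorphic_transform) (auto simp: f_def)
  moreover have "(\<lambda>N. (\<Sum>n<N. npow (- s) n) - npow (1 - s) N / (1 - s))
       \<longlonglongrightarrow> f s" if s: "Re s > 0" "s \<noteq> 1" for s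
  proof -
    have "(\<lambda>N. \<Sum>n<N. unit_mellin (\<lambda>x. x - 1/2) n s) \<longlonglongrightarrow> F s"
      using summable_unit_mellin[OF c s(1)] F(2)[OF s(1)] unfolding periodic_mellin_def
      by (simp add: summable_LIMSEQ)
    then have "(\<lambda>N. 1 / (s - 1) + 1/2 - s * (\<Sum>n<N. unit_mellin (\<lambda>x. x - 1/2) n s)
        - npow (- s) N / 2) \<longlonglongrightarrow> 1 / (s - 1) + 1/2 - s * F s - 0 / 2"
      by (intro tendsto_intros exp_ln_Suc_tendsto_0) (use s in auto)
    then show ?thesis unfolding zeta_partial_sum[OF s] using s by (simp add: f_def)
  qed
  moreover have "f 1 = 0" by (simp add: f_def)
  ultimately show ?thesis by blast
qed

text \<open>\<open>zeta\<close> is a definite description, so uniqueness comes first: two candidates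
  agree on Re s > 1, hence on the punctured plane, which is connected, and the convention at 1
  settles the remaining point.\<close>

lemma zeta_characterization:
  shows zeta_holomorphic: "zeta holomorphic_on (- {1})"
    and zeta_limit: "Re s > 0 \<Longrightarrow> s \<noteq> 1 \<Longrightarrow>
     (\<lambda>N. (\<Sum>n<N. npow (- s) n) - npow (1 - s) N / (1 - s))
       \<longlonglongrightarrow> zeta s"
    and zeta_sums: "Re s > 1 \<Longrightarrow> (\<lambda>n. 1 / (of_nat (Suc n) powr s)) sums zeta s"
proof -
  obtain f where f: "f holomorphic_on (- {1})" "f 1 = 0"
    "\<And>s. Re s > 0 \<Longrightarrow> s \<noteq> 1 \<Longrightarrow>
     (\<lambda>N. (\<Sum>n<N. npow (- s) n) - npow (1 - s) N / (1 - s))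
       \<longlonglongrightarrow> f s"
    using zeta_exists by blast
  have e: "1 / (of_nat (Suc n) powr s) = npow (- s) n" for n s
    by (simp add: powr_def exp_minus divide_inverse Ln_of_nat del: of_nat_Suc)
  have sums: "(\<lambda>n. 1 / (of_nat (Suc n) powr s)) sums f s" if s: "Re s > 1" for s
  proof -
    have s1: "s \<noteq> 1" using s by auto
    have "(\<lambda>N. npow (1 - s) N) \<longlonglongrightarrow> 0"
      by (rule exp_ln_Suc_tendsto_0) (use s in auto)
    then have "(\<lambda>N. ((\<Sum>n<N. npow (- s) n) - npow (1 - s) N / (1 - s))
       + npow (1 - s) N / (1 - s)) \<longlonglongrightarrow> f s + 0 / (1 - s)"
      by (intro tendsto_intros f(3)) (use s s1 in auto)
    then show ?thesis unfolding sums_def e by simp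
  qed
  have "zeta = f"
    unfolding zeta_def
  proof (rule the_equality)
    show "f holomorphic_on - {1} \<and> (\<forall>s. 1 < Re s \<longrightarrow> (\<lambda>n. 1 / of_nat (Suc n) powr s) sums f s) \<and> f 1 = 0"
      using f sums by blast
    fix g assume g: "g holomorphic_on - {1} \<and> (\<forall>s. 1 < Re s \<longrightarrow> (\<lambda>n. 1 / of_nat (Suc n) powr s) sums g s) \<and> g 1 = 0"
    have "g s - f s = 0" if s: "s \<noteq> 1" for s
    proof (rule analytic_continuation[where S = "- {1}" and U = "{s. Re s > 1}" and \<xi> = 2 and f = "\<lambda>s. g s - f s"])
      show "(\<lambda>s. g s - f s) holomorphic_on - {1}"
        using g f by (intro holomorphic_intros) auto
      show "2 islimpt {s. 1 < Re s}"
        by (rule interior_limit_point) (simp add: interior_open open_halfspace_Re_gt)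
      show "connected (- {1::complex})"
        by (rule connected_punctured_universe) simp
      show "g z - f z = 0" if "z \<in> {s. 1 < Re s}" for z
        using g sums[of z] that sums_unique2 by force
    qed (use s in auto)
    then show "g = f" using g f(2) by (metis eq_iff_diff_eq_0 ext)
  qed
  then show "zeta holomorphic_on (- {1})"
    "Re s > 0 \<Longrightarrow> s \<noteq> 1 \<Longrightarrow>
     (\<lambda>N. (\<Sum>n<N. npow (- s) n) - npow (1 - s) N / (1 - s))
       \<longlonglongrightarrow> zeta s"
    "Re s > 1 \<Longrightarrow> (\<lambda>n. 1 / (of_nat (Suc n) powr s)) sums zeta s"
    using f sums by auto
qed

section \<open>The critical line as a Fourier transform\<close>

text \<open>Two integrals are in use: the Lebesgue integral for Fubini and substitution on unbounded
  sets, the gauge integral for the fundamental theorem on compact intervals. This limit is the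
  passage between them.\<close>

lemma integral_halfline_tendsto:
  fixes f :: "real \<Rightarrow> 'a::euclidean_space"
  assumes "set_integrable lborel {a..} f"
  shows "((\<lambda>b. integral {a..b} f) \<longlongrightarrow> (LINT x:{a..}|lborel. f x)) at_top"
proof -
  have "set_integrable lborel {a..b} f" for b
    by (rule set_integrable_subset[OF assms]) auto
  then have "(LINT x:{a..b}|lborel. f x) = integral {a..b} f" for b
    by (rule set_borel_integral_eq_integral)
  then show ?thesis
    using tendsto_set_lebesgue_integral_at_top[of a lborel f] assms by simp
qed

section \<open>Fourier transforms of two-sided exponentials\<close>

lemma set_integrable_exp_minus:
  assumes "a > 0"
  shows "set_integrable lborel {0..} (\<lambda>u::real. exp (- a * u))"
proof -
  have "(\<lambda>x::real. exp (- a * x)) absolutely_integrable_on {0..}"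
    by (rule nonnegative_absolutely_integrable_1)
      (use has_integral_exp_minus_to_infinity[OF assms, of 0] in \<open>auto simp: integrable_on_def\<close>)
  then show ?thesis
    unfolding set_integrable_def by (subst (asm) integrable_completion) auto
qed

lemma set_integrable_cexp_minus:
  assumes "Re z > 0"
  shows "set_integrable lborel {0..} (\<lambda>u::real. exp (- z * of_real u))"
  unfolding set_integrable_def
proof (rule Bochner_Integration.integrable_bound)
  show "integrable lborel (\<lambda>u. indicator {0..} u *\<^sub>R exp (- Re z * u))"
    using set_integrable_exp_minus[OF assms] unfolding set_integrable_def .
qed (auto simp: indicator_def norm_exp_eq_Re)

lemma laplace_cexp:
  assumes "Re z > 0"
  shows "(LINT u:{0..}|lborel. exp (- z * of_real u)) = 1 / z"
proof (rule tendsto_unique[OF _ integral_halfline_tendsto[OF set_integrable_cexp_minus[OF assms]]])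
  have z: "z \<noteq> 0" using assms by auto
  have I: "((\<lambda>u. exp (- z * of_real u)) has_integral (- exp (- z * of_real b) / z - (- exp (- z * of_real 0) / z))) {0..b}"
    if "b \<ge> 0" for b
  proof (rule fundamental_theorem_of_calculus[OF that])
    fix x :: real
    have "((\<lambda>u. exp (- z * complex_of_real u)) has_vector_derivative - z * exp (- z * of_real x)) (at x within {0..b})"
      by (rule cexp_mult_has_vector_derivative)
    from has_vector_derivative_divide[OF has_vector_derivative_minus[OF this], of z]
    show "((\<lambda>u. - exp (- z * complex_of_real u) / z) has_vector_derivative exp (- z * of_real x)) (at x within {0..b})"
      using z by simp
  qed
  have "eventually (\<lambda>b. (1 - exp (- z * of_real b)) / z = integral {0..b} (\<lambda>u. exp (- z * of_real u))) at_top"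
    by (rule eventually_mono[OF eventually_ge_at_top[of 0]]) (subst integral_unique[OF I], auto simp: diff_divide_distrib)
  moreover have "((\<lambda>b::real. (1 - exp (- z * of_real b)) / z) \<longlongrightarrow> (1 - 0) / z) at_top"
  proof (intro tendsto_intros z)
    have "((\<lambda>b::real. exp (- Re z * b)) \<longlongrightarrow> 0) at_top"
      using assms by real_asymp
    then have "((\<lambda>b::real. norm (exp (- z * of_real b))) \<longlongrightarrow> 0) at_top"
      by (simp add: norm_exp_eq_Re)
    then show "((\<lambda>b::real. exp (- z * of_real b)) \<longlongrightarrow> 0) at_top"
      by (rule tendsto_norm_zero_cancel)
  qed
  ultimately show "((\<lambda>b. integral {0..b} (\<lambda>u. exp (- z * of_real u))) \<longlongrightarrow> 1 / z) at_top"
    using Lim_transform_eventually by fastforce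
qed auto

lemma laplace_two_sided:
  fixes f :: "real \<Rightarrow> complex"
  assumes p: "set_integrable lborel {0..} f" and n: "set_integrable lborel {0..} (\<lambda>u. f (- u))"
  shows "integrable lborel f"
    and "(\<integral>u. f u \<partial>lborel) = (LINT u:{0..}|lborel. f u) + (LINT u:{0..}|lborel. f (- u))"
proof -
  have n': "set_integrable lborel {..0} f"
  proof -
    have "integrable lborel (\<lambda>x. indicator {0..} (0 + - 1 * x) *\<^sub>R f (- (0 + - 1 * x)))"
      by (rule lborel_integrable_real_affine) (use n in \<open>auto simp: set_integrable_def\<close>)
    moreover have "(\<lambda>x::real. indicator {0..} (0 + - 1 * x) *\<^sub>R f (- (0 + - 1 * x))) = (\<lambda>x. indicator {..0} x *\<^sub>R f x)"
      by (auto simp: indicator_def)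
    ultimately show ?thesis unfolding set_integrable_def by (simp only:)
  qed
  have n'': "set_integrable lborel {..<0} f" "set_integrable lborel {0<..} f"
    by (rule set_integrable_subset[OF n'], auto, rule set_integrable_subset[OF p], auto)
  have U: "{..0} \<union> {0<..} = (UNIV :: real set)" by auto
  have un: "set_integrable lborel UNIV f"
    using set_integrable_Un[OF n' n''(2)] by (simp add: U)
  then show "integrable lborel f" by (simp add: set_integrable_def)
  have "(LINT u:UNIV|lborel. f u) = (LINT u:{..0}|lborel. f u) + (LINT u:{0<..}|lborel. f u)"
    unfolding U[symmetric] by (rule set_integral_Un[OF _ n' n''(2)]) auto
  also have "(LINT u:{..0}|lborel. f u) = (LINT u:{0..}|lborel. f (- u))"
    by (subst set_integral_reflect) (simp add: atLeast_def)
  also have "(LINT u:{0<..}|lborel. f u) = (LINT u:{0..}|lborel. f u)"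
    unfolding set_lebesgue_integral_def
    by (intro integral_cong_AE AE_I'[of "{0}"]) 
      (use p n''(2) in \<open>auto simp: set_integrable_def indicator_def\<close>)
  finally show "(\<integral>u. f u \<partial>lborel) = (LINT u:{0..}|lborel. f u) + (LINT u:{0..}|lborel. f (- u))"
    by (simp add: set_lebesgue_integral_def)
qed

lemma fourier_double_exp:
  assumes "a > 0"
  shows "integrable lborel (\<lambda>u. of_real (exp (- a * \<bar>u\<bar>)) * exp (- \<i> * of_real t * of_real u))"
    and "(\<integral>u. of_real (exp (- a * \<bar>u\<bar>)) * exp (- \<i> * of_real t * of_real u) \<partial>lborel) = of_real (2 * a / (a\<^sup>2 + t\<^sup>2))"
proof -
  define f where "f = (\<lambda>u::real. of_real (exp (- a * \<bar>u\<bar>)) * exp (- \<i> * of_real t * of_real u))"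
  define z where "z = of_real a + \<i> * complex_of_real t"
  have z: "Re z > 0" "Re (cnj z) > 0" using assms by (auto simp: z_def)
  have e: "f u = exp (- z * of_real u)" "f (- u) = exp (- cnj z * of_real u)" if "u \<in> {0..}" for u
    using that by (auto simp: f_def z_def exp_of_real[symmetric] exp_add[symmetric] algebra_simps)
  have c: "set_integrable lborel {0..} f = set_integrable lborel {0..} (\<lambda>u. exp (- z * of_real u))"
    "set_integrable lborel {0..} (\<lambda>u. f (- u)) = set_integrable lborel {0..} (\<lambda>u. exp (- cnj z * of_real u))"
    by (rule set_integrable_cong[OF refl refl e(1)], simp, rule set_integrable_cong[OF refl refl e(2)], simp)
  have "(LINT u:{0..}|lborel. f u) = 1 / z" "(LINT u:{0..}|lborel. f (- u)) = 1 / cnj z"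
    unfolding laplace_cexp[OF z(1), symmetric] laplace_cexp[OF z(2), symmetric]
    by (rule set_lebesgue_integral_cong, use e in auto)+
  moreover have "1 / z + 1 / cnj z = of_real (2 * a / (a\<^sup>2 + t\<^sup>2))"
  proof -
    have z0: "z \<noteq> 0" using z by auto
    then have "1 / z + 1 / cnj z = (z + cnj z) / (z * cnj z)" by (simp add: field_simps)
    also have "z * cnj z = of_real (a\<^sup>2 + t\<^sup>2)" unfolding complex_mult_cnj by (simp add: z_def)
    also have "z + cnj z = of_real (2 * a)" by (simp add: complex_add_cnj z_def)
    finally show ?thesis by simp
  qed
  ultimately show "integrable lborel (\<lambda>u. of_real (exp (- a * \<bar>u\<bar>)) * exp (- \<i> * of_real t * of_real u))"
    "(\<integral>u. of_real (exp (- a * \<bar>u\<bar>)) * exp (- \<i> * of_real t * of_real u) \<partial>lborel) = of_real (2 * a / (a\<^sup>2 + t\<^sup>2))"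
    using laplace_two_sided[of f] set_integrable_cexp_minus[OF z(1)] set_integrable_cexp_minus[OF z(2)] c
    unfolding f_def by simp_all
qed

lemma integrable_double_exp:
  assumes "a > 0"
  shows "integrable lborel (\<lambda>u::real. exp (- a * \<bar>u\<bar>))"
  using integrable_norm[OF fourier_double_exp(1)[OF assms, of 0]] by simp

section \<open>The sawtooth kernel and its relation to zeta\<close>

definition sawtooth_kernel :: "real \<Rightarrow> real" where
  "sawtooth_kernel u = frac (exp u) * exp (- u / 2)"

lemma sawtooth_kernel_nonneg: "sawtooth_kernel u \<ge> 0"
  by (simp add: sawtooth_kernel_def)

text \<open>For u \<ge> 0 the fractional part is at most 1, for u < 0 at most exp u; against exp (-
  u / 2) both give the same two-sided exponential. Hence the transform converges absolutely.\<close>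

lemma sawtooth_kernel_le: "sawtooth_kernel u \<le> exp (- (1/2) * \<bar>u\<bar>)"
proof (cases "u \<ge> 0")
  case True
  have "frac (exp u) * exp (- u / 2) \<le> 1 * exp (- u / 2)"
    by (intro mult_right_mono) (auto simp: frac_lt_1 less_imp_le)
  then show ?thesis using True by (simp add: sawtooth_kernel_def)
next
  case False
  have "frac (exp u) \<le> exp u"
    using frac_def[of "exp u"] by (simp)
  then have "frac (exp u) * exp (- u / 2) \<le> exp u * exp (- u / 2)"
    by (intro mult_right_mono) auto
  also have "\<dots> = exp (u / 2)" by (simp add: exp_add[symmetric])
  finally show ?thesis using False by (simp add: sawtooth_kernel_def)
qed

lemma borel_measurable_frac [measurable]: "frac \<in> borel_measurable (borel :: real measure)"
  unfolding frac_def[abs_def] by measurable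

lemma sawtooth_kernel_measurable [measurable]: "sawtooth_kernel \<in> borel_measurable borel"
  unfolding sawtooth_kernel_def[abs_def] by measurable

lemma integrable_sawtooth_kernel: "integrable lborel sawtooth_kernel"
  by (rule Bochner_Integration.integrable_bound[OF integrable_double_exp[of "1/2"]])
    (use sawtooth_kernel_le sawtooth_kernel_nonneg in auto)

definition fourier :: "(real \<Rightarrow> real) \<Rightarrow> real \<Rightarrow> complex" where
  "fourier f t = (\<integral>u. of_real (f u) * exp (- \<i> * of_real t * of_real u) \<partial>lborel)"

lemma integrable_fourier:
  assumes "integrable lborel f"
  shows "integrable lborel (\<lambda>u. of_real (f u) * exp (- \<i> * of_real t * of_real u))"
  by (rule Bochner_Integration.integrable_bound[OF assms])
    (use borel_measurable_integrable[OF assms] in \<open>auto simp: norm_mult norm_exp_eq_Re\<close>)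

text \<open>Between consecutive logarithms the integer part of exp u is constant, so the integrand
  is elementary. At the right end point it jumps, which is why the comparison is made in the
  interior.\<close>

lemma sawtooth_block_has_integral:
  fixes s :: complex
  assumes s: "s \<noteq> 0" "s \<noteq> 1"
  shows "((\<lambda>u. of_real (frac (exp u)) * exp (- s * of_real u)) has_integral
     (npow (1 - s) (Suc n) - npow (1 - s) n) / (1 - s)
     + of_nat (Suc n) * (npow (- s) (Suc n) - npow (- s) n) / s)
     {ln (real (Suc n))..ln (real (Suc (Suc n)))}"
proof -
  define F where "F = (\<lambda>u::real. exp ((1 - s) * of_real u) / (1 - s) + of_nat (Suc n) * (exp (- s * of_real u) / s))"
  have "((\<lambda>u. exp ((1 - s) * of_real u) - of_nat (Suc n) * exp (- s * of_real u)) has_integral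
     F (ln (real (Suc (Suc n)))) - F (ln (real (Suc n)))) (cbox (ln (real (Suc n))) (ln (real (Suc (Suc n)))))"
    unfolding cbox_interval
  proof (rule fundamental_theorem_of_calculus)
    show "ln (real (Suc n)) \<le> ln (real (Suc (Suc n)))" by simp
    fix x
    have "(F has_vector_derivative ((1 - s) * exp ((1 - s) * of_real x)) / (1 - s) + of_nat (Suc n) * ((- s * exp (- s * of_real x)) / s))
      (at x within {ln (real (Suc n))..ln (real (Suc (Suc n)))})"
      unfolding F_def
      by (intro has_vector_derivative_add has_vector_derivative_mult_right has_vector_derivative_divide
          cexp_mult_has_vector_derivative)
    then show "(F has_vector_derivative exp ((1 - s) * of_real x) - of_nat (Suc n) * exp (- s * of_real x))
      (at x within {ln (real (Suc n))..ln (real (Suc (Suc n)))})"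
      using s by simp
  qed
  then have "((\<lambda>u. of_real (frac (exp u)) * exp (- s * of_real u)) has_integral
     F (ln (real (Suc (Suc n)))) - F (ln (real (Suc n)))) (cbox (ln (real (Suc n))) (ln (real (Suc (Suc n)))))"
  proof (rule has_integral_spike_interior)
    fix x assume "x \<in> box (ln (real (Suc n))) (ln (real (Suc (Suc n))))"
    then have x: "ln (real (Suc n)) < x" "x < ln (real (Suc (Suc n)))" by (auto simp: box_real)
    have "real (Suc n) < exp x" "exp x < real (Suc (Suc n))"
      using x by (metis exp_less_mono exp_ln of_nat_0_less_iff zero_less_Suc)+
    then have "\<lfloor>exp x\<rfloor> = int (Suc n)" by (simp add: floor_eq_iff)
    then have fr: "frac (exp x) = exp x - real (Suc n)" by (simp add: frac_def)
    have "exp ((1 - s) * of_real x) = of_real (exp x) * exp (- s * of_real x)"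
      by (simp add: left_diff_distrib exp_diff exp_minus divide_inverse exp_of_real)
    then show "of_real (frac (exp x)) * exp (- s * of_real x) = exp ((1 - s) * of_real x) - of_nat (Suc n) * exp (- s * of_real x)"
      unfolding fr by (simp add: algebra_simps)
  qed
  moreover have "F (ln (real (Suc (Suc n)))) - F (ln (real (Suc n))) = 
    (npow (1 - s) (Suc n) - npow (1 - s) n) / (1 - s)
     + of_nat (Suc n) * (npow (- s) (Suc n) - npow (- s) n) / s"
    unfolding F_def by (simp add: diff_divide_distrib right_diff_distrib del: of_nat_Suc)
  ultimately show ?thesis by (simp del: of_nat_Suc)
qed

text \<open>Abel summation over the blocks: integer parts weighted with differences of the powers (n
  + 1)^(-s) collapse to a partial sum of the Dirichlet series.\<close>

lemma sawtooth_partial_has_integral: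
  fixes s :: complex
  assumes s: "s \<noteq> 0" "s \<noteq> 1"
  shows "((\<lambda>u. of_real (frac (exp u)) * exp (- s * of_real u)) has_integral
     (npow (1 - s) N - 1) / (1 - s)
     + (of_nat N * npow (- s) N - (\<Sum>n<N. npow (- s) n)) / s)
     {0..ln (real (Suc N))}"
proof (induction N)
  case 0
  then show ?case by (simp add: has_integral_refl)
next
  case (Suc N)
  have "((\<lambda>u. of_real (frac (exp u)) * exp (- s * of_real u)) has_integral
     ((npow (1 - s) N - 1) / (1 - s)
     + (of_nat N * npow (- s) N - (\<Sum>n<N. npow (- s) n)) / s)
     + ((npow (1 - s) (Suc N) - npow (1 - s) N) / (1 - s)
     + of_nat (Suc N) * (npow (- s) (Suc N) - npow (- s) N) / s))
     {0..ln (real (Suc (Suc N)))}"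
    by (rule has_integral_combine[OF _ _ Suc sawtooth_block_has_integral[OF s]]) auto
  moreover have "((npow (1 - s) N - 1) / (1 - s)
     + (of_nat N * npow (- s) N - (\<Sum>n<N. npow (- s) n)) / s)
     + ((npow (1 - s) (Suc N) - npow (1 - s) N) / (1 - s)
     + of_nat (Suc N) * (npow (- s) (Suc N) - npow (- s) N) / s)
   = (npow (1 - s) (Suc N) - 1) / (1 - s)
     + (of_nat (Suc N) * npow (- s) (Suc N) - (\<Sum>n<Suc N. npow (- s) n)) / s"
    unfolding sum.lessThan_Suc
    by (simp add: algebra_simps diff_divide_distrib add_divide_distrib)
  ultimately show ?case by (simp only:)
qed

text \<open>On u < 0 the kernel is exp (u / 2) and contributes 1/(1 - s). On u \<ge> 0 the integrals
  up to ln (N + 1) are -1/s times the corrected partial sums of \<open>zeta_limit\<close>, up to a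
  vanishing term and the constant -1/(1 - s), which cancels the other contribution.\<close>

lemma zeta_eq_fourier_sawtooth:
  fixes t :: real
  defines "s \<equiv> 1/2 + \<i> * complex_of_real t"
  shows "zeta s = - s * fourier sawtooth_kernel t"
proof -
  have s: "s \<noteq> 0" "s \<noteq> 1" "Re s > 0" by (auto simp: s_def complex_eq_iff)
  define f where "f = (\<lambda>u. of_real (sawtooth_kernel u) * exp (- \<i> * of_real t * of_real u))"
  have int: "integrable lborel f"
    unfolding f_def by (rule integrable_fourier[OF integrable_sawtooth_kernel])
  have f: "f u = of_real (frac (exp u)) * exp (- s * of_real u)" for u
  proof -
    have "- s * of_real u = of_real (- u / 2) + - \<i> * of_real t * of_real u"
      by (simp add: s_def algebra_simps)
    then have "exp (- s * of_real u) = of_real (exp (- u / 2)) * exp (- \<i> * of_real t * of_real u)"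
      by (simp only: exp_add exp_of_real)
    then show ?thesis by (simp add: f_def sawtooth_kernel_def)
  qed
  have p: "set_integrable lborel {0..} f"
    using int integrable_mult_indicator[of "{0..}" lborel f] by (simp add: set_integrable_def)
  have int': "integrable lborel (\<lambda>u. f (- u))"
    using lborel_integrable_real_affine[OF int, of "-1" 0] by simp
  have n: "set_integrable lborel {0..} (\<lambda>u. f (- u))"
    using int' integrable_mult_indicator[of "{0..}" lborel "\<lambda>u. f (- u)"] by (simp add: set_integrable_def)
  have "(LINT u:{0..}|lborel. f (- u)) = (LINT u:{0..}|lborel. exp (- (1 - s) * of_real u))"
    unfolding set_lebesgue_integral_def
  proof (intro integral_cong_AE)
    \<comment> \<open>At x = 0 the two sides differ, because frac 1 = 0; the identity is claimed for
      x > 0 and used almost everywhere.\<close>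
    have e: "f (- x) = exp (- (1 - s) * of_real x)" if "x > 0" for x
    proof -
      have "frac (exp (- x)) = exp (- x)" using that by (subst frac_eq) auto
      moreover have "- (1 - s) * complex_of_real x = of_real (- x) + - s * of_real (- x)"
        by (simp add: algebra_simps)
      ultimately show ?thesis unfolding f by (simp only: exp_add exp_of_real)
    qed
    show "AE x in lborel. indicator {0..} x *\<^sub>R f (- x) = indicator {0..} x *\<^sub>R exp (- (1 - s) * of_real x)"
      using AE_lborel_singleton[of 0] by eventually_elim (use e in \<open>auto simp: indicator_def\<close>)
  qed (use n set_integrable_cexp_minus[of "1 - s"] in \<open>auto simp: set_integrable_def s_def\<close>)
  also have "\<dots> = 1 / (1 - s)" by (rule laplace_cexp) (simp add: s_def)
  finally have neg: "(LINT u:{0..}|lborel. f (- u)) = 1 / (1 - s)" .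
  have "filterlim (\<lambda>N. ln (real (Suc N))) at_top sequentially"
    by (rule filterlim_compose[OF ln_at_top filterlim_compose[OF filterlim_real_sequentially filterlim_Suc]])
  then have "(\<lambda>N. integral {0..ln (real (Suc N))} f) \<longlonglongrightarrow> (LINT u:{0..}|lborel. f u)"
    by (rule filterlim_compose[OF integral_halfline_tendsto[OF p]])
  also have "(\<lambda>N. integral {0..ln (real (Suc N))} f) = 
    (\<lambda>N. (npow (1 - s) N - 1) / (1 - s)
     + (of_nat N * npow (- s) N - (\<Sum>n<N. npow (- s) n)) / s)"
    unfolding f[abs_def] by (rule ext) (rule integral_unique[OF sawtooth_partial_has_integral[OF s(1,2)]])
  also have "\<dots> = (\<lambda>N. - (1/s) * ((\<Sum>n<N. npow (- s) n)
      - npow (1 - s) N / (1 - s)) - 1 / (1 - s) - npow (- s) N / s)"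
  proof
    fix N
    define b where "b = npow (- s) N"
    have B: "npow (1 - s) N = of_nat (Suc N) * b"
      using exp_mult_ln_shift[of "real (Suc N)" "1 - s"] by (simp add: b_def field_simps del: of_nat_Suc)
    define Z where "Z = (\<Sum>n<N. npow (- s) n)"
    have "1 - s \<noteq> 0" using s by auto
    then show "(npow (1 - s) N - 1) / (1 - s)
     + (of_nat N * npow (- s) N - (\<Sum>n<N. npow (- s) n)) / s
      = - (1/s) * ((\<Sum>n<N. npow (- s) n)
      - npow (1 - s) N / (1 - s)) - 1 / (1 - s) - npow (- s) N / s"
      unfolding B b_def[symmetric] Z_def[symmetric] using s by (simp add: divide_simps) (simp add: algebra_simps)
  qed
  finally have 1: "(\<lambda>N. - (1/s) * ((\<Sum>n<N. npow (- s) n)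
      - npow (1 - s) N / (1 - s)) - 1 / (1 - s) - npow (- s) N / s)
      \<longlonglongrightarrow> (LINT u:{0..}|lborel. f u)" .
  have 2: "(\<lambda>N. - (1/s) * ((\<Sum>n<N. npow (- s) n)
      - npow (1 - s) N / (1 - s)) - 1 / (1 - s) - npow (- s) N / s)
      \<longlonglongrightarrow> - (1/s) * zeta s - 1 / (1 - s) - 0 / s"
    by (intro tendsto_intros zeta_limit exp_ln_Suc_tendsto_0 s) (use s in auto)
  have "(LINT u:{0..}|lborel. f u) = - (1/s) * zeta s - 1 / (1 - s)"
    using LIMSEQ_unique[OF 1 2] by simp
  then have "fourier sawtooth_kernel t = - (1/s) * zeta s"
    using laplace_two_sided(2)[OF p n] neg by (simp add: fourier_def f_def)
  then show ?thesis using s by simp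
qed

definition spectral_density :: "real \<Rightarrow> real" where
  "spectral_density t = (cmod (fourier sawtooth_kernel t))\<^sup>2"

lemma critical_weight_eq: "critical_weight t = (1/4 + t\<^sup>2) * spectral_density t"
proof -
  have "(cmod (1/2 + \<i> * complex_of_real t))\<^sup>2 = 1/4 + t\<^sup>2"
    by (subst cmod_power2) (simp add: power2_eq_square)
  then show ?thesis
    unfolding critical_weight_def spectral_density_def zeta_eq_fourier_sawtooth norm_mult power_mult_distrib norm_minus_cancel
    by simp
qed

section \<open>Autocorrelation and its Fourier transform\<close>

definition autocorrelation :: "(real \<Rightarrow> real) \<Rightarrow> real \<Rightarrow> real" where
  "autocorrelation f v = (\<integral>u. f u * f (u + v) \<partial>lborel)"

lemma integrable_pair_shift:
  fixes f g :: "real \<Rightarrow> 'a :: {real_normed_field, banach, second_countable_topology}"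
  assumes f: "integrable lborel f" and g: "integrable lborel g"
  shows "integrable (lborel \<Otimes>\<^sub>M lborel) (\<lambda>(u, v). f u * g (u + v))"
proof (rule lborel_pair.Fubini_integrable)
  have [measurable]: "f \<in> borel_measurable borel" "g \<in> borel_measurable borel"
    using f g by auto
  show "(\<lambda>(u, v). f u * g (u + v)) \<in> borel_measurable (lborel \<Otimes>\<^sub>M lborel)"
    by measurable
  have gs: "integrable lborel (\<lambda>v. g (u + v))" for u
    using lborel_integrable_real_affine[OF g, of 1 u] by simp
  have "(\<integral>v. norm (g (u + v)) \<partial>lborel) = (\<integral>v. norm (g v) \<partial>lborel)" for u
    using lborel_integral_real_affine[of 1 "\<lambda>v. norm (g v)" u] by simp
  then show "integrable lborel (\<lambda>x. \<integral>y. norm (case (x, y) of (u, v) \<Rightarrow> f u * g (u + v)) \<partial>lborel)"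
    using f by (simp add: norm_mult)
  show "AE x in lborel. integrable lborel (\<lambda>y. case (x, y) of (u, v) \<Rightarrow> f u * g (u + v))"
    using gs by simp
qed

lemma integrable_autocorrelation:
  assumes "integrable lborel f"
  shows "integrable lborel (autocorrelation f)"
  unfolding autocorrelation_def[abs_def]
  using lborel_pair.integrable_snd[OF integrable_pair_shift[OF assms assms]] by simp

text \<open>Wiener-Khinchin: exp (- i t v) is the product of exp (i t u) and exp (- i t (u + v)), so
  Fubini and translation invariance produce the transform times its conjugate.\<close>

lemma fourier_autocorrelation:
  assumes f: "integrable lborel f"
  shows "fourier (autocorrelation f) t = of_real ((cmod (fourier f t))\<^sup>2)"
proof -
  define a where "a = (\<lambda>u. of_real (f u) * exp (\<i> * of_real t * of_real u))"
  define b where "b = (\<lambda>u. of_real (f u) * exp (- \<i> * of_real t * of_real u))"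
  have ab: "integrable lborel a" "integrable lborel b"
    using integrable_fourier[OF f, of t] integrable_fourier[OF f, of "- t"] by (auto simp: a_def b_def)
  have "fourier (autocorrelation f) t = (\<integral>v. (\<integral>u. of_real (f u * f (u + v)) * exp (- \<i> * of_real t * of_real v) \<partial>lborel) \<partial>lborel)"
    unfolding fourier_def autocorrelation_def by (simp del: of_real_mult)
  also have "\<dots> = (\<integral>v. (\<integral>u. a u * b (u + v) \<partial>lborel) \<partial>lborel)"
  proof -
    have "of_real (f u * f (u + v)) * exp (- \<i> * of_real t * of_real v) = a u * b (u + v)" for u v
      by (simp add: a_def b_def algebra_simps exp_add[symmetric] exp_diff exp_minus) (simp add: field_simps exp_add)
    then show ?thesis by simp
  qed
  also have "\<dots> = (\<integral>u. (\<integral>v. a u * b (u + v) \<partial>lborel) \<partial>lborel)"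
    by (rule lborel_pair.Fubini_integral) (rule integrable_pair_shift[OF ab])
  also have "\<dots> = (\<integral>u. a u * (\<integral>v. b v \<partial>lborel) \<partial>lborel)"
  proof -
    have "(\<integral>v. b (u + v) \<partial>lborel) = (\<integral>v. b v \<partial>lborel)" for u
      using lborel_integral_real_affine[of 1 b u] by simp
    then show ?thesis by simp
  qed
  also have "\<dots> = (\<integral>u. a u \<partial>lborel) * (\<integral>u. b u \<partial>lborel)" by simp
  also have "(\<integral>u. a u \<partial>lborel) = cnj (\<integral>u. b u \<partial>lborel)"
  proof -
    have "a u = cnj (b u)" for u by (simp add: a_def b_def exp_cnj)
    then show ?thesis by simp
  qed
  finally show ?thesis
    unfolding complex_norm_square by (simp add: fourier_def b_def mult.commute)
qed

lemma spectral_density_eq: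
  "of_real (spectral_density t) = fourier (autocorrelation sawtooth_kernel) t"
  unfolding spectral_density_def fourier_autocorrelation[OF integrable_sawtooth_kernel] ..

section \<open>Expansion of the autocorrelation at zero\<close>

lemma autocorrelation_minus: "autocorrelation f (- v) = autocorrelation f v"
proof -
  have "autocorrelation f (- v) = (\<integral>u. f (v + 1 * u) * f (v + 1 * u + - v) \<partial>lborel)"
    unfolding autocorrelation_def
    using lborel_integral_real_affine[of 1 "\<lambda>u. f u * f (u + - v)" v] by simp
  then show ?thesis by (simp add: autocorrelation_def mult.commute add.commute)
qed

lemma autocorrelation_sawtooth_bound: "\<bar>autocorrelation sawtooth_kernel v\<bar> \<le> (\<integral>u. sawtooth_kernel u \<partial>lborel)"
proof -
  have le1: "sawtooth_kernel u \<le> 1" for u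
    using sawtooth_kernel_le[of u] by (rule order_trans) auto
  have "integrable lborel (\<lambda>u. sawtooth_kernel u * sawtooth_kernel (u + v))"
    by (rule Bochner_Integration.integrable_bound[OF integrable_sawtooth_kernel])
      (use le1 sawtooth_kernel_nonneg in \<open>auto simp: abs_mult mult_left_le\<close>)
  then have "autocorrelation sawtooth_kernel v \<le> (\<integral>u. sawtooth_kernel u \<partial>lborel)"
    unfolding autocorrelation_def
    by (rule integral_mono[OF _ integrable_sawtooth_kernel]) (use le1 sawtooth_kernel_nonneg in \<open>auto simp: mult_left_le\<close>)
  moreover have "autocorrelation sawtooth_kernel v \<ge> 0"
    unfolding autocorrelation_def using sawtooth_kernel_nonneg by (intro integral_nonneg_AE) auto
  ultimately show ?thesis by simp
qed

definition frac_gap :: "real \<Rightarrow> real \<Rightarrow> real" where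
  "frac_gap q x = (frac (q * x) - frac x)\<^sup>2 / x\<^sup>2"

lemma frac_gap_measurable [measurable]: "frac_gap q \<in> borel_measurable borel"
  unfolding frac_gap_def[abs_def] by measurable

text \<open>With H the kernel, the square of exp (v / 2) H(u + v) - H u integrates to (exp v + 1) R
  0 - 2 exp (v / 2) R v, and after x = exp u it becomes \<open>frac_gap\<close>. The behaviour of R
  near 0 is thus expressed by a nonnegative integral that can be evaluated by counting integer
  parts.\<close>

lemma autocorrelation_eq_frac_gap:
  fixes v :: real
  defines "R \<equiv> autocorrelation sawtooth_kernel"
  shows "frac_gap (exp v) absolutely_integrable_on {0<..}"
    and "R v = cosh (v / 2) * R 0 - exp (- v / 2) / 2 * integral {0<..} (frac_gap (exp v))"
proof -
  define H where "H = sawtooth_kernel"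
  have [measurable]: "H \<in> borel_measurable borel" by (simp add: H_def)
  have bd: "0 \<le> H u" "H u \<le> 1" for u
    using sawtooth_kernel_le[of u] sawtooth_kernel_nonneg[of u]
    by (auto simp: H_def intro: order_trans[OF sawtooth_kernel_le])
  have intH: "integrable lborel H" by (simp add: H_def integrable_sawtooth_kernel)
  have i: "integrable lborel (\<lambda>u. H u * H (u + w))" for w
    by (rule Bochner_Integration.integrable_bound[OF intH])
      (use bd in \<open>auto simp: abs_mult mult_left_le\<close>)
  have s: "integrable lborel (\<lambda>u. H (u + w) * H (u + w))" "(\<integral>u. H (u + w) * H (u + w) \<partial>lborel) = R 0" for w
    using lborel_integrable_real_affine[OF i[of 0], of 1 w] lborel_integral_real_affine[of 1 "\<lambda>u. H u * H u" w]
    by (simp_all add: R_def autocorrelation_def H_def add.commute)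
  define d where "d = (\<lambda>u. (frac (exp v * exp u) - frac (exp u))\<^sup>2 * exp (- u))"
  have d: "d u = exp v * (H (u + v) * H (u + v)) + H (u + 0) * H (u + 0) - 2 * exp (v / 2) * (H u * H (u + v))" for u
  proof -
    have e: "exp (- u) = exp (- u / 2) * exp (- u / 2)" "exp v = exp (v / 2) * exp (v / 2)"
      by (simp_all add: exp_add[symmetric])
    have "- (u + v) / 2 = - u / 2 - v / 2" by (simp add: field_simps)
    then have H: "H (u + v) = frac (exp v * exp u) * (exp (- u / 2) / exp (v / 2))" "H u = frac (exp u) * exp (- u / 2)"
      unfolding H_def sawtooth_kernel_def by (simp_all only: exp_diff exp_add mult.commute)
    show ?thesis unfolding d_def add_0_right H e by (simp add: power2_eq_square field_simps)
  qed
  have int: "integrable lborel d"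
    unfolding d[abs_def] by (intro Bochner_Integration.integrable_add Bochner_Integration.integrable_diff integrable_mult_right s i)
  have Id: "(\<integral>u. d u \<partial>lborel) = exp v * R 0 + R 0 - 2 * exp (v / 2) * R v"
    unfolding d[abs_def]
    by (subst Bochner_Integration.integral_diff Bochner_Integration.integral_add integral_mult_right_zero | (intro Bochner_Integration.integrable_add integrable_mult_right s i))+
      (use s(2)[of 0] s(2)[of v] in \<open>simp add: R_def autocorrelation_def H_def\<close>)
  have dh: "\<bar>exp u\<bar> * frac_gap (exp v) (exp u) = d u" for u
    by (simp add: frac_gap_def d_def power2_eq_square exp_minus field_simps)
  have "(\<lambda>u. \<bar>exp u\<bar> * frac_gap (exp v) (exp u)) absolutely_integrable_on UNIV \<and>
           integral UNIV (\<lambda>u. \<bar>exp u\<bar> * frac_gap (exp v) (exp u)) = (\<integral>u. d u \<partial>lborel)"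
    unfolding dh using integrable_completion[of d lborel] int integral_lborel[OF int]
    by (auto simp: set_integrable_def)
  then have g: "frac_gap (exp v) absolutely_integrable_on (exp ` UNIV) \<and>
      integral (exp ` UNIV) (frac_gap (exp v)) = (\<integral>u. d u \<partial>lborel)"
    by (subst (asm) has_absolute_integral_change_of_variables_1') (auto intro!: derivative_eq_intros simp: inj_on_def)
  moreover have "range (exp :: real \<Rightarrow> real) = {0<..}"
    by (auto simp: image_iff) (metis exp_ln)
  ultimately show "frac_gap (exp v) absolutely_integrable_on {0<..}" by simp
  have "integral {0<..} (frac_gap (exp v)) = exp v * R 0 + R 0 - 2 * exp (v / 2) * R v"
    using g \<open>range (exp :: real \<Rightarrow> real) = {0<..}\<close> Id by simp
  then have "2 * exp (v / 2) * R v = exp v * R 0 + R 0 - integral {0<..} (frac_gap (exp v))" by simp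
  then have "exp (- v / 2) * (2 * exp (v / 2) * R v) = exp (- v / 2) * (exp v * R 0 + R 0 - integral {0<..} (frac_gap (exp v)))"
    by simp
  moreover have "exp (- v / 2) * exp (v / 2) = 1" "exp (- v / 2) * exp v = exp (v / 2)"
    by (simp_all add: exp_add[symmetric])
  moreover have "exp (- v / 2) * (2 * exp (v / 2) * R v) = 2 * (exp (- v / 2) * exp (v / 2)) * R v"
    "exp (- v / 2) * (exp v * R 0 + R 0 - integral {0<..} (frac_gap (exp v)))
      = (exp (- v / 2) * exp v) * R 0 + exp (- v / 2) * R 0 - exp (- v / 2) * integral {0<..} (frac_gap (exp v))"
    by (simp_all only: algebra_simps)
  ultimately have "2 * R v = exp (v / 2) * R 0 + exp (- v / 2) * R 0 - exp (- v / 2) * integral {0<..} (frac_gap (exp v))"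
    by (simp only: mult_1_right)
  moreover have "cosh (v / 2) = (exp (v / 2) + exp (- v / 2)) / 2" by (simp add: cosh_def)
  ultimately show "R v = cosh (v / 2) * R 0 - exp (- v / 2) / 2 * integral {0<..} (frac_gap (exp v))"
    by (simp only:) (simp add: field_simps)
qed

section \<open>Exact evaluation of the gap integral for small arguments\<close>

lemma frac_eq_diff: "real n \<le> x \<Longrightarrow> x < real (Suc n) \<Longrightarrow> frac x = x - real n"
proof -
  assume "real n \<le> x" "x < real (Suc n)"
  then have "\<lfloor>x\<rfloor> = int n" by (simp add: floor_eq_iff)
  then show ?thesis by (simp add: frac_def)
qed

text \<open>As long as \<open>(n + 1) \<kappa> \<le> 1\<close> the integer parts of \<open>x\<close> and \<open>(1 + \<kappa>) x\<close> differ by at most one on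
  \<open>[n, n + 1]\<close>, and the integral is elementary.\<close>

lemma frac_gap_block_exact:
  assumes k: "\<kappa> > 0" and n: "real (Suc n) * \<kappa> \<le> 1"
  shows "(frac_gap (1 + \<kappa>) has_integral \<kappa>\<^sup>2 + \<kappa> / real (Suc n) - 2 * \<kappa> * ln (1 + \<kappa>)) {real n..real (Suc n)}"
proof -
  \<comment> \<open>At c the product (1 + \<kappa>) x reaches n + 1. Before c the fractional parts
    differ by \<kappa> x, after it by \<kappa> x - 1; the hypothesis on (n + 1) \<kappa> prevents a
    second jump inside the block.\<close>
  define c where "c = real (Suc n) / (1 + \<kappa>)"
  have l: "1 + \<kappa> > 0" using k by simp
  have nk: "real n * \<kappa> \<le> 1" using n k by (simp add: algebra_simps)
  have c1: "real n \<le> c" "c \<le> real (Suc n)" "c > 0"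
    using k nk by (auto simp: c_def field_simps)
  have "(frac_gap (1 + \<kappa>) has_integral (c - real n) *\<^sub>R \<kappa>\<^sup>2) (cbox (real n) c)"
  proof (rule has_integral_spike_interior)
    show "((\<lambda>_. \<kappa>\<^sup>2) has_integral (c - real n) *\<^sub>R \<kappa>\<^sup>2) (cbox (real n) c)"
      using has_integral_const_real[of "\<kappa>\<^sup>2" "real n" c] c1 by simp
    fix x assume "x \<in> box (real n) c"
    then have x: "real n < x" "x < c" by (auto simp: box_real)
    have x0: "x > 0" using x by (meson less_le_trans not_le of_nat_0_le_iff order_le_less_trans)
    have "frac x = x - real n" by (rule frac_eq_diff) (use x c1 in auto)
    moreover have "frac ((1 + \<kappa>) * x) = (1 + \<kappa>) * x - real n"
    proof (rule frac_eq_diff)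
      show "(1 + \<kappa>) * x < real (Suc n)" using x l by (simp add: c_def field_simps)
      have "1 * x \<le> (1 + \<kappa>) * x" by (rule mult_right_mono) (use k x0 in auto)
      then show "real n \<le> (1 + \<kappa>) * x" using x by linarith
    qed
    ultimately have d: "frac ((1 + \<kappa>) * x) - frac x = \<kappa> * x" by (simp add: distrib_right)
    show "frac_gap (1 + \<kappa>) x = \<kappa>\<^sup>2" unfolding frac_gap_def d using x0 by (simp add: power_mult_distrib)
  qed
  then have 1: "(frac_gap (1 + \<kappa>) has_integral (c - real n) *\<^sub>R \<kappa>\<^sup>2) {real n..c}" by simp
  define F where "F = (\<lambda>x::real. \<kappa>\<^sup>2 * x - 2 * \<kappa> * ln x - 1 / x)"
  have "(frac_gap (1 + \<kappa>) has_integral F (real (Suc n)) - F c) (cbox c (real (Suc n)))"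
  proof (rule has_integral_spike_interior)
    show "((\<lambda>x. (\<kappa> - 1 / x)\<^sup>2) has_integral F (real (Suc n)) - F c) (cbox c (real (Suc n)))"
      unfolding cbox_interval
    proof (rule fundamental_theorem_of_calculus[OF c1(2)])
      fix x assume "x \<in> {c..real (Suc n)}"
      then have "x > 0" using c1 by auto
      then show "(F has_vector_derivative (\<kappa> - 1 / x)\<^sup>2) (at x within {c..real (Suc n)})"
        unfolding F_def has_real_derivative_iff_has_vector_derivative[symmetric]
        by (auto intro!: derivative_eq_intros simp: power2_eq_square field_simps)
    qed
    fix x assume "x \<in> box c (real (Suc n))"
    then have x: "c < x" "x < real (Suc n)" by (auto simp: box_real)
    have x0: "x > 0" using x c1 by auto
    have "frac x = x - real n" by (rule frac_eq_diff) (use x c1 in auto)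
    moreover have "frac ((1 + \<kappa>) * x) = (1 + \<kappa>) * x - real (Suc n)"
    proof (rule frac_eq_diff)
      show "real (Suc n) \<le> (1 + \<kappa>) * x" using x l by (simp add: c_def field_simps)
      have "(1 + \<kappa>) * x < (1 + \<kappa>) * real (Suc n)" using x l by (intro mult_strict_left_mono) auto
      also have "\<dots> \<le> real (Suc (Suc n))" using n by (simp add: algebra_simps)
      finally show "(1 + \<kappa>) * x < real (Suc (Suc n))" .
    qed
    ultimately have d: "frac ((1 + \<kappa>) * x) - frac x = \<kappa> * x - 1" by (simp add: distrib_right)
    have "frac_gap (1 + \<kappa>) x = (\<kappa> * x - 1)\<^sup>2 / x\<^sup>2" unfolding frac_gap_def d ..
    also have "\<dots> = ((\<kappa> * x - 1) / x)\<^sup>2" by (simp add: power_divide)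
    also have "(\<kappa> * x - 1) / x = \<kappa> - 1 / x" using x0 by (simp add: field_simps)
    finally show "frac_gap (1 + \<kappa>) x = (\<kappa> - 1 / x)\<^sup>2" .
  qed
  then have 2: "(frac_gap (1 + \<kappa>) has_integral F (real (Suc n)) - F c) {c..real (Suc n)}" by simp
  have "(c - real n) *\<^sub>R \<kappa>\<^sup>2 + (F (real (Suc n)) - F c) = \<kappa>\<^sup>2 + \<kappa> / real (Suc n) - 2 * \<kappa> * ln (1 + \<kappa>)"
  proof -
    have L: "ln c = ln (real (Suc n)) - ln (1 + \<kappa>)" unfolding c_def using l by (simp add: ln_div)
    have I: "1 / c = 1 / real (Suc n) + \<kappa> / real (Suc n)" by (simp add: c_def add_divide_distrib del: of_nat_Suc)
    show ?thesis unfolding F_def L I by (simp add: algebra_simps)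
  qed
  then show ?thesis using has_integral_combine[OF c1(1,2) 1 2] by simp
qed

text \<open>The terms \<kappa> / (n + 1) of the blocks add up to \<kappa> times a harmonic number;
  through it Euler's constant enters the expansion.\<close>

lemma frac_gap_initial_exact:
  assumes k: "\<kappa> > 0" and n: "real M * \<kappa> \<le> 1"
  shows "(frac_gap (1 + \<kappa>) has_integral \<kappa> * harm M + real M * (\<kappa>\<^sup>2 - 2 * \<kappa> * ln (1 + \<kappa>))) {0..real M}"
  using n
proof (induction M)
  case 0
  then show ?case by (simp add: harm_def has_integral_refl)
next
  case (Suc M)
  have "real M * \<kappa> \<le> real (Suc M) * \<kappa>" using k by (intro mult_right_mono) auto
  then have IH: "(frac_gap (1 + \<kappa>) has_integral \<kappa> * harm M + real M * (\<kappa>\<^sup>2 - 2 * \<kappa> * ln (1 + \<kappa>))) {0..real M}"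
    using Suc by linarith
  have "(frac_gap (1 + \<kappa>) has_integral \<kappa> * harm M + real M * (\<kappa>\<^sup>2 - 2 * \<kappa> * ln (1 + \<kappa>)) + 
     (\<kappa>\<^sup>2 + \<kappa> / real (Suc M) - 2 * \<kappa> * ln (1 + \<kappa>))) {0..real (Suc M)}"
    by (rule has_integral_combine[OF _ _ IH frac_gap_block_exact[OF k Suc.prems]]) auto
  moreover have "\<kappa> * harm M + real M * (\<kappa>\<^sup>2 - 2 * \<kappa> * ln (1 + \<kappa>)) + 
     (\<kappa>\<^sup>2 + \<kappa> / real (Suc M) - 2 * \<kappa> * ln (1 + \<kappa>)) = \<kappa> * harm (Suc M) + real (Suc M) * (\<kappa>\<^sup>2 - 2 * \<kappa> * ln (1 + \<kappa>))"
    by (simp add: harm_Suc divide_inverse distrib_left distrib_right)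
  ultimately show ?case by (simp only:)
qed

section \<open>Mean squares of shifted fractional parts\<close>

definition frac_bump :: "real \<Rightarrow> real" where
  "frac_bump v = frac v * (1 - frac v)"

lemma frac_bump_measurable [measurable]: "frac_bump \<in> borel_measurable borel"
  unfolding frac_bump_def[abs_def] by measurable

lemma frac_bump_bounds: "0 \<le> frac_bump v" "frac_bump v \<le> 1" "v \<ge> 0 \<Longrightarrow> frac_bump v \<le> v"
proof -
  show "0 \<le> frac_bump v" by (simp add: frac_bump_def frac_lt_1 less_imp_le)
  have "frac v * (1 - frac v) \<le> frac v * 1"
    by (intro mult_left_mono) auto
  then show "frac_bump v \<le> 1" using frac_lt_1[of v] by (simp add: frac_bump_def)
  assume "v \<ge> 0"
  then have "frac v \<le> v" by (simp add: frac_def)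
  then show "frac_bump v \<le> v" using \<open>frac v * (1 - frac v) \<le> frac v * 1\<close> by (simp add: frac_bump_def)
qed

text \<open>With equal integer parts the bump is a quadratic whose slopes are at most 1 in modulus.
  Otherwise \<open>frac_bump x\<close> is at most the distance to the next integer above x and
  \<open>frac_bump y\<close> at most that to the last integer below y, and these distances fit side
  by side between x and y.\<close>

lemma frac_bump_lipschitz: "x \<le> y \<Longrightarrow> \<bar>frac_bump y - frac_bump x\<bar> \<le> y - x"
proof (cases "\<lfloor>x\<rfloor> = \<lfloor>y\<rfloor>")
  case True
  assume xy: "x \<le> y"
  have "frac_bump y - frac_bump x = (frac y - frac x) * (1 - frac x - frac y)"
    by (simp add: frac_bump_def algebra_simps)
  moreover have "frac y - frac x = y - x" using True by (simp add: frac_def)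
  moreover have "\<bar>1 - frac x - frac y\<bar> \<le> 1"
    using frac_ge_0[of x] frac_ge_0[of y] frac_lt_1[of x] frac_lt_1[of y] by linarith
  ultimately show ?thesis using xy by (simp add: abs_mult mult_left_le)
next
  case False
  assume xy: "x \<le> y"
  then have "\<lfloor>x\<rfloor> + 1 \<le> \<lfloor>y\<rfloor>" using False floor_mono[OF xy] by linarith
  then have "(1 - frac x) + frac y \<le> y - x" unfolding frac_def by linarith
  moreover have "frac_bump x \<le> 1 - frac x"
    unfolding frac_bump_def using frac_lt_1[of x] mult_right_mono[of "frac x" 1 "1 - frac x"] by simp
  moreover have "frac_bump y \<le> frac y"
    unfolding frac_bump_def using mult_left_mono[of "1 - frac y" 1 "frac y"] by simp
  ultimately show ?thesis using frac_bump_bounds(1)[of x] frac_bump_bounds(1)[of y] frac_ge_0[of y] frac_lt_1[of x] by linarith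
qed

lemma bounded_borel_integrable_on:
  fixes h :: "real \<Rightarrow> real"
  assumes "h \<in> borel_measurable borel" "\<And>x. x \<in> {a..b} \<Longrightarrow> \<bar>h x\<bar> \<le> B"
  shows "h integrable_on {a..b}"
proof -
  have "set_integrable lborel {a..b} h"
    unfolding set_integrable_def
  proof (rule Bochner_Integration.integrable_bound)
    show "integrable lborel (\<lambda>x. indicator {a..b} x *\<^sub>R B)"
      by (intro integrable_scaleR_left integrable_real_indicator) (auto simp: emeasure_lborel_Icc_eq)
    have "\<bar>h x\<bar> \<le> \<bar>B\<bar>" if "x \<in> {a..b}" for x using assms(2)[OF that] by linarith
    then show "AE x in lborel. norm (indicator {a..b} x *\<^sub>R h x) \<le> norm (indicator {a..b} x *\<^sub>R B)"
      by (intro AE_I2) (auto simp: indicator_def)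
  qed (use assms in measurable)
  then show ?thesis by (rule set_borel_integral_eq_integral)
qed

lemma integral_indicator_le:
  fixes a b c d :: real
  assumes "c \<le> d"
  shows "integral {a..b} (indicator {c..d}) \<le> d - c"
proof -
  have "((\<lambda>x. if x \<in> {c..d} then 1 else 0 :: real) has_integral (d - c)) UNIV"
    unfolding has_integral_restrict_UNIV using has_integral_const_real[of "1::real" c d] assms by simp
  then have I: "((indicator {c..d} :: real \<Rightarrow> real) has_integral (d - c)) UNIV"
  proof -
    have "(indicator {c..d} :: real \<Rightarrow> real) = (\<lambda>x. if x \<in> {c..d} then 1 else 0)" by (auto simp: indicator_def)
    then show ?thesis using \<open>((\<lambda>x. if x \<in> {c..d} then 1 else 0 :: real) has_integral (d - c)) UNIV\<close> by (simp only:)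
  qed
  have "integral {a..b} (indicator {c..d} :: real \<Rightarrow> real) \<le> integral UNIV (indicator {c..d})"
  proof (rule integral_subset_le)
    show "(indicator {c..d} :: real \<Rightarrow> real) integrable_on {a..b}"
      by (rule bounded_borel_integrable_on[of _ _ _ 1]) (auto simp: indicator_def)
    show "(indicator {c..d} :: real \<Rightarrow> real) integrable_on UNIV" using I by blast
  qed auto
  then show ?thesis using I by (simp add: integral_unique)
qed

text \<open>Replacing the slowly varying shift \<open>\<kappa> x\<close> by \<open>\<kappa> n\<close> changes the fractional part noticeably only on
  two short intervals; for a constant shift the mean square over a period is \<open>frac_bump\<close>.\<close>

lemma frac_shift_mean_square:
  fixes \<kappa> :: real
  assumes k: "0 < \<kappa>" "\<kappa> \<le> 1"
  shows "\<bar>integral {real n..real (Suc n)} (\<lambda>x. (frac ((1 + \<kappa>) * x) - frac x)\<^sup>2) - frac_bump (\<kappa> * real n)\<bar> \<le> 6 * \<kappa>"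
proof -
  define a where "a = frac (\<kappa> * real n)"
  have a: "0 \<le> a" "a < 1" by (auto simp: a_def frac_lt_1)
  define g where "g = (\<lambda>x. frac ((1 + \<kappa>) * x) - frac x)"
  define G where "G = (\<lambda>x. frac (x + \<kappa> * real n) - frac x)"
  have [measurable]: "g \<in> borel_measurable borel" "G \<in> borel_measurable borel"
    by (simp_all add: g_def G_def)
  have fr: "frac (x + \<kappa> * real n) = frac (x + a)" for x
  proof -
    have "x + \<kappa> * real n = (x + a) + of_int \<lfloor>\<kappa> * real n\<rfloor>" by (simp add: a_def frac_def)
    then show ?thesis by (simp only:) (simp add: frac_def)
  qed
  have g1: "\<bar>g x\<bar> \<le> 1" "\<bar>G x\<bar> \<le> 1" for x
    using frac_ge_0[of x] frac_lt_1[of x] frac_ge_0[of "(1 + \<kappa>) * x"] frac_lt_1[of "(1 + \<kappa>) * x"]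
      frac_ge_0[of "x + \<kappa> * real n"] frac_lt_1[of "x + \<kappa> * real n"]
    unfolding g_def G_def by linarith+
  have sq1: "\<bar>(g x)\<^sup>2\<bar> \<le> 1" "\<bar>(G x)\<^sup>2\<bar> \<le> 1" for x
    using g1[of x] by (auto simp: abs_square_le_1)
  have ig: "(\<lambda>x. (g x)\<^sup>2) integrable_on {c..d}" "(\<lambda>x. (G x)\<^sup>2) integrable_on {c..d}" for c d
    by (rule bounded_borel_integrable_on[of _ _ _ 1]; use sq1 in auto)+
  have frlow: "frac (x + a) = x - real n + a" if "real n < x" "x < real n + 1 - a" for x
    using frac_eq_diff[of n "x + a"] that a by simp
  have frhigh: "frac (x + a) = x - real n + a - 1" if "real n + 1 - a \<le> x" "x < real n + 1" for x
    using frac_eq_diff[of "Suc n" "x + a"] that a by simp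
  have frx: "frac x = x - real n" if "real n < x" "x < real n + 1" for x
    using frac_eq_diff[of n x] that by simp
  \<comment> \<open>\<open>G\<close> equals a until x + a passes the next integer and a - 1
    afterwards; the squares, weighted with the lengths 1 - a and a, add up to a (1 - a).\<close>
  have "((\<lambda>x. (G x)\<^sup>2) has_integral (real n + 1 - a - real n) *\<^sub>R a\<^sup>2) (cbox (real n) (real n + 1 - a))"
  proof (rule has_integral_spike_interior)
    show "((\<lambda>_. a\<^sup>2) has_integral (real n + 1 - a - real n) *\<^sub>R a\<^sup>2) (cbox (real n) (real n + 1 - a))"
      using has_integral_const_real[of "a\<^sup>2" "real n" "real n + 1 - a"] a by simp
    fix x assume "x \<in> box (real n) (real n + 1 - a)"
    then have x: "real n < x" "x < real n + 1 - a" by (auto simp: box_real)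
    have "G x = a" unfolding G_def fr frlow[OF x] using frx[of x] x a by simp
    then show "(G x)\<^sup>2 = a\<^sup>2" by simp
  qed
  then have G1: "((\<lambda>x. (G x)\<^sup>2) has_integral (1 - a) * a\<^sup>2) {real n..real n + 1 - a}" by simp
  have "((\<lambda>x. (G x)\<^sup>2) has_integral (real n + 1 - (real n + 1 - a)) *\<^sub>R (1 - a)\<^sup>2) (cbox (real n + 1 - a) (real n + 1))"
  proof (rule has_integral_spike_interior)
    show "((\<lambda>_. (1 - a)\<^sup>2) has_integral (real n + 1 - (real n + 1 - a)) *\<^sub>R (1 - a)\<^sup>2) (cbox (real n + 1 - a) (real n + 1))"
      using has_integral_const_real[of "(1 - a)\<^sup>2" "real n + 1 - a" "real n + 1"] a by simp
    fix x assume "x \<in> box (real n + 1 - a) (real n + 1)"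
    then have x: "real n + 1 - a \<le> x" "x < real n + 1" "real n < x" using a by (auto simp: box_real)
    have "G x = - (1 - a)" unfolding G_def fr frhigh[OF x(1,2)] using frx[of x] x a by simp
    then show "(G x)\<^sup>2 = (1 - a)\<^sup>2" by (simp only: power2_minus)
  qed
  then have G2: "((\<lambda>x. (G x)\<^sup>2) has_integral a * (1 - a)\<^sup>2) {real n + 1 - a..real n + 1}" by simp
  have "((\<lambda>x. (G x)\<^sup>2) has_integral (1 - a) * a\<^sup>2 + a * (1 - a)\<^sup>2) {real n..real n + 1}"
    by (rule has_integral_combine[OF _ _ G1 G2]) (use a in auto)
  moreover have "(1 - a) * a\<^sup>2 + a * (1 - a)\<^sup>2 = frac_bump (\<kappa> * real n)"
    by (simp add: frac_bump_def a_def[symmetric]) (simp add: power2_eq_square algebra_simps)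
  ultimately have IG: "integral {real n..real (Suc n)} (\<lambda>x. (G x)\<^sup>2) = frac_bump (\<kappa> * real n)"
    by (simp add: integral_unique add.commute)
  define B where "B = (\<lambda>x. 2 * \<kappa> + (2 * indicator {real n + 1 - \<kappa> - a..real n + 1 - a} x
    + 2 * indicator {real n + 2 - \<kappa> - a..real n + 2 - a} x) :: real)"
  have ib: "(indicator {c..d} :: real \<Rightarrow> real) integrable_on {real n..real (Suc n)}" for c d
    by (rule bounded_borel_integrable_on[of _ _ _ 1]) (auto simp: indicator_def)
  have bd: "\<bar>(g x)\<^sup>2 - (G x)\<^sup>2\<bar> \<le> B x" if x: "real n < x" "x < real n + 1" for x
  proof -
    have "\<bar>(g x)\<^sup>2 - (G x)\<^sup>2\<bar> = \<bar>g x - G x\<bar> * \<bar>g x + G x\<bar>"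
      by (simp add: abs_mult[symmetric] power2_eq_square algebra_simps)
    also have "\<dots> \<le> \<bar>g x - G x\<bar> * 2"
      using g1[of x] by (intro mult_left_mono) auto
    finally have 1: "\<bar>(g x)\<^sup>2 - (G x)\<^sup>2\<bar> \<le> 2 * \<bar>g x - G x\<bar>" by simp
    define y where "y = x + \<kappa> * real n"
    define e where "e = \<kappa> * (x - real n)"
    have e: "0 \<le> e" "e \<le> \<kappa>" using x k by (auto simp: e_def mult_left_le)
    have gG: "g x - G x = frac (y + e) - frac y"
      by (simp add: g_def G_def y_def e_def algebra_simps)
    show ?thesis
    proof (cases "frac y + e < 1")
      case True
      have "\<lfloor>y + e\<rfloor> = \<lfloor>y\<rfloor>"
      proof (rule floor_unique)
        show "of_int \<lfloor>y\<rfloor> \<le> y + e" using e of_int_floor_le[of y] by linarith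
        show "y + e < of_int \<lfloor>y\<rfloor> + 1" using True unfolding frac_def by linarith
      qed
      then have "g x - G x = e" unfolding gG frac_def by simp
      then have "\<bar>(g x)\<^sup>2 - (G x)\<^sup>2\<bar> \<le> 2 * \<kappa>" using 1 e by simp
      also have "\<dots> \<le> B x" by (simp add: B_def)
      finally show ?thesis .
    next
      case False
      have "x \<in> {real n + 1 - \<kappa> - a..real n + 1 - a} \<union> {real n + 2 - \<kappa> - a..real n + 2 - a}"
      proof (cases "x < real n + 1 - a")
        case True
        have "frac y = x - real n + a" unfolding y_def fr by (rule frlow[OF x(1) True])
        then show ?thesis using False e True by auto
      next
        case xx: False
        have "frac y = x - real n + a - 1" unfolding y_def fr by (rule frhigh) (use xx x in auto)
        then show ?thesis using False e xx x a by auto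
      qed
      then have "B x \<ge> 2"
      proof
        assume "x \<in> {real n + 1 - \<kappa> - a..real n + 1 - a}"
        then have "indicator {real n + 1 - \<kappa> - a..real n + 1 - a} x = (1 :: real)" by (simp only: indicator_simps)
        then show ?thesis unfolding B_def using k by simp
      next
        assume "x \<in> {real n + 2 - \<kappa> - a..real n + 2 - a}"
        then have "indicator {real n + 2 - \<kappa> - a..real n + 2 - a} x = (1 :: real)" by (simp only: indicator_simps)
        then show ?thesis unfolding B_def using k by simp
      qed
      moreover have "\<bar>g x - G x\<bar> \<le> 1"
        unfolding gG using frac_ge_0[of y] frac_lt_1[of y] frac_ge_0[of "y + e"] frac_lt_1[of "y + e"] by linarith
      ultimately have "2 * \<bar>g x - G x\<bar> \<le> B x" by (smt (verit))
      then show ?thesis by (rule order_trans[OF 1])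
    qed
  qed
  have ic: "((\<lambda>x. 2 * \<kappa>) has_integral 2 * \<kappa>) {real n..real (Suc n)}"
    using has_integral_const_real[of "2 * \<kappa>" "real n" "real (Suc n)"] by simp
  have hB: "(B has_integral 2 * \<kappa> + (2 * integral {real n..real (Suc n)} (indicator {real n + 1 - \<kappa> - a..real n + 1 - a})
      + 2 * integral {real n..real (Suc n)} (indicator {real n + 2 - \<kappa> - a..real n + 2 - a}))) {real n..real (Suc n)}"
    unfolding B_def by (intro has_integral_add has_integral_mult_right integrable_integral ib ic)
  then have iB: "B integrable_on {real n..real (Suc n)}" by blast
  have "integral {real n..real (Suc n)} B = 2 * \<kappa> + (2 * integral {real n..real (Suc n)} (indicator {real n + 1 - \<kappa> - a..real n + 1 - a})
      + 2 * integral {real n..real (Suc n)} (indicator {real n + 2 - \<kappa> - a..real n + 2 - a}))"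
    by (rule integral_unique[OF hB])
  also have "\<dots> \<le> 6 * \<kappa>"
    using integral_indicator_le[of "real n + 1 - \<kappa> - a" "real n + 1 - a" "real n" "real (Suc n)"]
      integral_indicator_le[of "real n + 2 - \<kappa> - a" "real n + 2 - a" "real n" "real (Suc n)"] k by simp
  finally have IB: "integral {real n..real (Suc n)} B \<le> 6 * \<kappa>" .
  have "\<bar>integral {real n..real (Suc n)} (\<lambda>x. (g x)\<^sup>2 - (G x)\<^sup>2)\<bar> \<le> integral {real n..real (Suc n)} B"
  proof -
    \<comment> \<open>The pointwise bound is available on the open interval; \<open>h\<close> blanks
      out the two end points, a null set, so that the integrals can be compared.\<close>
    define h where "h = (\<lambda>x. if x \<in> {real n, real (Suc n)} then 0 else (g x)\<^sup>2 - (G x)\<^sup>2)"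
    have "integral {real n..real (Suc n)} (\<lambda>x. (g x)\<^sup>2 - (G x)\<^sup>2) = integral {real n..real (Suc n)} h"
      by (rule integral_spike[of "{real n, real (Suc n)}"]) (auto simp: h_def)
    moreover have "h integrable_on {real n..real (Suc n)}"
      by (rule integrable_spike[OF integrable_diff[OF ig], of "{real n, real (Suc n)}"]) (auto simp: h_def)
    then have "norm (integral {real n..real (Suc n)} h) \<le> integral {real n..real (Suc n)} B"
    proof (rule integral_norm_bound_integral[OF _ iB])
      fix x assume x: "x \<in> {real n..real (Suc n)}"
      have "B x \<ge> 0" using k by (simp add: B_def)
      then show "norm (h x) \<le> B x" using bd[of x] x by (auto simp: h_def)
    qed
    ultimately show ?thesis by simp
  qed
  then have "\<bar>integral {real n..real (Suc n)} (\<lambda>x. (g x)\<^sup>2) - frac_bump (\<kappa> * real n)\<bar> \<le> 6 * \<kappa>"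
    unfolding Henstock_Kurzweil_Integration.integral_diff[OF ig] IG using IB by linarith
  then show ?thesis unfolding g_def .
qed

text \<open>Two replacements: the weight 1/x^2 is frozen at 1/n^2, and the mean square over the
  block is exchanged for the bump. Freezing costs 2/n^3 times the mass of the block. That this mass
  is O(\<kappa> n) and not merely O(1) is essential: otherwise the errors beyond a cutoff of size
  \<kappa>^(-1/2) would add up to order \<kappa>. The constant is 7 + 18.\<close>

lemma frac_gap_block_approx:
  fixes \<kappa> :: real
  assumes k: "0 < \<kappa>" "\<kappa> \<le> 1" and n: "n \<ge> 1"
  shows "\<bar>integral {real n..real (Suc n)} (\<lambda>x. frac_gap (1 + \<kappa>) x - frac_bump (\<kappa> * x) / x\<^sup>2)\<bar> \<le> 25 * \<kappa> / (real n)\<^sup>2"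
proof -
  let ?I = "{real n..real (Suc n)}"
  have n0: "real n > 0" using n by simp
  define g2 where "g2 = (\<lambda>x. (frac ((1 + \<kappa>) * x) - frac x)\<^sup>2)"
  define b where "b = (\<lambda>x. frac_bump (\<kappa> * x))"
  have [measurable]: "g2 \<in> borel_measurable borel" "b \<in> borel_measurable borel"
    by (simp_all add: g2_def b_def)
  have g2: "0 \<le> g2 x" "g2 x \<le> 1" for x
  proof -
    have "\<bar>frac ((1 + \<kappa>) * x) - frac x\<bar> \<le> 1"
      using frac_ge_0[of x] frac_lt_1[of x] frac_ge_0[of "(1 + \<kappa>) * x"] frac_lt_1[of "(1 + \<kappa>) * x"] by linarith
    then show "g2 x \<le> 1" "0 \<le> g2 x" by (auto simp: g2_def abs_square_le_1)
  qed
  have b: "0 \<le> b x" "b x \<le> 1" for x by (simp_all add: b_def frac_bump_bounds)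
  have ig: "g2 integrable_on ?I" "b integrable_on ?I"
    using g2 b by (auto intro!: bounded_borel_integrable_on[of _ _ _ 1])
  have Ig: "\<bar>integral ?I g2 - b (real n)\<bar> \<le> 6 * \<kappa>"
    using frac_shift_mean_square[OF k] by (simp add: g2_def b_def)
  have ic: "(\<lambda>x. b (real n)) integrable_on ?I" by (rule integrable_const_ivl)
  have "norm (integral ?I (\<lambda>x. b x - b (real n))) \<le> integral ?I (\<lambda>x. \<kappa>)"
  proof (rule integral_norm_bound_integral[OF integrable_diff[OF ig(2) ic] integrable_const_ivl])
    fix x assume x: "x \<in> ?I"
    have "\<bar>b x - b (real n)\<bar> \<le> \<kappa> * x - \<kappa> * real n"
      unfolding b_def by (rule frac_bump_lipschitz) (use x k in auto)
    also have "\<dots> = \<kappa> * (x - real n)" by (simp add: algebra_simps)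
    also have "\<dots> \<le> \<kappa> * 1" by (rule mult_left_mono) (use x k in auto)
    finally show "norm (b x - b (real n)) \<le> \<kappa>" by simp
  qed
  then have Ib: "\<bar>integral ?I b - b (real n)\<bar> \<le> \<kappa>"
    unfolding Henstock_Kurzweil_Integration.integral_diff[OF ig(2) ic] by simp
  define w where "w = (\<lambda>x::real. 1 / (real n)\<^sup>2 - 1 / x\<^sup>2)"
  have w: "0 \<le> w x" "w x \<le> 2 / real n ^ 3" if x: "x \<in> ?I" for x
  proof -
    have x': "real n \<le> x" "x \<le> real n + 1" "0 < x" using x n0 by auto
    then have "(real n)\<^sup>2 \<le> x\<^sup>2" by (intro power_mono) auto
    then show "0 \<le> w x" using n0 by (simp add: w_def frac_le)
    have "x\<^sup>2 \<le> (real n + 1)\<^sup>2" using x' by (intro power_mono) auto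
    then have "w x \<le> 1 / (real n)\<^sup>2 - 1 / (real n + 1)\<^sup>2"
      unfolding w_def using x' by (intro diff_left_mono frac_le) auto
    also have "\<dots> \<le> 2 / real n ^ 3"
    proof -
      have "2 / m ^ 3 - (1 / m\<^sup>2 - 1 / (m + 1)\<^sup>2) = (3 * m + 2) / (m ^ 3 * (m + 1)\<^sup>2)" if "m > 0" for m :: real
        using that by (simp add: divide_simps) (simp add: algebra_simps eval_nat_numeral)
      from this[OF n0] have "2 / real n ^ 3 - (1 / (real n)\<^sup>2 - 1 / (real n + 1)\<^sup>2) = (3 * real n + 2) / (real n ^ 3 * (real n + 1)\<^sup>2)" .
      moreover have "\<dots> \<ge> 0" using n0 by simp
      ultimately show ?thesis by linarith
    qed
    finally show "w x \<le> 2 / real n ^ 3" .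
  qed
  have wm: "(\<lambda>x. (g2 x - b x) * w x) integrable_on ?I"
  proof (rule bounded_borel_integrable_on[of _ _ _ "2 / real n ^ 3"])
    show "(\<lambda>x. (g2 x - b x) * w x) \<in> borel_measurable borel" unfolding w_def by measurable
    fix x assume x: "x \<in> ?I"
    have "\<bar>g2 x - b x\<bar> * \<bar>w x\<bar> \<le> 1 * (2 / real n ^ 3)"
      using g2[of x] b[of x] w[OF x] by (intro mult_mono) auto
    then show "\<bar>(g2 x - b x) * w x\<bar> \<le> 2 / real n ^ 3" by (simp add: abs_mult)
  qed
  have "norm (integral ?I (\<lambda>x. (g2 x - b x) * w x)) \<le> integral ?I (\<lambda>x. (g2 x + b x) * (2 / real n ^ 3))"
  proof (rule integral_norm_bound_integral[OF wm])
    show "(\<lambda>x. (g2 x + b x) * (2 / real n ^ 3)) integrable_on ?I"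
      by (intro integrable_on_mult_left integrable_add ig)
    fix x assume x: "x \<in> ?I"
    have "\<bar>g2 x - b x\<bar> * \<bar>w x\<bar> \<le> (g2 x + b x) * (2 / real n ^ 3)"
      using g2[of x] b[of x] w[OF x] by (intro mult_mono) auto
    then show "norm ((g2 x - b x) * w x) \<le> (g2 x + b x) * (2 / real n ^ 3)" by (simp add: abs_mult)
  qed
  also have "\<dots> = (integral ?I g2 + integral ?I b) * (2 / real n ^ 3)"
    by (subst Henstock_Kurzweil_Integration.integral_mult_left) (subst Henstock_Kurzweil_Integration.integral_add[OF ig], simp)
  \<comment> \<open>The integrals equal \<open>b (real n)\<close> up to 6 \<kappa> and \<kappa>; as
    \<open>b (real n)\<close> and \<kappa> are at most \<kappa> n, their sum is at most (2 + 7)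
    \<kappa> n.\<close>
  also have "\<dots> \<le> (9 * \<kappa> * real n) * (2 / real n ^ 3)"
  proof (rule mult_right_mono)
    have "b (real n) \<le> \<kappa> * real n" unfolding b_def by (rule frac_bump_bounds) (use k in auto)
    moreover have "\<kappa> \<le> \<kappa> * real n" using k n by (simp add: mult_le_cancel_left1)
    ultimately show "integral ?I g2 + integral ?I b \<le> 9 * \<kappa> * real n" using Ig Ib by linarith
  qed (use n0 in auto)
  also have "\<dots> = 18 * \<kappa> / (real n)\<^sup>2" using n0 by (simp add: power2_eq_square power3_eq_cube)
  finally have E2: "\<bar>integral ?I (\<lambda>x. (g2 x - b x) * w x)\<bar> \<le> 18 * \<kappa> / (real n)\<^sup>2" by simp
  have "integral ?I (\<lambda>x. frac_gap (1 + \<kappa>) x - frac_bump (\<kappa> * x) / x\<^sup>2)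
      = integral ?I (\<lambda>x. (g2 x - b x) * (1 / (real n)\<^sup>2) - (g2 x - b x) * w x)"
    by (rule integral_cong) (simp add: frac_gap_def g2_def b_def w_def right_diff_distrib diff_divide_distrib)
  also have "\<dots> = integral ?I (\<lambda>x. (g2 x - b x) * (1 / (real n)\<^sup>2)) - integral ?I (\<lambda>x. (g2 x - b x) * w x)"
    by (intro integral_diff integrable_on_mult_left integrable_diff ig wm)
  also have "integral ?I (\<lambda>x. (g2 x - b x) * (1 / (real n)\<^sup>2)) = (integral ?I g2 - integral ?I b) * (1 / (real n)\<^sup>2)"
    by (subst Henstock_Kurzweil_Integration.integral_mult_left) (subst Henstock_Kurzweil_Integration.integral_diff[OF ig], simp)
  finally have eq: "integral ?I (\<lambda>x. frac_gap (1 + \<kappa>) x - frac_bump (\<kappa> * x) / x\<^sup>2)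
    = (integral ?I g2 - integral ?I b) * (1 / (real n)\<^sup>2) - integral ?I (\<lambda>x. (g2 x - b x) * w x)" .
  have "\<bar>integral ?I g2 - integral ?I b\<bar> * (1 / (real n)\<^sup>2) \<le> (7 * \<kappa>) * (1 / (real n)\<^sup>2)"
    using Ig Ib by (intro mult_right_mono) auto
  then have "\<bar>(integral ?I g2 - integral ?I b) * (1 / (real n)\<^sup>2)\<bar> \<le> 7 * \<kappa> / (real n)\<^sup>2"
    by (simp add: abs_mult)
  moreover have "25 * \<kappa> / (real n)\<^sup>2 = 7 * \<kappa> / (real n)\<^sup>2 + 18 * \<kappa> / (real n)\<^sup>2"
    by (simp add: add_divide_distrib[symmetric])
  ultimately show ?thesis unfolding eq using E2 by linarith
qed

text \<open>Kept general in h because it occurs twice: with \<open>frac_bump\<close>, and with 1 -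
  exp (- v) for the exponential integral. In both cases h v behaves like v at 0+, which makes the
  tail logarithmic.\<close>

definition inv_square_tail :: "(real \<Rightarrow> real) \<Rightarrow> real \<Rightarrow> real" where
  "inv_square_tail h \<epsilon> = (LINT v:{\<epsilon>..}|lborel. h v / v\<^sup>2)"

lemma integrable_inv_power_tail:
  assumes "n > 1" "(\<epsilon> :: real) > 0"
  shows "set_integrable lborel {\<epsilon>..} (\<lambda>x::real. 1 / x ^ n)"
proof -
  have "(\<lambda>x::real. 1 / x ^ n) absolutely_integrable_on {\<epsilon>..}"
    by (rule nonnegative_absolutely_integrable_1)
      (use has_integral_inverse_power_to_inf[of n \<epsilon>] assms in \<open>auto simp: integrable_on_def\<close>)
  then show ?thesis
    unfolding set_integrable_def by (subst (asm) integrable_completion) auto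
qed

lemma set_integrable_inv_square:
  fixes h :: "real \<Rightarrow> real"
  assumes [measurable]: "h \<in> borel_measurable borel" and h: "\<And>v. v \<ge> 0 \<Longrightarrow> \<bar>h v\<bar> \<le> 1" and e: "\<epsilon> > 0"
  shows "set_integrable lborel {\<epsilon>..} (\<lambda>v. h v / v\<^sup>2)"
  unfolding set_integrable_def
proof (rule Bochner_Integration.integrable_bound)
  show "integrable lborel (\<lambda>x. indicator {\<epsilon>..} x *\<^sub>R (1 / x\<^sup>2))"
    using integrable_inv_power_tail[of 2 \<epsilon>] e by (simp add: set_integrable_def)
  show "AE v in lborel. norm (indicator {\<epsilon>..} v *\<^sub>R (h v / v\<^sup>2)) \<le> norm (indicator {\<epsilon>..} v *\<^sub>R (1 / v\<^sup>2))"
    using h e by (intro AE_I2) (auto simp: indicator_def intro!: divide_right_mono)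
qed measurable

lemma inv_square_tail_split:
  fixes h :: "real \<Rightarrow> real"
  assumes h: "h \<in> borel_measurable borel" "\<And>v. v \<ge> 0 \<Longrightarrow> \<bar>h v\<bar> \<le> 1" and e: "0 < \<epsilon>" "\<epsilon> \<le> 1"
  shows "inv_square_tail h \<epsilon> = integral {\<epsilon>..1} (\<lambda>v. h v / v\<^sup>2) + inv_square_tail h 1"
proof -
  define g where "g = (\<lambda>v::real. h v / v\<^sup>2)"
  have int: "set_integrable lborel {\<epsilon>..} g" "set_integrable lborel {1..} g"
    using set_integrable_inv_square[OF h] e by (auto simp: g_def)
  have "((\<lambda>b. integral {\<epsilon>..b} g) \<longlongrightarrow> inv_square_tail h \<epsilon>) at_top"
    using integral_halfline_tendsto[OF int(1)] by (simp add: inv_square_tail_def g_def)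
  moreover have "((\<lambda>b. integral {\<epsilon>..1} g + integral {1..b} g) \<longlongrightarrow> integral {\<epsilon>..1} g + inv_square_tail h 1) at_top"
    using integral_halfline_tendsto[OF int(2)] by (intro tendsto_intros) (simp add: inv_square_tail_def g_def)
  moreover have "eventually (\<lambda>b. integral {\<epsilon>..1} g + integral {1..b} g = integral {\<epsilon>..b} g) at_top"
    using eventually_ge_at_top[of 1]
  proof eventually_elim
    case (elim b)
    have "g integrable_on {\<epsilon>..b}"
      by (rule set_borel_integral_eq_integral(1)[OF set_integrable_subset[OF int(1)]]) auto
    then show ?case using Henstock_Kurzweil_Integration.integral_combine[of \<epsilon> 1 b g] e elim by simp
  qed
  ultimately have "inv_square_tail h \<epsilon> = integral {\<epsilon>..1} g + inv_square_tail h 1"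
    by (rule tendsto_unique[OF trivial_limit_at_top_linorder _ Lim_transform_eventually])
  then show ?thesis by (simp add: g_def)
qed

lemma inv_square_tail_scale:
  fixes h :: "real \<Rightarrow> real"
  assumes h: "h \<in> borel_measurable borel" "\<And>v. v \<ge> 0 \<Longrightarrow> \<bar>h v\<bar> \<le> 1" and k: "\<kappa> > 0" and m: "m > 0"
  shows "set_integrable lborel {m..} (\<lambda>x. h (\<kappa> * x) / x\<^sup>2)"
    and "(LINT x:{m..}|lborel. h (\<kappa> * x) / x\<^sup>2) = \<kappa> * inv_square_tail h (\<kappa> * m)"
proof -
  define g where "g = (\<lambda>v::real. indicator {\<kappa> * m..} v *\<^sub>R (h v / v\<^sup>2))"
  have "\<kappa> * m > 0" using k m by simp
  from set_integrable_inv_square[OF h this] have g: "integrable lborel g"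
    unfolding g_def set_integrable_def .
  have e: "\<kappa>\<^sup>2 * g (0 + \<kappa> * x) = indicator {m..} x *\<^sub>R (h (\<kappa> * x) / x\<^sup>2)" for x
    using k by (auto simp: g_def indicator_def power_mult_distrib)
  have "integrable lborel (\<lambda>x. \<kappa>\<^sup>2 * g (0 + \<kappa> * x))"
    by (intro integrable_mult_right lborel_integrable_real_affine[OF g]) (use k in auto)
  then show "set_integrable lborel {m..} (\<lambda>x. h (\<kappa> * x) / x\<^sup>2)"
    unfolding e set_integrable_def .
  have "(LINT x:{m..}|lborel. h (\<kappa> * x) / x\<^sup>2) = (\<integral>x. \<kappa>\<^sup>2 * g (0 + \<kappa> * x) \<partial>lborel)"
    unfolding e set_lebesgue_integral_def ..
  also have "\<dots> = \<kappa> * (\<kappa> * (\<integral>x. g (0 + \<kappa> * x) \<partial>lborel))" by (simp add: power2_eq_square mult.assoc)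
  also have "\<kappa> * (\<integral>x. g (0 + \<kappa> * x) \<partial>lborel) = (\<integral>x. g x \<partial>lborel)"
    using lborel_integral_real_affine[of \<kappa> g 0] k by simp
  finally show "(LINT x:{m..}|lborel. h (\<kappa> * x) / x\<^sup>2) = \<kappa> * inv_square_tail h (\<kappa> * m)"
    by (simp add: inv_square_tail_def g_def set_lebesgue_integral_def)
qed

abbreviation bump_tail :: "real \<Rightarrow> real" where
  "bump_tail \<equiv> inv_square_tail frac_bump"

lemma frac_bump_abs_le: "\<bar>frac_bump v\<bar> \<le> 1"
  using frac_bump_bounds[of v] by simp

text \<open>Below 1 the integrand is 1/v - 1, whose primitive supplies the logarithm in the
  expansion. The value \<open>bump_tail 1\<close> stays as an unevaluated constant.\<close>

lemma bump_tail_eq: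
  assumes e: "0 < \<epsilon>" "\<epsilon> \<le> 1"
  shows "bump_tail \<epsilon> = bump_tail 1 - ln \<epsilon> - 1 + \<epsilon>"
proof -
  define h where "h = (\<lambda>v::real. frac_bump v / v\<^sup>2)"
  have "(h has_integral ((ln 1 - 1) - (ln \<epsilon> - \<epsilon>))) (cbox \<epsilon> 1)"
  proof (rule has_integral_spike_interior)
    show "((\<lambda>v. 1 / v - 1) has_integral ((ln 1 - 1) - (ln \<epsilon> - \<epsilon>))) (cbox \<epsilon> 1)"
      unfolding cbox_interval
      by (rule fundamental_theorem_of_calculus[OF e(2)])
        (use e in \<open>auto intro!: derivative_eq_intros simp: has_real_derivative_iff_has_vector_derivative[symmetric] divide_inverse\<close>)
    fix x assume "x \<in> box \<epsilon> 1"
    then have x: "0 < x" "x < 1" using e by (auto simp: box_real)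
    then have "frac x = x" by (simp add: frac_eq)
    then show "h x = 1 / x - 1" using x by (simp add: h_def frac_bump_def power2_eq_square field_simps)
  qed
  then have "integral {\<epsilon>..1} h = - ln \<epsilon> - 1 + \<epsilon>" by (simp add: integral_unique)
  then show ?thesis
    using inv_square_tail_split[OF frac_bump_measurable frac_bump_abs_le e] by (simp add: h_def)
qed

text \<open>Exact values up to M, the bump model from M on. The block errors 25 \<kappa> / N^2 are
  dominated by 50 \<kappa> (1/N - 1/(N + 1)) and telescope to at most 50 \<kappa> / M.\<close>

lemma frac_gap_total:
  assumes k: "0 < \<kappa>" "\<kappa> \<le> 1" and M: "M \<ge> 1" "real M * \<kappa> \<le> 1"
  shows "\<bar>integral {0<..} (frac_gap (1 + \<kappa>)) - (\<kappa> * harm M + real M * (\<kappa>\<^sup>2 - 2 * \<kappa> * ln (1 + \<kappa>)) + \<kappa> * bump_tail (\<kappa> * real M))\<bar>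
    \<le> 50 * \<kappa> / real M"
proof -
  define f where "f = frac_gap (1 + \<kappa>)"
  have [measurable]: "f \<in> borel_measurable borel" by (simp add: f_def)
  define f2 where "f2 = (\<lambda>x. frac_bump (\<kappa> * x) / x\<^sup>2)"
  define c where "c = \<kappa> * harm M + real M * (\<kappa>\<^sup>2 - 2 * \<kappa> * ln (1 + \<kappa>))"
  have M0: "real M > 0" using M by simp
  have "frac_gap (exp (ln (1 + \<kappa>))) absolutely_integrable_on {0<..}"
    by (rule autocorrelation_eq_frac_gap)
  then have "f absolutely_integrable_on {0<..}" using k by (simp add: f_def)
  then have 1: "set_integrable lborel {0<..} f"
    unfolding set_integrable_def by (subst (asm) integrable_completion) auto
  \<comment> \<open>\<open>frac_gap\<close> vanishes at 0, so the half-lines with and without 0 may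
    be exchanged.\<close>
  have e: "indicator {0..} x *\<^sub>R f x = indicator {0<..} x *\<^sub>R f x" for x
    by (auto simp: indicator_def f_def frac_gap_def)
  have 2: "set_integrable lborel {0..} f" using 1 unfolding set_integrable_def e .
  have D: "(LINT x:{0..}|lborel. f x) = integral {0<..} f"
    using set_borel_integral_eq_integral(2)[OF 1] unfolding set_lebesgue_integral_def e .
  note f2 = inv_square_tail_scale[OF frac_bump_measurable frac_bump_abs_le k(1) M0, folded f2_def]
  have iM: "f integrable_on {a..b}" if "a \<ge> 0" for a b
    by (rule set_borel_integral_eq_integral(1)[OF set_integrable_subset[OF 2]]) (use that in auto)
  have iM2: "f2 integrable_on {a..b}" if "a \<ge> real M" for a b
    by (rule set_borel_integral_eq_integral(1)[OF set_integrable_subset[OF f2(1)]]) (use that in auto)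
  have IM: "integral {0..real M} f = c"
    unfolding f_def c_def by (rule integral_unique[OF frac_gap_initial_exact[OF k(1) M(2)]])
  have diff: "\<bar>integral {real M..real N} (\<lambda>x. f x - f2 x)\<bar> \<le> 50 * \<kappa> * (1 / real M - 1 / real N)" if "N \<ge> M" for N
    using that
  proof (induction N rule: dec_induct)
    case base
    then show ?case by simp
  next
    case (step N)
    have N0: "real N > 0" "N \<ge> 1" using step M by auto
    have "integral {real M..real (Suc N)} (\<lambda>x. f x - f2 x) = integral {real M..real N} (\<lambda>x. f x - f2 x)
        + integral {real N..real (Suc N)} (\<lambda>x. f x - f2 x)"
      by (rule Henstock_Kurzweil_Integration.integral_combine[symmetric])
        (use step in \<open>auto intro!: integrable_diff iM iM2\<close>)
    moreover have "\<bar>integral {real N..real (Suc N)} (\<lambda>x. f x - f2 x)\<bar> \<le> 25 * \<kappa> / (real N)\<^sup>2"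
      unfolding f_def f2_def by (rule frac_gap_block_approx[OF k N0(2)])
    moreover have "25 * \<kappa> / (real N)\<^sup>2 \<le> 50 * \<kappa> * (1 / real N - 1 / real (Suc N))"
    proof -
      have "50 * \<kappa> * (1 / m - 1 / (m + 1)) - 25 * \<kappa> / m\<^sup>2 = 25 * \<kappa> * (m - 1) / (m\<^sup>2 * (m + 1))" if "m > 0" for m
        using that by (simp add: divide_simps) (simp add: algebra_simps eval_nat_numeral)
      from this[OF N0(1)] have "50 * \<kappa> * (1 / real N - 1 / real (Suc N)) - 25 * \<kappa> / (real N)\<^sup>2 = 25 * \<kappa> * (real N - 1) / ((real N)\<^sup>2 * real (Suc N))"
        by (simp add: add.commute)
      also have "\<dots> \<ge> 0" using k N0 by (intro divide_nonneg_nonneg mult_nonneg_nonneg) auto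
      finally show ?thesis by simp
    qed
    ultimately show ?case using step.IH by (simp add: right_diff_distrib)
  qed
  have lim: "filterlim real at_top sequentially" by (rule filterlim_real_sequentially)
  have "(\<lambda>N. integral {0..real N} f - c - integral {real M..real N} f2) \<longlonglongrightarrow> integral {0<..} f - c - \<kappa> * bump_tail (\<kappa> * real M)"
    using filterlim_compose[OF integral_halfline_tendsto[OF 2] lim] filterlim_compose[OF integral_halfline_tendsto[OF f2(1)] lim]
    unfolding D f2(2) by (intro tendsto_intros)
  then have "(\<lambda>N. \<bar>integral {0..real N} f - c - integral {real M..real N} f2\<bar>) \<longlonglongrightarrow> \<bar>integral {0<..} f - c - \<kappa> * bump_tail (\<kappa> * real M)\<bar>"
    by (rule tendsto_rabs)
  then have "\<bar>integral {0<..} f - c - \<kappa> * bump_tail (\<kappa> * real M)\<bar> \<le> 50 * \<kappa> / real M"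
  proof (rule tendsto_upperbound)
    show "\<forall>\<^sub>F N in sequentially. \<bar>integral {0..real N} f - c - integral {real M..real N} f2\<bar> \<le> 50 * \<kappa> / real M"
      using eventually_ge_at_top[of M]
    proof eventually_elim
      case (elim N)
      have "integral {0..real N} f = integral {0..real M} f + integral {real M..real N} f"
        by (rule Henstock_Kurzweil_Integration.integral_combine[symmetric]) (use elim in \<open>auto intro!: iM\<close>)
      then have "integral {0..real N} f - c - integral {real M..real N} f2 = integral {real M..real N} (\<lambda>x. f x - f2 x)"
        using IM by (simp add: Henstock_Kurzweil_Integration.integral_diff[OF iM iM2])
      moreover have "50 * \<kappa> * (1 / real M - 1 / real N) \<le> 50 * \<kappa> / real M"
        using k by (simp add: right_diff_distrib)
      ultimately show ?case using diff[OF elim] by simp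
    qed
  qed auto
  then show ?thesis by (simp add: f_def c_def algebra_simps)
qed

text \<open>A cutoff M near \<kappa>^(-1/2) balances the model error of order \<kappa> / M against M
  \<kappa>^2 from the exact part; both are then of size \<kappa>^(3/2). The logarithms of M in the
  harmonic number and in the tail cancel. The constant collects 100 + 2 + 1 + 1.\<close>

lemma frac_gap_expansion:
  assumes k: "0 < \<kappa>" "\<kappa> \<le> 1"
  shows "\<bar>integral {0<..} (frac_gap (1 + \<kappa>)) - (\<kappa> * ln (1 / \<kappa>) + (euler_mascheroni + bump_tail 1 - 1) * \<kappa>)\<bar>
    \<le> 104 * (\<kappa> * sqrt \<kappa>)"
proof -
  define r where "r = 1 / sqrt \<kappa>"
  have r: "r \<ge> 1" "sqrt \<kappa> > 0" using k by (auto simp: r_def)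
  define M where "M = nat \<lfloor>r\<rfloor>"
  have M: "real M \<le> r" "real M > r - 1" "M \<ge> 1" using r by (auto simp: M_def) linarith+
  have M0: "real M > 0" using M by simp
  have "real M \<ge> r / 2" using M r by (cases "r \<ge> 2") auto
  then have iM: "1 / real M \<le> 2 * sqrt \<kappa>"
    using M0 r by (simp add: r_def field_simps)
  have sk: "sqrt \<kappa> * sqrt \<kappa> = \<kappa>" using k by simp
  have "real M * \<kappa> \<le> r * \<kappa>" using M k by (intro mult_right_mono) auto
  also have "r * \<kappa> = r * (sqrt \<kappa> * sqrt \<kappa>)" by (simp only: sk)
  also have "\<dots> = sqrt \<kappa>" using r(2) unfolding r_def by (simp del: real_sqrt_mult_self)
  finally have Mk: "real M * \<kappa> \<le> sqrt \<kappa>" .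
  have Mk1: "real M * \<kappa> \<le> 1" using Mk k real_sqrt_le_1_iff[of \<kappa>] by linarith
  have kM: "0 < \<kappa> * real M" "\<kappa> * real M \<le> 1" using k M0 Mk1 by (auto simp: mult.commute)
  have bt: "bump_tail (\<kappa> * real M) = bump_tail 1 - ln \<kappa> - ln (real M) - 1 + \<kappa> * real M"
    using bump_tail_eq[OF kM] ln_mult[of \<kappa> "real M"] k M0 by simp
  have h: "\<bar>harm M - ln (real M) - euler_mascheroni\<bar> \<le> 1 / real M"
  proof -
    have "ln (real (Suc M)) - ln (real M) = ln (real (Suc M) / real M)" using M0 by (simp add: ln_div)
    also have "\<dots> = ln (1 + 1 / real M)" using M0 by (simp add: add_divide_distrib add.commute)
    also have "\<dots> \<le> 1 / real M" using M0 by (intro ln_add_one_self_le_self) auto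
    finally have "ln (real (Suc M)) - ln (real M) \<le> 1 / real M" .
    moreover have "ln (real (Suc M)) \<ge> ln (real M)" using M0 by simp
    moreover have "inverse (real (2 * M)) \<le> 1 / real M" using M0 by (simp add: field_simps)
    moreover have "inverse (real (2 * (M + 1))) \<ge> 0" by simp
    ultimately show ?thesis using euler_mascheroni_bounds[OF M(3)] by (simp only: atLeastAtMost_iff of_nat_Suc) linarith
  qed
  have l: "0 \<le> ln (1 + \<kappa>)" "ln (1 + \<kappa>) \<le> \<kappa>" using k by (auto intro: ln_add_one_self_le_self)
  define E1 where "E1 = \<kappa> * (harm M - ln (real M) - euler_mascheroni)"
  have E1: "\<bar>E1\<bar> \<le> \<kappa> * (1 / real M)" unfolding E1_def abs_mult using h k by (intro mult_mono) auto
  define E2 where "E2 = real M * (\<kappa>\<^sup>2 - 2 * \<kappa> * ln (1 + \<kappa>))"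
  have "\<kappa> * ln (1 + \<kappa>) \<le> \<kappa> * \<kappa>" "0 \<le> \<kappa> * ln (1 + \<kappa>)"
    using l k by (auto intro!: mult_left_mono mult_nonneg_nonneg)
  then have "\<bar>\<kappa>\<^sup>2 - 2 * \<kappa> * ln (1 + \<kappa>)\<bar> \<le> \<kappa>\<^sup>2"
    unfolding power2_eq_square mult.assoc by linarith
  then have E2: "\<bar>E2\<bar> \<le> real M * \<kappa>\<^sup>2" unfolding E2_def abs_mult by (intro mult_mono) auto
  define E where "E = integral {0<..} (frac_gap (1 + \<kappa>)) - (\<kappa> * harm M + E2 + \<kappa> * bump_tail (\<kappa> * real M))"
  have E: "\<bar>E\<bar> \<le> 50 * (\<kappa> * (1 / real M))"
    using frac_gap_total[OF k M(3) Mk1] by (simp add: E_def E2_def)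
  have "integral {0<..} (frac_gap (1 + \<kappa>)) - (\<kappa> * ln (1 / \<kappa>) + (euler_mascheroni + bump_tail 1 - 1) * \<kappa>)
      = E + E1 + E2 + \<kappa> * (\<kappa> * real M)"
    unfolding E_def E1_def bt using k by (simp add: ln_div algebra_simps)
  moreover have "\<kappa> * (1 / real M) \<le> \<kappa> * (2 * sqrt \<kappa>)" using iM k by (intro mult_left_mono) auto
  moreover have "\<kappa> * (\<kappa> * real M) \<le> \<kappa> * sqrt \<kappa>" "\<kappa> * (\<kappa> * real M) \<ge> 0"
    using Mk k by (auto intro!: mult_left_mono simp: mult.commute)
  moreover have "real M * \<kappa>\<^sup>2 = \<kappa> * (\<kappa> * real M)" by (simp add: power2_eq_square)
  ultimately show ?thesis using E E1 E2 by (simp only:)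
qed

text \<open>The expansion of the gap integral is taken at \<kappa> = exp v - 1. Passing from
  \<kappa> to v and inserting the factors cosh (v / 2) and exp (- v / 2) changes the main terms by
  O(v^2), which is below v^(3/2).\<close>

lemma autocorrelation_sawtooth_expansion:
  fixes b :: real
  defines "R \<equiv> autocorrelation sawtooth_kernel" and "b \<equiv> euler_mascheroni + bump_tail 1 - 1"
  shows "(\<lambda>v. R v - (R 0 - (v * ln (1 / v) + b * v) / 2)) \<in> O[at_right 0](\<lambda>v. v powr (3/2))"
proof -
  define err where "err = (\<lambda>v. integral {0<..} (frac_gap (exp v)) - ((exp v - 1) * ln (1 / (exp v - 1)) + b * (exp v - 1)))"
  have cm: "(\<lambda>v. c * f v) \<in> O[at_right 0](g)" if "f \<in> O[at_right 0](g)" for c :: real and f g :: "real \<Rightarrow> real"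
    using that by (cases "c = 0") auto
  have "err \<in> O[at_right 0](\<lambda>v. (exp v - 1) * sqrt (exp v - 1))"
  proof (rule bigoI[of _ 104])
    have "eventually (\<lambda>v::real. exp v - 1 \<le> 1) (at_right 0)" by real_asymp
    then show "\<forall>\<^sub>F v in at_right 0. norm (err v) \<le> 104 * norm ((exp v - 1) * sqrt (exp v - 1))"
      using eventually_at_right_less[of "0::real"]
    proof eventually_elim
      case (elim v)
      then show ?case using frac_gap_expansion[of "exp v - 1"] by (simp add: err_def b_def)
    qed
  qed
  also have "(\<lambda>v::real. (exp v - 1) * sqrt (exp v - 1)) \<in> O[at_right 0](\<lambda>v. v powr (3/2))"
    by real_asymp
  finally have err: "err \<in> O[at_right 0](\<lambda>v. v powr (3/2))" .
  have "(\<lambda>v. exp (- v / 2) * err v) \<in> O[at_right 0](\<lambda>v. 1 * v powr (3/2))"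
    by (rule landau_o.big.mult[OF _ err]) real_asymp
  then have err': "(\<lambda>v. exp (- v / 2) * err v) \<in> O[at_right 0](\<lambda>v. v powr (3/2))" by simp
  have a1: "(\<lambda>v::real. cosh (v / 2) - 1) \<in> O[at_right 0](\<lambda>v. v powr (3/2))"
    unfolding cosh_field_def by real_asymp
  have a2: "(\<lambda>v::real. exp (- v / 2) * (exp v - 1) - v) \<in> O[at_right 0](\<lambda>v. v powr (3/2))"
    by real_asymp
  have a3: "(\<lambda>v::real. exp (- v / 2) * ((exp v - 1) * ln (1 / (exp v - 1))) - v * ln (1 / v)) \<in> O[at_right 0](\<lambda>v. v powr (3/2))"
    by real_asymp
  have "(\<lambda>v. R 0 * (cosh (v / 2) - 1) + (- 1/2) * (exp (- v / 2) * ((exp v - 1) * ln (1 / (exp v - 1))) - v * ln (1 / v))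
     + (- b / 2) * (exp (- v / 2) * (exp v - 1) - v) + (- 1/2) * (exp (- v / 2) * err v)) \<in> O[at_right 0](\<lambda>v. v powr (3/2))"
    by (intro sum_in_bigo(1) cm a1 a2 a3 err')
  moreover have "R v - (R 0 - (v * ln (1 / v) + b * v) / 2) = R 0 * (cosh (v / 2) - 1) + (- 1/2) * (exp (- v / 2) * ((exp v - 1) * ln (1 / (exp v - 1))) - v * ln (1 / v))
     + (- b / 2) * (exp (- v / 2) * (exp v - 1) - v) + (- 1/2) * (exp (- v / 2) * err v)" for v
    unfolding R_def autocorrelation_eq_frac_gap(2)[of v] err_def by (simp add: field_simps)
  ultimately show ?thesis by simp
qed

section \<open>Iterated averages\<close>

text \<open>One-sided windows: the average at T involves only values from T on, so all comparisons
  stay on a half-line \<open>{c..}\<close>, where the model density is known to be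
  nonnegative.\<close>

definition forward_avg :: "real \<Rightarrow> (real \<Rightarrow> 'a::euclidean_space) \<Rightarrow> real \<Rightarrow> 'a" where
  "forward_avg \<Delta> f T = (1 / \<Delta>) *\<^sub>R integral {0..\<Delta>} (\<lambda>a. f (T + a))"

lemma continuous_on_shift_pair:
  assumes "continuous_on {c..} f"
  shows "continuous_on ({c..} \<times> cbox 0 \<Delta>) (\<lambda>(T, a). f (T + a :: real))"
  unfolding case_prod_unfold
  by (rule continuous_on_compose2[OF assms]) (auto intro!: continuous_intros)

lemma forward_avg_integrable:
  fixes f :: "real \<Rightarrow> 'a::euclidean_space"
  assumes "continuous_on {c..} f" "T \<ge> c"
  shows "(\<lambda>a. f (T + a)) integrable_on {0..\<Delta>}"
  by (intro integrable_continuous_interval continuous_on_compose2[OF assms(1)] continuous_intros)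
    (use assms(2) in auto)

lemma continuous_on_forward_avg:
  fixes f :: "real \<Rightarrow> 'a::euclidean_space"
  assumes "continuous_on {c..} f"
  shows "continuous_on {c..} (forward_avg \<Delta> f)"
  unfolding forward_avg_def[abs_def]
  using integral_continuous_on_param[OF continuous_on_shift_pair[OF assms, of \<Delta>]]
  by (intro continuous_intros) simp

lemma forward_avg_diff:
  fixes f g :: "real \<Rightarrow> 'a::euclidean_space"
  assumes "continuous_on {c..} f" "continuous_on {c..} g" "T \<ge> c"
  shows "forward_avg \<Delta> (\<lambda>t. f t - g t) T = forward_avg \<Delta> f T - forward_avg \<Delta> g T"
  unfolding forward_avg_def
  by (subst Henstock_Kurzweil_Integration.integral_diff)
    (auto intro!: forward_avg_integrable[OF assms(1,3)] forward_avg_integrable[OF assms(2,3)] simp: scaleR_diff_right)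

lemma forward_avg_cong:
  assumes "\<And>t. t \<ge> T \<Longrightarrow> f t = g t"
  shows "forward_avg \<Delta> f T = forward_avg \<Delta> g T"
  unfolding forward_avg_def by (intro arg_cong[of _ _ "\<lambda>x. (1/\<Delta>) *\<^sub>R x"] integral_cong assms) auto

lemma forward_avg_nonneg:
  fixes f :: "real \<Rightarrow> real"
  assumes "\<And>t. t \<ge> c \<Longrightarrow> f t \<ge> 0" "T \<ge> c" "\<Delta> > 0"
  shows "forward_avg \<Delta> f T \<ge> 0"
proof -
  have "integral {0..\<Delta>} (\<lambda>a. f (T + a)) \<ge> 0"
    by (cases "(\<lambda>a. f (T + a)) integrable_on {0..\<Delta>}")
      (use assms in \<open>auto intro!: Henstock_Kurzweil_Integration.integral_nonneg simp: not_integrable_integral\<close>)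
  then show ?thesis using assms(3) by (simp add: forward_avg_def)
qed

text \<open>After exchanging the integrations, the integral of the average is the mean over s in
  [0, \<Delta>] of the integrals over [a + s, b + s]. Each of these intervals lies in
  [a, b + \<Delta>] and contains [a + \<Delta>, b]; nonnegativity gives both bounds.\<close>

lemma integral_forward_avg:
  fixes f :: "real \<Rightarrow> real"
  assumes f: "continuous_on {c..} f" "\<And>t. t \<ge> c \<Longrightarrow> f t \<ge> 0" and c: "c \<le> a" and D: "\<Delta> > 0"
  shows integral_forward_avg_le: "integral {a..b} (forward_avg \<Delta> f) \<le> integral {a..b + \<Delta>} f"
    and integral_forward_avg_ge: "integral {a + \<Delta>..b} f \<le> integral {a..b} (forward_avg \<Delta> f)"
proof -
  have int: "f integrable_on {u..v}" if "u \<ge> c" for u v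
    by (rule integrable_continuous_interval[OF continuous_on_subset[OF f(1)]]) (use that in auto)
  show "integral {a..b} (forward_avg \<Delta> f) \<le> integral {a..b + \<Delta>} f"
    "integral {a + \<Delta>..b} f \<le> integral {a..b} (forward_avg \<Delta> f)"
  proof -
    have "continuous_on (cbox (a, 0) (b, \<Delta>)) (\<lambda>(T, s). f (T + s))"
      by (rule continuous_on_subset[OF continuous_on_shift_pair[OF f(1), of \<Delta>]]) (use c in \<open>auto simp: cbox_Pair_eq\<close>)
    then have "integral {a..b} (\<lambda>T. integral {0..\<Delta>} (\<lambda>s. f (T + s))) = integral {0..\<Delta>} (\<lambda>s. integral {a..b} (\<lambda>T. f (T + s)))"
      using integral_swap_continuous[of a 0 b \<Delta> "\<lambda>T s. f (T + s)"] by simp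
    moreover have "integral {a..b} (\<lambda>T. f (T + s)) = integral {a + s..b + s} f" if "s \<in> {0..\<Delta>}" for s
      using integral_shift[OF continuous_on_subset[OF f(1)], of a s b] that c by (auto simp: o_def)
    then have "integral {0..\<Delta>} (\<lambda>s. integral {a..b} (\<lambda>T. f (T + s))) = integral {0..\<Delta>} (\<lambda>s. integral {a + s..b + s} f)"
      by (rule Henstock_Kurzweil_Integration.integral_cong)
    ultimately have eq: "integral {a..b} (forward_avg \<Delta> f) = (1 / \<Delta>) * integral {0..\<Delta>} (\<lambda>s. integral {a + s..b + s} f)"
      unfolding forward_avg_def[abs_def] by simp
    have ints: "(\<lambda>s. integral {a + s..b + s} f) integrable_on {0..\<Delta>}"
    proof -
      have "continuous_on ({0..} \<times> cbox a b) (\<lambda>(s, T). f (T + s))"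
        unfolding case_prod_unfold
        by (rule continuous_on_compose2[OF f(1)]) (use c in \<open>auto intro!: continuous_intros\<close>)
      from integral_continuous_on_param[OF this]
      have "continuous_on {0..} (\<lambda>s. integral {a..b} (\<lambda>T. f (T + s)))" by simp
      then have "(\<lambda>s. integral {a..b} (\<lambda>T. f (T + s))) integrable_on {0..\<Delta>}"
        by (intro integrable_continuous_interval) (auto elim: continuous_on_subset)
      moreover have "integral {a..b} (\<lambda>T. f (T + s)) = integral {a + s..b + s} f" if "s \<in> {0..\<Delta>}" for s
        using integral_shift[OF continuous_on_subset[OF f(1)], of a s b] that c by (auto simp: o_def)
      ultimately show ?thesis by (rule integrable_eq)
    qed
    have "integral {0..\<Delta>} (\<lambda>s. integral {a + s..b + s} f) \<le> integral {0..\<Delta>} (\<lambda>s. integral {a..b + \<Delta>} f)"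
      by (rule integral_le[OF ints integrable_const_ivl])
        (intro integral_subset_le int; use c f in auto)
    also have "\<dots> = \<Delta> * integral {a..b + \<Delta>} f" using D by simp
    finally show "integral {a..b} (forward_avg \<Delta> f) \<le> integral {a..b + \<Delta>} f"
      unfolding eq using D by (simp add: field_simps)
    have "\<Delta> * integral {a + \<Delta>..b} f = integral {0..\<Delta>} (\<lambda>s. integral {a + \<Delta>..b} f)" using D by simp
    also have "\<dots> \<le> integral {0..\<Delta>} (\<lambda>s. integral {a + s..b + s} f)"
      by (rule integral_le[OF integrable_const_ivl ints])
        (intro integral_subset_le int; use c f in auto)
    finally show "integral {a + \<Delta>..b} f \<le> integral {a..b} (forward_avg \<Delta> f)"
      unfolding eq using D by (simp add: field_simps)
  qed
qed

abbreviation forward_avg3 :: "real \<Rightarrow> (real \<Rightarrow> 'a::euclidean_space) \<Rightarrow> real \<Rightarrow> 'a" where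
  "forward_avg3 \<Delta> f \<equiv> forward_avg \<Delta> (forward_avg \<Delta> (forward_avg \<Delta> f))"

lemma integral_forward_avg3:
  fixes f :: "real \<Rightarrow> real"
  assumes f: "continuous_on {c..} f" "\<And>t. t \<ge> c \<Longrightarrow> f t \<ge> 0" and c: "c \<le> a" and D: "\<Delta> > 0"
  shows integral_forward_avg3_le: "integral {a..b} (forward_avg3 \<Delta> f) \<le> integral {a..b + 3 * \<Delta>} f"
    and integral_forward_avg3_ge: "integral {a + 3 * \<Delta>..b} f \<le> integral {a..b} (forward_avg3 \<Delta> f)"
proof -
  let ?f1 = "forward_avg \<Delta> f" and ?f2 = "forward_avg \<Delta> (forward_avg \<Delta> f)"
  have c1: "continuous_on {c..} ?f1" and c2: "continuous_on {c..} ?f2"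
    by (intro continuous_on_forward_avg f(1))+
  have p1: "?f1 t \<ge> 0" if "t \<ge> c" for t by (rule forward_avg_nonneg[OF f(2) that D])
  have p2: "?f2 t \<ge> 0" if "t \<ge> c" for t by (rule forward_avg_nonneg[OF p1 that D])
  have "integral {a..b} (forward_avg3 \<Delta> f) \<le> integral {a..b + \<Delta>} ?f2"
    by (rule integral_forward_avg_le[OF c2 p2 c D])
  also have "\<dots> \<le> integral {a..b + \<Delta> + \<Delta>} ?f1" by (rule integral_forward_avg_le[OF c1 p1 c D])
  also have "\<dots> \<le> integral {a..b + \<Delta> + \<Delta> + \<Delta>} f" by (rule integral_forward_avg_le[OF f c D])
  finally show "integral {a..b} (forward_avg3 \<Delta> f) \<le> integral {a..b + 3 * \<Delta>} f" by (simp add: algebra_simps)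
  have "integral {a + 3 * \<Delta>..b} f = integral {a + \<Delta> + \<Delta> + \<Delta>..b} f" by (simp add: algebra_simps)
  also have "\<dots> \<le> integral {a + \<Delta> + \<Delta>..b} ?f1" by (rule integral_forward_avg_ge[OF f _ D]) (use c D in auto)
  also have "\<dots> \<le> integral {a + \<Delta>..b} ?f2" by (rule integral_forward_avg_ge[OF c1 p1 _ D]) (use c D in auto)
  also have "\<dots> \<le> integral {a..b} (forward_avg3 \<Delta> f)" by (rule integral_forward_avg_ge[OF c2 p2 c D])
  finally show "integral {a + 3 * \<Delta>..b} f \<le> integral {a..b} (forward_avg3 \<Delta> f)" .
qed

lemma forward_avg3_diff:
  fixes f g :: "real \<Rightarrow> 'a::euclidean_space"
  assumes "continuous_on {c..} f" "continuous_on {c..} g" "T \<ge> c" "\<Delta> > 0"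
  shows "forward_avg3 \<Delta> (\<lambda>t. f t - g t) T = forward_avg3 \<Delta> f T - forward_avg3 \<Delta> g T"
proof -
  note c = continuous_on_forward_avg
  have 1: "forward_avg \<Delta> (\<lambda>t. f t - g t) t = forward_avg \<Delta> f t - forward_avg \<Delta> g t" if "t \<ge> c" for t
    by (rule forward_avg_diff[OF assms(1,2) that])
  have 2: "forward_avg \<Delta> (forward_avg \<Delta> (\<lambda>t. f t - g t)) t = forward_avg \<Delta> (forward_avg \<Delta> f) t - forward_avg \<Delta> (forward_avg \<Delta> g) t"
    if "t \<ge> c" for t
    unfolding forward_avg_diff[OF c[OF assms(1)] c[OF assms(2)] that, symmetric]
    by (rule forward_avg_cong) (use 1 that in auto)
  show ?thesis
    unfolding forward_avg_diff[OF c[OF c[OF assms(1)]] c[OF c[OF assms(2)]] assms(3), symmetric]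
    by (rule forward_avg_cong) (use 2 assms in auto)
qed

lemma forward_avg_of_real:
  fixes f :: "real \<Rightarrow> real"
  assumes "continuous_on {c..} f" "T \<ge> c"
  shows "forward_avg \<Delta> (\<lambda>t. complex_of_real (f t)) T = of_real (forward_avg \<Delta> f T)"
proof -
  have "integral {0..\<Delta>} (\<lambda>a. complex_of_real (f (T + a))) = of_real (integral {0..\<Delta>} (\<lambda>a. f (T + a)))"
    using has_integral_of_real[OF integrable_integral[OF forward_avg_integrable[OF assms]], where 'b = complex]
    by (simp add: o_def integral_unique)
  then show ?thesis by (simp add: forward_avg_def scaleR_conv_of_real)
qed

lemma forward_avg3_of_real:
  fixes f :: "real \<Rightarrow> real"
  assumes "continuous_on {c..} f" "T \<ge> c" "\<Delta> > 0"
  shows "forward_avg3 \<Delta> (\<lambda>t. complex_of_real (f t)) T = of_real (forward_avg3 \<Delta> f T)"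
proof -
  note c = continuous_on_forward_avg
  have 1: "forward_avg \<Delta> (\<lambda>t. complex_of_real (f t)) t = of_real (forward_avg \<Delta> f t)" if "t \<ge> c" for t
    by (rule forward_avg_of_real[OF assms(1) that])
  have 2: "forward_avg \<Delta> (forward_avg \<Delta> (\<lambda>t. complex_of_real (f t))) t = of_real (forward_avg \<Delta> (forward_avg \<Delta> f) t)"
    if "t \<ge> c" for t
    unfolding forward_avg_of_real[OF c[OF assms(1)] that, symmetric]
    by (rule forward_avg_cong) (use 1 that in auto)
  show ?thesis
    unfolding forward_avg_of_real[OF c[OF c[OF assms(1)]] assms(2), symmetric]
    by (rule forward_avg_cong) (use 2 assms in auto)
qed

section \<open>Averaging as multiplication on the Fourier side\<close>

definition cfourier :: "(real \<Rightarrow> complex) \<Rightarrow> real \<Rightarrow> complex" where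
  "cfourier g t = (\<integral>u. g u * exp (- \<i> * of_real t * of_real u) \<partial>lborel)"

definition avg_multiplier :: "real \<Rightarrow> real \<Rightarrow> complex" where
  "avg_multiplier \<Delta> u = (1 / \<Delta>) *\<^sub>R integral {0..\<Delta>} (\<lambda>a. exp (- \<i> * of_real u * of_real a))"

lemma avg_multiplier_has_integral:
  assumes "u \<noteq> 0" "\<Delta> \<ge> 0"
  shows "((\<lambda>a. exp (- \<i> * of_real u * of_real a)) has_integral (1 - exp (- \<i> * of_real u * of_real \<Delta>)) / (\<i> * of_real u)) {0..\<Delta>}"
proof -
  define z where "z = - \<i> * complex_of_real u"
  have z: "z \<noteq> 0" using assms by (simp add: z_def)
  have "((\<lambda>a. exp (z * of_real a)) has_integral (exp (z * of_real \<Delta>) / z - exp (z * of_real 0) / z)) {0..\<Delta>}"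
  proof (rule fundamental_theorem_of_calculus[OF assms(2)])
    fix x :: real
    have "((\<lambda>u. exp (z * complex_of_real u)) has_vector_derivative z * exp (z * of_real x)) (at x within {0..\<Delta>})"
      by (rule cexp_mult_has_vector_derivative)
    from has_vector_derivative_divide[OF this, of z]
    show "((\<lambda>u. exp (z * complex_of_real u) / z) has_vector_derivative exp (z * of_real x)) (at x within {0..\<Delta>})"
      using z by simp
  qed
  moreover have "exp (z * of_real \<Delta>) / z - exp (z * of_real 0) / z = (1 - exp (z * of_real \<Delta>)) / (- z)"
    by (simp add: diff_divide_distrib)
  ultimately show ?thesis by (simp add: z_def)
qed

text \<open>For u \<noteq> 0 the numerator of the explicit value is a difference of two points of
  the unit circle, whence the 2. The second bound has product form so that it covers u = 0 as
  well.\<close>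

lemma norm_avg_multiplier_le:
  assumes D: "\<Delta> > 0"
  shows "norm (avg_multiplier \<Delta> u) \<le> 1" "norm (avg_multiplier \<Delta> u) * (\<Delta> * \<bar>u\<bar>) \<le> 2"
proof -
  have "norm (integral {0..\<Delta>} (\<lambda>a. exp (- \<i> * of_real u * of_real a))) \<le> integral {0..\<Delta>} (\<lambda>a. 1 :: real)"
    by (rule integral_norm_bound_integral)
      (auto intro!: integrable_continuous_interval continuous_intros simp: norm_exp_eq_Re)
  then show "norm (avg_multiplier \<Delta> u) \<le> 1"
    using D by (simp add: avg_multiplier_def)
  show "norm (avg_multiplier \<Delta> u) * (\<Delta> * \<bar>u\<bar>) \<le> 2"
  proof (cases "u = 0")
    case False
    have "norm (avg_multiplier \<Delta> u) * (\<Delta> * \<bar>u\<bar>) = norm (1 - exp (- \<i> * of_real u * of_real \<Delta>))"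
      unfolding avg_multiplier_def integral_unique[OF avg_multiplier_has_integral[OF False less_imp_le[OF D]]]
      using D False by (simp add: norm_divide norm_mult)
    also have "\<dots> \<le> norm (1 :: complex) + norm (exp (- \<i> * of_real u * of_real \<Delta>))" by (rule norm_triangle_ineq4)
    also have "\<dots> = 2" by (simp add: norm_exp_eq_Re)
    finally show ?thesis .
  qed simp
qed

lemma avg_multiplier_measurable [measurable]: "\<Delta> > 0 \<Longrightarrow> avg_multiplier \<Delta> \<in> borel_measurable borel"
proof -
  assume D: "\<Delta> > 0"
  have "avg_multiplier \<Delta> = (\<lambda>u. if u = 0 then avg_multiplier \<Delta> 0 else (1 / \<Delta>) *\<^sub>R ((1 - exp (- \<i> * of_real u * of_real \<Delta>)) / (\<i> * of_real u)))"
    using integral_unique[OF avg_multiplier_has_integral[OF _ less_imp_le[OF D]]] by (auto simp: avg_multiplier_def)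
  then show ?thesis by (subst \<open>avg_multiplier \<Delta> = _\<close>) measurable
qed

text \<open>The phase at T + a is the phase at T times exp (- i u a); Fubini on the window times the
  line carries out the integration over a first and leaves the multiplier.\<close>

lemma forward_avg_cfourier:
  assumes g: "integrable lborel g" and D: "\<Delta> > 0"
  shows "integrable lborel (\<lambda>u. g u * avg_multiplier \<Delta> u)"
    and "forward_avg \<Delta> (cfourier g) T = cfourier (\<lambda>u. g u * avg_multiplier \<Delta> u) T"
proof -
  have gm [measurable]: "g \<in> borel_measurable borel" using g by auto
  have [measurable]: "avg_multiplier \<Delta> \<in> borel_measurable borel" by (rule avg_multiplier_measurable[OF D])
  show "integrable lborel (\<lambda>u. g u * avg_multiplier \<Delta> u)"
    by (rule Bochner_Integration.integrable_bound[OF g])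
      (use norm_avg_multiplier_le(1)[OF D] in \<open>auto simp: norm_mult intro!: mult_left_le\<close>)
  define F where "F = (\<lambda>a u. indicator {0..\<Delta>} a *\<^sub>R (g u * exp (- \<i> * of_real (T + a) * of_real u)))"
  have ng: "integrable lborel (\<lambda>u. norm (g u))" using g by (rule integrable_norm)
  have int1: "integrable lborel (\<lambda>u. g u * exp (- \<i> * of_real s * of_real u))" for s
    by (rule Bochner_Integration.integrable_bound[OF g]) (auto simp: norm_mult norm_exp_eq_Re)
  have int: "integrable (lborel \<Otimes>\<^sub>M lborel) (case_prod F)"
  proof (rule lborel_pair.Fubini_integrable)
    show "(\<lambda>(a, u). F a u) \<in> borel_measurable (lborel \<Otimes>\<^sub>M lborel)" unfolding F_def by measurable
    have "norm (F a u) = indicator {0..\<Delta>} a * norm (g u)" for a u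
      by (simp add: F_def norm_mult norm_exp_eq_Re)
    then have "(\<lambda>a. \<integral>u. norm (case (a, u) of (a, u) \<Rightarrow> F a u) \<partial>lborel) = (\<lambda>a. indicator {0..\<Delta>} a *\<^sub>R (\<integral>u. norm (g u) \<partial>lborel))"
      by simp
    moreover have "integrable lborel (\<lambda>a. indicator {0..\<Delta>} a *\<^sub>R (\<integral>u. norm (g u) \<partial>lborel))"
      by (intro integrable_scaleR_left integrable_real_indicator) (auto simp: emeasure_lborel_Icc_eq)
    ultimately show "integrable lborel (\<lambda>a. \<integral>u. norm (case (a, u) of (a, u) \<Rightarrow> F a u) \<partial>lborel)" by (simp only:)
    show "AE a in lborel. integrable lborel (\<lambda>u. case (a, u) of (a, u) \<Rightarrow> F a u)"
    proof (rule AE_I2)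
      fix a
      show "integrable lborel (\<lambda>u. case (a, u) of (a, u) \<Rightarrow> F a u)"
        unfolding F_def split by (rule integrable_scaleR_right, rule int1)
    qed
  qed
  have "(\<integral>u. (\<integral>a. F a u \<partial>lborel) \<partial>lborel) = (\<integral>a. (\<integral>u. F a u \<partial>lborel) \<partial>lborel)"
    by (rule lborel_pair.Fubini_integral[OF int])
  moreover have "(\<integral>u. F a u \<partial>lborel) = indicator {0..\<Delta>} a *\<^sub>R cfourier g (T + a)" for a
    by (simp add: F_def cfourier_def)
  moreover have "(\<integral>a. F a u \<partial>lborel) = \<Delta> *\<^sub>R (g u * avg_multiplier \<Delta> u * exp (- \<i> * of_real T * of_real u))" for u
  proof -
    have si: "set_integrable lborel {0..\<Delta>} (\<lambda>a. exp (- \<i> * of_real u * of_real a))"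
      by (rule borel_integrable_atLeastAtMost') (auto intro!: continuous_intros)
    have "- \<i> * complex_of_real (T + a) * of_real u = - \<i> * of_real T * of_real u + - \<i> * of_real u * of_real a" for a
      by (simp add: algebra_simps)
    then have "F a u = (g u * exp (- \<i> * of_real T * of_real u)) * (indicator {0..\<Delta>} a *\<^sub>R exp (- \<i> * of_real u * of_real a))" for a
      by (simp only: F_def exp_add) (simp add: algebra_simps)
    then have "(\<integral>a. F a u \<partial>lborel) = (\<integral>a. (g u * exp (- \<i> * of_real T * of_real u)) * (indicator {0..\<Delta>} a *\<^sub>R exp (- \<i> * of_real u * of_real a)) \<partial>lborel)"
      by (simp only:)
    also have "\<dots> = (g u * exp (- \<i> * of_real T * of_real u)) * (LINT a:{0..\<Delta>}|lborel. exp (- \<i> * of_real u * of_real a))"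
      unfolding set_lebesgue_integral_def by (rule integral_mult_right_zero)
    also have "(LINT a:{0..\<Delta>}|lborel. exp (- \<i> * of_real u * of_real a)) = \<Delta> *\<^sub>R avg_multiplier \<Delta> u"
      unfolding set_borel_integral_eq_integral(2)[OF si] avg_multiplier_def using D by simp
    finally show ?thesis by (simp add: algebra_simps)
  qed
  ultimately have "\<Delta> *\<^sub>R cfourier (\<lambda>u. g u * avg_multiplier \<Delta> u) T = (LINT a:{0..\<Delta>}|lborel. cfourier g (T + a))"
    by (simp add: cfourier_def set_lebesgue_integral_def)
  also have "\<dots> = integral {0..\<Delta>} (\<lambda>a. cfourier g (T + a))"
  proof (rule set_borel_integral_eq_integral)
    have "integrable lborel (\<lambda>a. \<integral>u. F a u \<partial>lborel)"
      using lborel_pair.integrable_fst[OF int] by simp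
    then show "set_integrable lborel {0..\<Delta>} (\<lambda>a. cfourier g (T + a))"
      unfolding set_integrable_def by (simp add: F_def cfourier_def)
  qed
  finally show "forward_avg \<Delta> (cfourier g) T = cfourier (\<lambda>u. g u * avg_multiplier \<Delta> u) T"
    unfolding forward_avg_def using D by (metis (no_types) divide_inverse_commute inverse_eq_divide left_inverse less_numeral_extra(3) mult.right_neutral scaleR_one scaleR_scaleR)
qed

lemma forward_avg3_cfourier:
  assumes g: "integrable lborel g" and D: "\<Delta> > 0"
  shows "integrable lborel (\<lambda>u. g u * avg_multiplier \<Delta> u ^ 3)"
    and "forward_avg3 \<Delta> (cfourier g) T = cfourier (\<lambda>u. g u * avg_multiplier \<Delta> u ^ 3) T"
proof -
  let ?m = "avg_multiplier \<Delta>"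
  note 1 = forward_avg_cfourier[OF g D]
  note 2 = forward_avg_cfourier[OF 1(1) D]
  note 3 = forward_avg_cfourier[OF 2(1) D]
  have e: "g u * ?m u * ?m u * ?m u = g u * ?m u ^ 3" for u by (simp add: power3_eq_cube)
  show "integrable lborel (\<lambda>u. g u * ?m u ^ 3)" using 3(1) unfolding e .
  have "forward_avg \<Delta> (cfourier g) = cfourier (\<lambda>u. g u * ?m u)"
    "forward_avg \<Delta> (cfourier (\<lambda>u. g u * ?m u)) = cfourier (\<lambda>u. g u * ?m u * ?m u)"
    using 1(2) 2(2) by blast+
  then show "forward_avg3 \<Delta> (cfourier g) T = cfourier (\<lambda>u. g u * ?m u ^ 3) T"
    using 3(2) by (simp only: e)
qed

text \<open>The size |x|^(3/2) of the remainder times the bound for the cube of the multiplier, in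
  the variable x = \<Delta> u; the 8 is 2^3. At infinity this is of order |x|^(-3/2), hence
  integrable; two averages would only give |x|^(-1/2).\<close>

definition decay_profile :: "real \<Rightarrow> real" where
  "decay_profile x = \<bar>x\<bar> powr (3/2) * min 1 (8 / \<bar>x\<bar> ^ 3)"

lemma integrable_decay_profile: "integrable lborel decay_profile"
proof -
  have [measurable]: "decay_profile \<in> borel_measurable borel" unfolding decay_profile_def[abs_def] by measurable
  have "(\<lambda>x::real. x powr (- (3/2))) absolutely_integrable_on {1..}"
    by (rule nonnegative_absolutely_integrable_1)
      (use has_integral_powr_to_inf[of "- (3/2)" 1] in \<open>auto simp: integrable_on_def\<close>)
  then have p: "integrable lborel (\<lambda>x::real. indicator {1..} x *\<^sub>R x powr (- (3/2)))"
    unfolding set_integrable_def by (subst (asm) integrable_completion) auto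
  have n: "integrable lborel (\<lambda>x::real. indicator {1..} (0 + - 1 * x) *\<^sub>R (0 + - 1 * x) powr (- (3/2)))"
    by (rule lborel_integrable_real_affine[OF p]) simp
  have m: "integrable lborel (indicator {-1..1} :: real \<Rightarrow> real)"
    by (rule integrable_real_indicator) (auto simp: emeasure_lborel_Icc_eq)
  show ?thesis
  proof (rule Bochner_Integration.integrable_bound)
    show "integrable lborel (\<lambda>x::real. indicator {-1..1} x + 8 * (indicator {1..} x *\<^sub>R x powr (- (3/2)))
        + 8 * (indicator {1..} (0 + - 1 * x) *\<^sub>R (0 + - 1 * x) powr (- (3/2))))"
      by (intro Bochner_Integration.integrable_add integrable_mult_right p n m)
    show "AE x in lborel. norm (decay_profile x) \<le> norm (indicator {-1..1} x + 8 * (indicator {1..} x *\<^sub>R x powr (- (3/2)))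
        + 8 * (indicator {1..} (0 + - 1 * x) *\<^sub>R (0 + - 1 * x) powr (- (3/2))))"
    proof (rule AE_I2)
      fix x :: real
      have big: "decay_profile x \<le> 8 * \<bar>x\<bar> powr (- (3/2))" if "x \<noteq> 0"
      proof -
        have "decay_profile x \<le> \<bar>x\<bar> powr (3/2) * (8 / \<bar>x\<bar> ^ 3)"
          unfolding decay_profile_def by (intro mult_left_mono) auto
        also have "\<dots> = 8 * (\<bar>x\<bar> powr (3/2) / \<bar>x\<bar> powr 3)" using that by (simp add: powr_numeral)
        also have "\<bar>x\<bar> powr (3/2) / \<bar>x\<bar> powr 3 = \<bar>x\<bar> powr (- (3/2))" unfolding powr_diff[symmetric] by simp
        finally show ?thesis .
      qed
      have small: "decay_profile x \<le> 1" if "\<bar>x\<bar> \<le> 1"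
      proof -
        have "\<bar>x\<bar> powr (3/2) * min 1 (8 / \<bar>x\<bar> ^ 3) \<le> 1 * 1"
          using that by (intro mult_mono) (auto intro: powr_le1)
        then show ?thesis by (simp add: decay_profile_def)
      qed
      have nn: "decay_profile x \<ge> 0" by (simp add: decay_profile_def)
      consider "\<bar>x\<bar> \<le> 1" | "x > 1" | "x < -1" by linarith
      then show "norm (decay_profile x) \<le> norm (indicator {-1..1} x + 8 * (indicator {1..} x *\<^sub>R x powr (- (3/2)))
        + 8 * (indicator {1..} (0 + - 1 * x) *\<^sub>R (0 + - 1 * x) powr (- (3/2))))"
      proof cases
        case 1
        then have "indicator {-1..1} x = (1::real)" by (auto simp: indicator_def)
        moreover have "0 \<le> indicator {1..} x *\<^sub>R x powr (- (3/2))"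
          "0 \<le> indicator {1..} (0 + - 1 * x) *\<^sub>R (0 + - 1 * x) powr (- (3/2))" by simp_all
        ultimately show ?thesis using small[OF 1] nn unfolding real_norm_def by linarith
      next
        case 2
        then show ?thesis using big nn by simp
      next
        case 3
        then show ?thesis using big nn by simp
      qed
    qed
  qed measurable
qed

text \<open>Substituting x = \<Delta> u in the bound for the integrand yields \<Delta>^(-3/2) from
  the power of u and \<Delta>^(-1) from the measure.\<close>

lemma forward_avg3_cfourier_bound:
  assumes g: "integrable lborel g" and C: "\<And>u. norm (g u) \<le> C * \<bar>u\<bar> powr (3/2)" and D: "\<Delta> > 0"
  shows "norm (forward_avg3 \<Delta> (cfourier g) T) \<le> C * (\<integral>x. decay_profile x \<partial>lborel) * \<Delta> powr (- (5/2))"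
proof -
  let ?m = "avg_multiplier \<Delta>"
  have C0: "C \<ge> 0" using C[of 1] norm_ge_zero[of "g 1"] by (simp del: norm_ge_zero)
  have Du: "\<bar>u\<bar> powr (3/2) * min 1 (8 / (\<Delta> * \<bar>u\<bar>) ^ 3) = \<Delta> powr (- (3/2)) * decay_profile (\<Delta> * u)" for u
  proof -
    have "\<Delta> powr (- (3/2)) * \<bar>\<Delta> * u\<bar> powr (3/2) = (\<Delta> powr (- (3/2)) * \<Delta> powr (3/2)) * \<bar>u\<bar> powr (3/2)"
      using D by (simp add: abs_mult powr_mult)
    also have "\<Delta> powr (- (3/2)) * \<Delta> powr (3/2) = 1" using D by (simp add: powr_add[symmetric])
    finally show ?thesis using D by (simp add: decay_profile_def abs_mult mult.assoc[symmetric])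
  qed
  have m3: "norm (?m u ^ 3) \<le> min 1 (8 / (\<Delta> * \<bar>u\<bar>) ^ 3)" if "u \<noteq> 0" for u
  proof -
    have p: "\<Delta> * \<bar>u\<bar> > 0" using D that by simp
    have "norm (?m u) ^ 3 \<le> 1" using norm_avg_multiplier_le(1)[OF D, of u] by (simp add: power_le_one)
    moreover have "norm (?m u) \<le> 2 / (\<Delta> * \<bar>u\<bar>)"
      using norm_avg_multiplier_le(2)[OF D, of u] p by (simp add: pos_le_divide_eq)
    then have "norm (?m u) ^ 3 \<le> (2 / (\<Delta> * \<bar>u\<bar>)) ^ 3" by (intro power_mono) auto
    ultimately show ?thesis by (simp add: norm_power power_divide)
  qed
  have dint: "integrable lborel (\<lambda>u. decay_profile (0 + \<Delta> * u))"
    by (rule lborel_integrable_real_affine[OF integrable_decay_profile]) (use D in simp)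
  have "norm (cfourier (\<lambda>u. g u * ?m u ^ 3) T) \<le> (\<integral>u. C * (\<Delta> powr (- (3/2)) * decay_profile (0 + \<Delta> * u)) \<partial>lborel)"
    unfolding cfourier_def
  proof (rule Bochner_Integration.integral_norm_bound_integral)
    show "integrable lborel (\<lambda>u. C * (\<Delta> powr (- (3/2)) * decay_profile (0 + \<Delta> * u)))"
      by (intro integrable_mult_right dint)
    show "integrable lborel (\<lambda>u. g u * ?m u ^ 3 * exp (- \<i> * of_real T * of_real u))"
      by (rule Bochner_Integration.integrable_bound[OF forward_avg3_cfourier(1)[OF g D]])
        (use forward_avg3_cfourier(1)[OF g D] in \<open>auto simp: norm_mult norm_exp_eq_Re\<close>)
    fix u :: real
    show "norm (g u * ?m u ^ 3 * exp (- \<i> * of_real T * of_real u)) \<le> C * (\<Delta> powr (- (3/2)) * decay_profile (0 + \<Delta> * u))"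
    proof (cases "u = 0")
      case True
      then show ?thesis using C[of 0] C0 by (simp add: norm_mult decay_profile_def)
    next
      case False
      have "norm (g u) * norm (?m u ^ 3) \<le> (C * \<bar>u\<bar> powr (3/2)) * min 1 (8 / (\<Delta> * \<bar>u\<bar>) ^ 3)"
        using C0 by (intro mult_mono C m3[OF False]) auto
      then show ?thesis using Du[of u] by (simp add: norm_mult norm_exp_eq_Re mult.assoc)
    qed
  qed
  also have "\<dots> = C * (\<Delta> powr (- (3/2)) * (\<integral>u. decay_profile (0 + \<Delta> * u) \<partial>lborel))" by simp
  also have "(\<integral>u. decay_profile (0 + \<Delta> * u) \<partial>lborel) = (\<integral>x. decay_profile x \<partial>lborel) / \<Delta>"
    using lborel_integral_real_affine[of \<Delta> decay_profile 0] D by simp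
  also have "C * (\<Delta> powr (- (3/2)) * ((\<integral>x. decay_profile x \<partial>lborel) / \<Delta>)) = C * (\<integral>x. decay_profile x \<partial>lborel) * (\<Delta> powr (- (3/2)) / \<Delta> powr 1)"
    using D by simp
  also have "\<Delta> powr (- (3/2)) / \<Delta> powr 1 = \<Delta> powr (- (5/2))" unfolding powr_diff[symmetric] by simp
  finally show ?thesis unfolding forward_avg3_cfourier(2)[OF g D] .
qed

section \<open>The mean square on the critical line\<close>

definition expint2 :: "real \<Rightarrow> real" where
  "expint2 u = (LINT a:{1..}|lborel. exp (- a * \<bar>u\<bar>) / a\<^sup>2)"

lemma inv_power_tail_integral:
  assumes "n > 1"
  shows "(LINT a:{1..}|lborel. 1 / a ^ n) = 1 / real (n - 1)"
  using set_borel_integral_eq_integral(2)[OF integrable_inv_power_tail[OF assms, of 1]]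
    integral_unique[OF has_integral_inverse_power_to_inf[OF assms, of 1]] by simp

lemma set_integrable_expint2: "set_integrable lborel {1..} (\<lambda>a::real. exp (- a * \<bar>u\<bar>) / a\<^sup>2)"
  unfolding set_integrable_def
proof (rule Bochner_Integration.integrable_bound)
  show "integrable lborel (\<lambda>a::real. indicator {1..} a *\<^sub>R (1 / a\<^sup>2))"
    using integrable_inv_power_tail[of 2 1] by (simp add: set_integrable_def)
  show "AE a in lborel. norm (indicator {1..} a *\<^sub>R (exp (- a * \<bar>u\<bar>) / a\<^sup>2)) \<le> norm (indicator {1..} a *\<^sub>R (1 / a\<^sup>2))"
    by (intro AE_I2) (auto simp: indicator_def intro!: divide_right_mono)
qed measurable

lemma expint2_bounds: "0 \<le> expint2 u" "expint2 u \<le> 1"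
proof -
  show "0 \<le> expint2 u"
    unfolding expint2_def set_lebesgue_integral_def by (intro integral_nonneg_AE AE_I2) auto
  have "expint2 u \<le> (LINT a:{1..}|lborel. 1 / a ^ 2)"
    unfolding expint2_def
    by (rule set_integral_mono[OF set_integrable_expint2 integrable_inv_power_tail]) (auto intro!: divide_right_mono)
  then show "expint2 u \<le> 1" by (subst (asm) inv_power_tail_integral) auto
qed

lemma expint2_0: "expint2 0 = 1"
  using inv_power_tail_integral[of 2] by (simp add: expint2_def)

text \<open>1 - \<open>expint2 u\<close> is u times the inverse-square tail from u of h v = 1 - exp
  (- v). In h v / v^2 = 1/v + \<phi> v the first part gives the logarithm; the bounded \<phi>
  contributes to the constant, up to u times its integral over [0, u], which is at most u^2.\<close>

lemma expint2_expansion: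
  "\<exists>C. (\<lambda>u. expint2 u - (1 - u * ln (1 / u) - C * u)) \<in> O[at_right 0](\<lambda>u. u powr (3/2))"
proof -
  define h where "h = (\<lambda>v::real. 1 - exp (- v))"
  have hm [measurable]: "h \<in> borel_measurable borel" unfolding h_def by measurable
  have h1: "\<bar>h v\<bar> \<le> 1" if "v \<ge> 0" for v using that by (auto simp: h_def)
  define \<phi> where "\<phi> = (\<lambda>v::real. (1 - exp (- v) - v) / v\<^sup>2)"
  have [measurable]: "\<phi> \<in> borel_measurable borel" unfolding \<phi>_def by measurable
  have phi: "\<bar>\<phi> v\<bar> \<le> 1" if "v \<ge> 0" for v
  proof (cases "v = 0")
    case False
    then have v: "v > 0" using that by simp
    have "exp (- v) \<le> 1 / (1 + v)"
      using exp_ge_add_one_self[of v] v by (simp add: exp_minus inverse_eq_divide frac_le)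
    then have "v - 1 + exp (- v) \<le> v - 1 + 1 / (1 + v)" by simp
    also have "\<dots> = v\<^sup>2 / (1 + v)" using v by (simp add: field_simps power2_eq_square)
    also have "\<dots> \<le> v\<^sup>2 / 1" using v by (intro divide_left_mono) auto
    finally have "v - 1 + exp (- v) \<le> v\<^sup>2" by simp
    moreover have "v - 1 + exp (- v) \<ge> 0" using exp_ge_add_one_self[of "- v"] by simp
    ultimately have "\<bar>1 - exp (- v) - v\<bar> \<le> v\<^sup>2" by linarith
    then show ?thesis using v by (simp add: \<phi>_def abs_divide)
  qed (simp add: \<phi>_def)
  define C where "C = inv_square_tail h 1 + integral {0..1} \<phi>"
  have "\<bar>expint2 u - (1 - u * ln (1 / u) - C * u)\<bar> \<le> u * u" if u: "0 < u" "u \<le> 1" for u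
  proof -
    have iphi: "\<phi> integrable_on {a..b}" if "a \<ge> 0" for a b
      by (rule bounded_borel_integrable_on[of _ _ _ 1]) (use phi that in auto)
    have sh: "set_integrable lborel {1..} (\<lambda>a. h (u * a) / a\<^sup>2)" and
      Ih: "(LINT a:{1..}|lborel. h (u * a) / a\<^sup>2) = u * inv_square_tail h u"
      using inv_square_tail_scale[OF hm h1 u(1), of 1] by simp_all
    have "expint2 u = (LINT a:{1..}|lborel. 1 / a ^ 2 - h (u * a) / a\<^sup>2)"
      unfolding expint2_def by (rule set_lebesgue_integral_cong) (use u in \<open>auto simp: h_def diff_divide_distrib mult.commute\<close>)
    also have "\<dots> = 1 - u * inv_square_tail h u"
      using inv_power_tail_integral[of 2] Ih
      by (subst set_integral_diff(2)[OF integrable_inv_power_tail sh]) auto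
    also have "inv_square_tail h u = integral {u..1} (\<lambda>v. h v / v\<^sup>2) + inv_square_tail h 1"
      by (rule inv_square_tail_split[OF hm h1 u])
    also have "integral {u..1} (\<lambda>v. h v / v\<^sup>2) = ln (1 / u) + integral {u..1} \<phi>"
    proof -
      have "((\<lambda>v. 1 / v) has_integral (ln 1 - ln u)) {u..1}"
        by (rule fundamental_theorem_of_calculus[OF u(2)])
          (use u in \<open>auto intro!: derivative_eq_intros simp: has_real_derivative_iff_has_vector_derivative[symmetric] divide_inverse\<close>)
      from has_integral_add[OF this integrable_integral[OF iphi]] u
      have "((\<lambda>v. 1 / v + \<phi> v) has_integral (ln (1 / u) + integral {u..1} \<phi>)) {u..1}"
        by (simp add: ln_div)
      then have "((\<lambda>v. h v / v\<^sup>2) has_integral (ln (1 / u) + integral {u..1} \<phi>)) {u..1}"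
        by (rule has_integral_eq[rotated])
          (use u in \<open>auto simp: h_def \<phi>_def field_simps power2_eq_square\<close>)
      then show ?thesis by (rule integral_unique)
    qed
    also have "integral {u..1} \<phi> = integral {0..1} \<phi> - integral {0..u} \<phi>"
      using Henstock_Kurzweil_Integration.integral_combine[of 0 u 1 \<phi>] iphi[of 0 1] u by simp
    finally have "expint2 u - (1 - u * ln (1 / u) - C * u) = u * integral {0..u} \<phi>"
      by (simp add: C_def algebra_simps)
    moreover have "norm (integral {0..u} \<phi>) \<le> integral {0..u} (\<lambda>_. 1)"
      by (rule Henstock_Kurzweil_Integration.integral_norm_bound_integral[OF iphi]) (use phi in auto)
    then have "\<bar>integral {0..u} \<phi>\<bar> \<le> u" using u by simp
    ultimately show ?thesis using u by (simp add: abs_mult mult_left_mono)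
  qed
  then have "(\<lambda>u. expint2 u - (1 - u * ln (1 / u) - C * u)) \<in> O[at_right 0](\<lambda>u. u * u)"
    by (intro bigoI[of _ 1]) (auto simp: eventually_at_right_less intro!: eventually_at_rightI[of 0 1])
  also have "(\<lambda>u::real. u * u) \<in> O[at_right 0](\<lambda>u. u powr (3/2))" by real_asymp
  finally show ?thesis by blast
qed

text \<open>\<open>expint2\<close> is a superposition of two-sided exponentials with weight a^(-2).
  Fubini, legitimate because the weighted L1 norms are 2 / a^3, reduces the transform to the
  integral of 2 / (a (a^2 + t^2)) over a \<ge> 1.\<close>

lemma expint2_fourier:
  shows integrable_expint2: "integrable lborel expint2"
    and fourier_expint2: "t \<noteq> 0 \<Longrightarrow> fourier expint2 t = of_real (ln (1 + t\<^sup>2) / t\<^sup>2)"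
proof -
  define F where "F = (\<lambda>t a u. (indicator {1..} a * (1 / a\<^sup>2)) *\<^sub>R (of_real (exp (- a * \<bar>u\<bar>)) * exp (- \<i> * complex_of_real t * of_real u)))"
  have int: "integrable (lborel \<Otimes>\<^sub>M lborel) (case_prod (F t))" for t
  proof (rule lborel_pair.Fubini_integrable)
    show "(\<lambda>(a, u). F t a u) \<in> borel_measurable (lborel \<Otimes>\<^sub>M lborel)" unfolding F_def by measurable
    have "(\<integral>u. norm (F t a u) \<partial>lborel) = indicator {1..} a *\<^sub>R (2 * (1 / a ^ 3))" for a
    proof (cases "a \<ge> 1")
      case True
      have "complex_of_real (\<integral>u. exp (- a * \<bar>u\<bar>) \<partial>lborel) = of_real (2 * a / a\<^sup>2)"
        using fourier_double_exp(2)[of a 0] True by simp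
      then have "(\<integral>u. exp (- a * \<bar>u\<bar>) \<partial>lborel) = 2 * a / a\<^sup>2" by (simp only: of_real_eq_iff)
      moreover have "norm (F t a u) = 1 / a\<^sup>2 * exp (- a * \<bar>u\<bar>)" for u
        using True by (simp add: F_def norm_mult norm_exp_eq_Re)
      ultimately show ?thesis using True by (simp add: eval_nat_numeral)
    next
      case False
      then show ?thesis by (simp add: F_def)
    qed
    moreover have "integrable lborel (\<lambda>a::real. indicator {1..} a *\<^sub>R (2 * (1 / a ^ 3)))"
      using set_integrable_mult_right[OF integrable_inv_power_tail[of 3 1], of 2]
      unfolding set_integrable_def by simp
    ultimately show "integrable lborel (\<lambda>a. \<integral>u. norm (case (a, u) of (a, u) \<Rightarrow> F t a u) \<partial>lborel)" by simp
    show "AE a in lborel. integrable lborel (\<lambda>u. case (a, u) of (a, u) \<Rightarrow> F t a u)"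
    proof (rule AE_I2)
      fix a :: real
      show "integrable lborel (\<lambda>u. case (a, u) of (a, u) \<Rightarrow> F t a u)"
      proof (cases "a \<ge> 1")
        case True
        then show ?thesis
          unfolding F_def split by (intro integrable_scaleR_right fourier_double_exp(1)) simp
      next
        case False
        then show ?thesis by (simp add: F_def)
      qed
    qed
  qed
  have inner: "(\<integral>a. F t a u \<partial>lborel) = of_real (expint2 u) * exp (- \<i> * of_real t * of_real u)" for t u
  proof -
    have "F t a u = of_real (indicator {1..} a *\<^sub>R (exp (- a * \<bar>u\<bar>) / a\<^sup>2)) * exp (- \<i> * of_real t * of_real u)" for a
      by (simp add: F_def scaleR_conv_of_real)
    then have "(\<integral>a. F t a u \<partial>lborel) = (\<integral>a. of_real (indicator {1..} a *\<^sub>R (exp (- a * \<bar>u\<bar>) / a\<^sup>2)) * exp (- \<i> * of_real t * of_real u) \<partial>lborel)"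
      by (simp only:)
    also have "\<dots> = (\<integral>a. of_real (indicator {1..} a *\<^sub>R (exp (- a * \<bar>u\<bar>) / a\<^sup>2)) \<partial>lborel) * exp (- \<i> * of_real t * of_real u)"
      by (rule integral_mult_left_zero)
    also have "(\<integral>a. complex_of_real (indicator {1..} a *\<^sub>R (exp (- a * \<bar>u\<bar>) / a\<^sup>2)) \<partial>lborel) = of_real (expint2 u)"
      unfolding integral_complex_of_real expint2_def set_lebesgue_integral_def ..
    finally show ?thesis .
  qed
  have "integrable lborel (\<lambda>u. \<integral>a. F 0 a u \<partial>lborel)"
    using lborel_pair.integrable_snd[OF int[of 0]] by simp
  then show "integrable lborel expint2" unfolding inner by (simp add: complex_of_real_integrable_eq)
  assume t: "t \<noteq> 0"
  define g where "g = (\<lambda>a::real. 2 / (a * (a\<^sup>2 + t\<^sup>2)))"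
  have sg: "set_integrable lborel {1..} g"
    unfolding set_integrable_def
  proof (rule Bochner_Integration.integrable_bound)
    show "integrable lborel (\<lambda>a::real. indicator {1..} a *\<^sub>R (2 * (1 / a ^ 3)))"
      using set_integrable_mult_right[OF integrable_inv_power_tail[of 3 1], of 2]
      unfolding set_integrable_def by simp
    show "(\<lambda>a. indicator {1..} a *\<^sub>R g a) \<in> borel_measurable lborel" unfolding g_def by measurable
    have "2 / (a * (a\<^sup>2 + t\<^sup>2)) \<le> 2 / a ^ 3" if "a \<ge> 1" for a
    proof (rule divide_left_mono)
      have "a * a\<^sup>2 \<le> a * (a\<^sup>2 + t\<^sup>2)" using that by (intro mult_left_mono) auto
      then show "a ^ 3 \<le> a * (a\<^sup>2 + t\<^sup>2)" by (simp add: eval_nat_numeral)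
      show "0 < a * (a\<^sup>2 + t\<^sup>2) * a ^ 3" using that by (intro mult_pos_pos add_pos_nonneg) auto
    qed simp
    moreover have "2 / (a * (a\<^sup>2 + t\<^sup>2)) \<ge> 0" if "a \<ge> 1" for a using that by simp
    ultimately show "AE a in lborel. norm (indicator {1..} a *\<^sub>R g a) \<le> norm (indicator {1..} a *\<^sub>R (2 * (1 / a ^ 3)))"
      by (intro AE_I2) (auto simp: g_def indicator_def)
  qed
  have "fourier expint2 t = (\<integral>u. (\<integral>a. F t a u \<partial>lborel) \<partial>lborel)"
    unfolding inner fourier_def ..
  also have "\<dots> = (\<integral>a. (\<integral>u. F t a u \<partial>lborel) \<partial>lborel)"
    by (rule lborel_pair.Fubini_integral[OF int])
  also have "\<dots> = (\<integral>a. complex_of_real (indicator {1..} a *\<^sub>R g a) \<partial>lborel)"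
  proof (rule Bochner_Integration.integral_cong[OF refl])
    fix a :: real
    show "(\<integral>u. F t a u \<partial>lborel) = complex_of_real (indicator {1..} a *\<^sub>R g a)"
    proof (cases "a \<ge> 1")
      case True
      then have "(\<integral>u. F t a u \<partial>lborel) = (indicator {1..} a * (1 / a\<^sup>2)) *\<^sub>R of_real (2 * a / (a\<^sup>2 + t\<^sup>2))"
        unfolding F_def by (subst integral_scaleR_right) (subst fourier_double_exp(2), auto)
      also have "\<dots> = of_real (1 / a\<^sup>2 * (2 * a / (a\<^sup>2 + t\<^sup>2)))" using True by (simp add: scaleR_conv_of_real)
      also have "1 / a\<^sup>2 * (2 * a / (a\<^sup>2 + t\<^sup>2)) = g a"
        using True by (simp add: g_def power2_eq_square)
      finally show ?thesis using True by simp
    next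
      case False
      then show ?thesis by (simp add: F_def)
    qed
  qed
  also have "\<dots> = of_real (LINT a:{1..}|lborel. g a)"
    unfolding integral_complex_of_real set_lebesgue_integral_def ..
  also have "(LINT a:{1..}|lborel. g a) = ln (1 + t\<^sup>2) / t\<^sup>2"
  proof (rule tendsto_unique[OF _ integral_halfline_tendsto[OF sg]])
    \<comment> \<open>A primitive by partial fractions, normalised to vanish at infinity, so that
      only -G 1 survives.\<close>
    define G where "G = (\<lambda>a. (2 * ln a - ln (a\<^sup>2 + t\<^sup>2)) / t\<^sup>2)"
    have "(g has_integral (G b - G 1)) {1..b}" if "b \<ge> 1" for b
    proof (rule fundamental_theorem_of_calculus[OF that])
      fix x assume "x \<in> {1..b}"
      then have x: "x > 0" "x\<^sup>2 + t\<^sup>2 > 0" by (auto intro!: add_pos_nonneg)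
      have "(G has_real_derivative (2 * (1 / x) - (2 * x) / (x\<^sup>2 + t\<^sup>2)) / t\<^sup>2) (at x within {1..b})"
        unfolding G_def using x t by (auto intro!: derivative_eq_intros simp: power2_eq_square)
      also have "(2 * (1 / x) - (2 * x) / (x\<^sup>2 + t\<^sup>2)) / t\<^sup>2 = g x"
      proof -
        have "2 * (1 / x) - (2 * x) / (x\<^sup>2 + t\<^sup>2) = 2 * t\<^sup>2 / (x * (x\<^sup>2 + t\<^sup>2))"
          using x by (simp add: field_simps power2_eq_square)
        then show ?thesis using t by (simp add: g_def)
      qed
      finally show "(G has_vector_derivative g x) (at x within {1..b})"
        by (simp add: has_real_derivative_iff_has_vector_derivative)
    qed
    then have "eventually (\<lambda>b. G b - G 1 = integral {1..b} g) at_top"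
      by (intro eventually_mono[OF eventually_ge_at_top[of 1]]) (metis integral_unique)
    moreover have "((\<lambda>b. G b - G 1) \<longlongrightarrow> 0 - G 1) at_top"
    proof (intro tendsto_diff tendsto_const)
      have "((\<lambda>b. t / b) \<longlongrightarrow> 0) at_top"
        by (rule real_tendsto_divide_at_top[OF tendsto_const filterlim_ident])
      then have "((\<lambda>b. - ln (1 + (t / b)\<^sup>2) / t\<^sup>2) \<longlongrightarrow> - ln (1 + 0\<^sup>2) / t\<^sup>2) at_top"
        using t by (intro tendsto_intros) auto
      moreover have "eventually (\<lambda>b. - ln (1 + (t / b)\<^sup>2) / t\<^sup>2 = G b) at_top"
        using eventually_gt_at_top[of 0]
      proof eventually_elim
        case (elim b)
        have "b\<^sup>2 + t\<^sup>2 = b\<^sup>2 * (1 + (t / b)\<^sup>2)" using elim by (simp add: power_divide algebra_simps)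
        moreover have "1 + (t / b)\<^sup>2 > 0" by (intro add_pos_nonneg) auto
        ultimately have "ln (b\<^sup>2 + t\<^sup>2) = 2 * ln b + ln (1 + (t / b)\<^sup>2)"
          using elim by (simp add: ln_mult ln_realpow)
        then show ?case by (simp add: G_def)
      qed
      ultimately show "(G \<longlongrightarrow> 0) at_top" by (simp add: Lim_transform_eventually)
    qed
    ultimately have "((\<lambda>b. integral {1..b} g) \<longlongrightarrow> 0 - G 1) at_top"
      by (rule Lim_transform_eventually[rotated])
    then show "((\<lambda>b. integral {1..b} g) \<longlongrightarrow> ln (1 + t\<^sup>2) / t\<^sup>2) at_top"
      by (simp add: G_def)
  qed auto
  finally show "fourier expint2 t = of_real (ln (1 + t\<^sup>2) / t\<^sup>2)" .
qed

section \<open>A model for the spectral density\<close>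

lemma fourier_add:
  "integrable lborel f \<Longrightarrow> integrable lborel g \<Longrightarrow> fourier (\<lambda>u. f u + g u) t = fourier f t + fourier g t"
  unfolding fourier_def using integrable_fourier[of f t] integrable_fourier[of g t]
  by (simp add: distrib_right)

lemma fourier_cmult: "fourier (\<lambda>u. c * f u) t = of_real c * fourier f t"
  unfolding fourier_def by (simp add: mult.assoc)

text \<open>Here r is the autocorrelation minus half of \<open>expint2\<close> minus multiples of
  exp (- |u|) and exp (- 2 |u|). The factor 1/2 removes the term u ln (1/u), and the exponentials
  remove what is left of the constant and linear terms. Evenness and boundedness extend the estimate
  at 0+ to all u.\<close>

lemma spectral_model:
  "\<exists>\<beta>1 \<beta>2 r C. integrable lborel r \<and> (\<forall>u. \<bar>r u\<bar> \<le> C * \<bar>u\<bar> powr (3/2)) \<and>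
    (\<forall>t. t \<noteq> 0 \<longrightarrow> of_real (spectral_density t - (ln (1 + t\<^sup>2) / (2 * t\<^sup>2) + 2 * \<beta>1 / (1 + t\<^sup>2) + 4 * \<beta>2 / (4 + t\<^sup>2))) = fourier r t)"
proof -
  define R where "R = autocorrelation sawtooth_kernel"
  define b where "b = euler_mascheroni + bump_tail 1 - 1"
  obtain C where C: "(\<lambda>u. expint2 u - (1 - u * ln (1 / u) - C * u)) \<in> O[at_right 0](\<lambda>u. u powr (3/2))"
    using expint2_expansion by blast
  \<comment> \<open>The solution of \<beta>1 + \<beta>2 = R 0 - 1/2, from the value at 0, and
    \<beta>1 + 2 \<beta>2 = (b - C) / 2, from the linear term.\<close>
  define \<beta>2 where "\<beta>2 = (b - C) / 2 - (R 0 - 1/2)"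
  define \<beta>1 where "\<beta>1 = R 0 - 1/2 - \<beta>2"
  define E where "E = (\<lambda>a u. exp (- a * \<bar>u :: real\<bar>))"
  define r where "r = (\<lambda>u. R u + (- (1/2)) * expint2 u + (- \<beta>1) * E 1 u + (- \<beta>2) * E 2 u)"
  have iR: "integrable lborel R" unfolding R_def by (rule integrable_autocorrelation[OF integrable_sawtooth_kernel])
  have iE: "integrable lborel (E a)" if "a > 0" for a unfolding E_def by (rule integrable_double_exp[OF that])
  have ir: "integrable lborel r"
    unfolding r_def by (intro Bochner_Integration.integrable_add integrable_mult_right iR iE integrable_expint2) auto
  have fr: "fourier r t = fourier R t - of_real (1/2) * fourier expint2 t - of_real \<beta>1 * fourier (E 1) t - of_real \<beta>2 * fourier (E 2) t" for t
    unfolding r_def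
    by (subst fourier_add fourier_cmult | intro Bochner_Integration.integrable_add integrable_mult_right iR iE integrable_expint2 zero_less_one zero_less_numeral)+ simp
  have fE: "fourier (E a) t = of_real (2 * a / (a\<^sup>2 + t\<^sup>2))" if "a > 0" for a t
    unfolding fourier_def E_def by (rule fourier_double_exp(2)[OF that])
  have "of_real (spectral_density t - (ln (1 + t\<^sup>2) / (2 * t\<^sup>2) + 2 * \<beta>1 / (1 + t\<^sup>2) + 4 * \<beta>2 / (4 + t\<^sup>2))) = fourier r t"
    if "t \<noteq> 0" for t
  proof -
    have "fourier R t = of_real (spectral_density t)" unfolding R_def spectral_density_eq ..
    moreover have "of_real (1/2) * fourier expint2 t = of_real (ln (1 + t\<^sup>2) / (2 * t\<^sup>2))"
      unfolding fourier_expint2[OF that] of_real_mult[symmetric] by simp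
    moreover have "of_real \<beta>1 * fourier (E 1) t = of_real (2 * \<beta>1 / (1 + t\<^sup>2))"
      "of_real \<beta>2 * fourier (E 2) t = of_real (4 * \<beta>2 / (4 + t\<^sup>2))"
      unfolding fE[OF zero_less_one] fE[OF zero_less_numeral] of_real_mult[symmetric] by (simp_all add: mult_ac)
    ultimately show ?thesis unfolding fr by (simp only: of_real_diff of_real_add) (simp add: algebra_simps)
  qed
  moreover have "\<exists>C. \<forall>u. \<bar>r u\<bar> \<le> C * \<bar>u\<bar> powr (3/2)"
  proof -
    have cm: "(\<lambda>v. c * f v) \<in> O[at_right 0](g)" if "f \<in> O[at_right 0](g)" for c :: real and f g :: "real \<Rightarrow> real"
      using that by (cases "c = 0") auto
    have e1: "(\<lambda>u::real. exp (- u) - (1 - u)) \<in> O[at_right 0](\<lambda>u. u powr (3/2))" by real_asymp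
    have e2: "(\<lambda>u::real. exp (- 2 * u) - (1 - 2 * u)) \<in> O[at_right 0](\<lambda>u. u powr (3/2))" by real_asymp
    have RO: "(\<lambda>v. R v - (R 0 - (v * ln (1 / v) + b * v) / 2)) \<in> O[at_right 0](\<lambda>v. v powr (3/2))"
      unfolding R_def b_def by (rule autocorrelation_sawtooth_expansion)
    have "(\<lambda>u. (R u - (R 0 - (u * ln (1 / u) + b * u) / 2)) + (- (1/2)) * (expint2 u - (1 - u * ln (1 / u) - C * u))
       + (- \<beta>1) * (exp (- u) - (1 - u)) + (- \<beta>2) * (exp (- 2 * u) - (1 - 2 * u))) \<in> O[at_right 0](\<lambda>u. u powr (3/2))"
      by (intro sum_in_bigo(1) cm RO C e1 e2)
    then obtain c where c: "eventually (\<lambda>u. \<bar>(R u - (R 0 - (u * ln (1 / u) + b * u) / 2)) + (- (1/2)) * (expint2 u - (1 - u * ln (1 / u) - C * u))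
       + (- \<beta>1) * (exp (- u) - (1 - u)) + (- \<beta>2) * (exp (- 2 * u) - (1 - 2 * u))\<bar> \<le> c * \<bar>u powr (3/2)\<bar>) (at_right 0)"
      by (auto elim!: landau_o.bigE)
    have "(R u - (R 0 - (u * ln (1 / u) + b * u) / 2)) + (- (1/2)) * (expint2 u - (1 - u * ln (1 / u) - C * u))
       + (- \<beta>1) * (exp (- u) - (1 - u)) + (- \<beta>2) * (exp (- 2 * u) - (1 - 2 * u)) = r u" if "u > 0" for u
    proof -
      have "\<beta>1 = R 0 - 1/2 - \<beta>2" "b = C + 2 * \<beta>2 + 2 * (R 0 - 1/2)" by (simp_all add: \<beta>1_def \<beta>2_def field_simps)
      then show ?thesis using that by (simp add: r_def E_def) (simp add: field_simps)
    qed
    then have "eventually (\<lambda>u. \<bar>r u\<bar> \<le> c * \<bar>u powr (3/2)\<bar>) (at_right 0)"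
      using eventually_conj[OF c eventually_at_right_less[of 0]] by (auto elim!: eventually_mono)
    then obtain d where d: "d > 0" "\<And>u. 0 < u \<Longrightarrow> u < d \<Longrightarrow> \<bar>r u\<bar> \<le> c * \<bar>u powr (3/2)\<bar>"
      unfolding eventually_at_right_field by auto
    define B where "B = (\<integral>u. sawtooth_kernel u \<partial>lborel) + 1/2 + \<bar>\<beta>1\<bar> + \<bar>\<beta>2\<bar>"
    have E1: "\<bar>E a u\<bar> \<le> 1" if "a > 0" for a u using that by (simp add: E_def)
    have rB: "\<bar>r u\<bar> \<le> B" for u
    proof -
      have "\<bar>r u\<bar> \<le> \<bar>R u\<bar> + \<bar>(1/2) * expint2 u\<bar> + \<bar>\<beta>1 * E 1 u\<bar> + \<bar>\<beta>2 * E 2 u\<bar>" unfolding r_def by simp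
      moreover have "\<bar>\<beta>1 * E 1 u\<bar> \<le> \<bar>\<beta>1\<bar>" "\<bar>\<beta>2 * E 2 u\<bar> \<le> \<bar>\<beta>2\<bar>"
        unfolding abs_mult using E1[of 1 u] E1[of 2 u] by (auto intro!: mult_left_le)
      moreover have "\<bar>(1/2) * expint2 u\<bar> \<le> 1/2" using expint2_bounds[of u] by simp
      moreover have "\<bar>R u\<bar> \<le> (\<integral>u. sawtooth_kernel u \<partial>lborel)" unfolding R_def by (rule autocorrelation_sawtooth_bound)
      ultimately show ?thesis unfolding B_def by linarith
    qed
    have even: "r \<bar>u\<bar> = r u" for u
      by (cases "u \<ge> 0") (auto simp: r_def E_def R_def autocorrelation_minus expint2_def)
    have r0: "r 0 = 0" by (simp add: r_def E_def expint2_0 \<beta>1_def)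
    \<comment> \<open>Near 0 the expansion gives the constant c; for |u| \<ge> d the bound B is at
      most B / d^(3/2) times |u|^(3/2).\<close>
    define K where "K = max c (B / d powr (3/2))"
    have "\<bar>r u\<bar> \<le> K * \<bar>u\<bar> powr (3/2)" for u
    proof -
      consider "u = 0" | "0 < \<bar>u\<bar>" "\<bar>u\<bar> < d" | "\<bar>u\<bar> \<ge> d" by linarith
      then show ?thesis
      proof cases
        case 1
        then show ?thesis by (simp add: r0)
      next
        case 2
        have "\<bar>r u\<bar> \<le> c * \<bar>u\<bar> powr (3/2)" using d(2)[OF 2] by (simp add: even)
        also have "\<dots> \<le> K * \<bar>u\<bar> powr (3/2)" by (intro mult_right_mono) (auto simp: K_def)
        finally show ?thesis .
      next
        case 3
        have B0: "B \<ge> 0" using rB[of 0] by simp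
        have "\<bar>r u\<bar> \<le> B / d powr (3/2) * d powr (3/2)" using rB[of u] d(1) by simp
        also have "\<dots> \<le> B / d powr (3/2) * \<bar>u\<bar> powr (3/2)"
          using B0 d(1) 3 by (intro mult_left_mono powr_mono2) auto
        also have "\<dots> \<le> K * \<bar>u\<bar> powr (3/2)" by (intro mult_right_mono) (auto simp: K_def)
        finally show ?thesis .
      qed
    qed
    then show ?thesis by blast
  qed
  ultimately show ?thesis using ir by metis
qed

section \<open>From averaged to unaveraged integrals\<close>

lemma forward_avg3_cong:
  assumes "\<And>t. t \<ge> T \<Longrightarrow> f t = g t" "\<Delta> > 0"
  shows "forward_avg3 \<Delta> f T = forward_avg3 \<Delta> g T"
  by (intro forward_avg_cong assms) (use assms in auto)

lemma continuous_critical_weight: "continuous_on UNIV critical_weight"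
proof -
  have "continuous_on (- {1}) zeta"
    by (rule holomorphic_on_imp_continuous_on[OF zeta_holomorphic])
  then have "continuous_on UNIV (\<lambda>t. zeta (1/2 + \<i> * complex_of_real t))"
    by (rule continuous_on_compose2) (auto intro!: continuous_intros simp: complex_eq_iff)
  then show ?thesis unfolding critical_weight_def[abs_def] by (intro continuous_intros)
qed

lemma spectral_density_quotient: "spectral_density t = critical_weight t / (1/4 + t\<^sup>2)"
proof -
  have "1/4 + t\<^sup>2 > 0" by (intro add_pos_nonneg) auto
  then show ?thesis unfolding critical_weight_eq by simp
qed

lemma continuous_spectral_density: "continuous_on UNIV spectral_density"
proof -
  have "1/4 + t\<^sup>2 \<noteq> 0" for t :: real using zero_le_power2[of t] by linarith
  then show ?thesis
    unfolding spectral_density_quotient[abs_def]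
    by (intro continuous_intros continuous_critical_weight) auto
qed

lemma spectral_density_nonneg: "spectral_density t \<ge> 0"
  by (simp add: spectral_density_def)

text \<open>The proof takes \<open>\<Delta> = Y powr (9/10)\<close>: then both the mass in a window of length \<open>\<Delta>\<close> near \<open>Y\<close> and the
  accumulated error \<open>Y * \<Delta> powr (- 5/2)\<close> are smaller than \<open>1 / Y\<close> by a power of \<open>Y\<close>.\<close>

lemma averages_imp_integrals_close:
  fixes p q :: "real \<Rightarrow> real"
  assumes p: "continuous_on {c..} p" "\<And>t. t \<ge> c \<Longrightarrow> p t \<ge> 0"
    and q: "continuous_on {c..} q" "\<And>t. t \<ge> c \<Longrightarrow> q t \<ge> 0"
    and K: "\<And>T \<Delta>. T \<ge> c \<Longrightarrow> \<Delta> > 0 \<Longrightarrow> \<bar>forward_avg3 \<Delta> p T - forward_avg3 \<Delta> q T\<bar> \<le> K * \<Delta> powr (- (5/2))"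
    and L: "\<And>t. t \<ge> c \<Longrightarrow> q t \<le> L * t powr (- (39/20))"
  shows "\<exists>Y0\<ge>c. \<exists>C. \<forall>Y\<ge>Y0. \<forall>Z\<in>{Y..2 * Y}. \<bar>integral {Y..Z} p - integral {Y..Z} q\<bar> \<le> C * Y powr (- (21/20))"
proof -
  have K0: "K \<ge> 0" using order_trans[OF abs_ge_zero K[of c 1]] by simp
  have L0: "L \<ge> 0"
  proof -
    have "0 \<le> L * (max c 1) powr (- (39/20))"
      using q(2)[of "max c 1"] L[of "max c 1"] by simp
    moreover have "(max c 1) powr (- (39/20)) > 0" by simp
    ultimately show ?thesis by (simp add: zero_le_mult_iff)
  qed
  \<comment> \<open>Room for three windows to the left of Y without falling below Y / 2, where the
    bound for q is still of the right order.\<close>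
  have "eventually (\<lambda>Y::real. 3 * Y powr (9/10) \<le> Y / 2) at_top" by real_asymp
  then obtain Y1 :: real where Y1: "\<And>Y. Y \<ge> Y1 \<Longrightarrow> 3 * Y powr (9/10) \<le> Y / 2"
    by (auto simp: eventually_at_top_linorder)
  define Y0 where "Y0 = max Y1 (max 1 (2 * \<bar>c\<bar>))"
  have bound: "\<bar>integral {Y..Z} p - integral {Y..Z} q\<bar> \<le> (24 * L + 2 * K) * Y powr (- (21/20))"
    if Y: "Y \<ge> Y0" and Z: "Z \<in> {Y..2 * Y}" for Y Z
  proof -
    define D where "D = Y powr (9/10)"
    have Y': "Y \<ge> 1" "Y / 2 \<ge> c" "3 * D \<le> Y / 2" using Y Y1[of Y] by (auto simp: Y0_def D_def)
    have D: "D > 0" using Y' by (simp add: D_def)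
    define s where "s = L * (Y / 2) powr (- (39/20))"
    have s: "q t \<le> s" if "t \<ge> Y / 2" for t
    proof -
      have "q t \<le> L * t powr (- (39/20))" using L[of t] that Y' by simp
      also have "\<dots> \<le> s" unfolding s_def using that Y' L0 by (intro mult_left_mono powr_mono2') auto
      finally show ?thesis .
    qed
    have s0: "s \<ge> 0" using L0 by (simp add: s_def)
    have ip: "p integrable_on {a..b}" and iq: "q integrable_on {a..b}"
      and ip3: "forward_avg3 D p integrable_on {a..b}" and iq3: "forward_avg3 D q integrable_on {a..b}"
      if "a \<ge> c" for a b
      using that by (auto intro!: integrable_continuous_interval continuous_on_subset[OF p(1)] continuous_on_subset[OF q(1)]
          continuous_on_subset[OF continuous_on_forward_avg[OF continuous_on_forward_avg[OF continuous_on_forward_avg[OF p(1)]]]]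
          continuous_on_subset[OF continuous_on_forward_avg[OF continuous_on_forward_avg[OF continuous_on_forward_avg[OF q(1)]]]])
    define \<delta> where "\<delta> = K * D powr (- (5/2))"
    have d0: "\<delta> \<ge> 0" using K0 by (simp add: \<delta>_def)
    have avg: "\<bar>integral {a..b} (forward_avg3 D p) - integral {a..b} (forward_avg3 D q)\<bar> \<le> 2 * Y * \<delta>"
      if a: "a \<ge> c" and ab: "b - a \<le> 2 * Y" for a b
    proof (cases "a \<le> b")
      case True
      have "norm (integral {a..b} (\<lambda>t. forward_avg3 D p t - forward_avg3 D q t)) \<le> integral {a..b} (\<lambda>_. \<delta>)"
        by (rule Henstock_Kurzweil_Integration.integral_norm_bound_integral[OF integrable_diff[OF ip3[OF a] iq3[OF a]] integrable_const_ivl])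
          (use K[OF _ D] a in \<open>auto simp: \<delta>_def\<close>)
      also have "\<dots> = (b - a) * \<delta>" using True by simp
      also have "\<dots> \<le> 2 * Y * \<delta>" by (rule mult_right_mono[OF ab d0])
      finally show ?thesis by (simp add: Henstock_Kurzweil_Integration.integral_diff[OF ip3[OF a] iq3[OF a]])
    next
      case False
      then show ?thesis using d0 Y' by simp
    qed
    have small: "integral {a..b} q \<le> 3 * D * s" if "a \<ge> Y / 2" "b - a \<le> 3 * D" for a b
    proof (cases "a \<le> b")
      case True
      have "integral {a..b} q \<le> integral {a..b} (\<lambda>_. s)"
        by (rule integral_le[OF iq integrable_const_ivl]) (use that Y' s in auto)
      also have "\<dots> = (b - a) * s" using True by simp
      also have "\<dots> \<le> 3 * D * s" using that s0 by (intro mult_right_mono) auto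
      finally show ?thesis .
    next
      case False
      then show ?thesis using s0 D by simp
    qed
    have YZ: "Y \<le> Z" "Z \<le> 2 * Y" using Z by auto
    have comb: "integral {a..b} q + integral {b..d} q = integral {a..d} q" if "Y / 2 \<le> a" "a \<le> b" "b \<le> d" for a b d
      by (rule Henstock_Kurzweil_Integration.integral_combine) (use that Y' iq in auto)
    have qn: "integral {a..b} q \<ge> 0" if "a \<ge> Y / 2" for a b
      by (rule Henstock_Kurzweil_Integration.integral_nonneg[OF iq]) (use that Y' q(2) in auto)
    \<comment> \<open>The mass of p on [Y, Z] is caught by averages started 3 D earlier. These are
      exchanged for averages of q, which use q on at most [Y - 3 D, Z + 3 D]; the two margins cost 3
      D s each.\<close>
    have upper: "integral {Y..Z} p \<le> integral {Y..Z} q + 6 * D * s + 2 * Y * \<delta>"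
    proof -
      have "integral {Y..Z} p \<le> integral {Y - 3 * D..Z} (forward_avg3 D p)"
        using integral_forward_avg3_ge[OF p, of "Y - 3 * D" D Z] Y' D by simp
      also have "\<dots> \<le> integral {Y - 3 * D..Z} (forward_avg3 D q) + 2 * Y * \<delta>"
        using avg[of "Y - 3 * D" Z] Y' YZ by linarith
      also have "integral {Y - 3 * D..Z} (forward_avg3 D q) \<le> integral {Y - 3 * D..Z + 3 * D} q"
        by (rule integral_forward_avg3_le[OF q]) (use Y' D in auto)
      also have "\<dots> = integral {Y - 3 * D..Y} q + (integral {Y..Z} q + integral {Z..Z + 3 * D} q)"
        using comb[of "Y - 3 * D" Y "Z + 3 * D"] comb[of Y Z "Z + 3 * D"] Y' YZ D by simp
      also have "integral {Y - 3 * D..Y} q \<le> 3 * D * s" by (rule small) (use Y' in auto)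
      also have "integral {Z..Z + 3 * D} q \<le> 3 * D * s" by (rule small) (use Y' YZ in auto)
      finally show ?thesis by simp
    qed
    have lower: "integral {Y..Z} q - 6 * D * s - 2 * Y * \<delta> \<le> integral {Y..Z} p"
    proof -
      have "integral {Y..Z} q - 6 * D * s \<le> integral {Y + 3 * D..Z - 3 * D} q"
      proof (cases "Y + 3 * D \<le> Z - 3 * D")
        case True
        have "integral {Y..Z} q = integral {Y..Y + 3 * D} q + (integral {Y + 3 * D..Z - 3 * D} q + integral {Z - 3 * D..Z} q)"
          using comb[of Y "Y + 3 * D" Z] comb[of "Y + 3 * D" "Z - 3 * D" Z] True Y' D by simp
        moreover have "integral {Y..Y + 3 * D} q \<le> 3 * D * s" by (rule small) (use Y' in auto)
        moreover have "integral {Z - 3 * D..Z} q \<le> 3 * D * s" by (rule small) (use Y' YZ in auto)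
        ultimately show ?thesis by simp
      next
        case False
        \<comment> \<open>The shrunken interval is empty here and its integral is 0. As [Y, Z] is
          then shorter than 6 D, each half counts as one margin.\<close>
        define m where "m = (Y + Z) / 2"
        have m: "Y \<le> m" "m \<le> Z" "m - Y \<le> 3 * D" "Z - m \<le> 3 * D" using False YZ by (auto simp: m_def field_simps)
        have "integral {Y..Z} q = integral {Y..m} q + integral {m..Z} q"
          using comb[of Y m Z] m Y' by simp
        moreover have "integral {Y..m} q \<le> 3 * D * s" by (rule small) (use Y' m in auto)
        moreover have "integral {m..Z} q \<le> 3 * D * s" by (rule small) (use Y' m in auto)
        ultimately show ?thesis using False by simp
      qed
      also have "\<dots> \<le> integral {Y..Z - 3 * D} (forward_avg3 D q)"
        by (rule integral_forward_avg3_ge[OF q]) (use Y' D in auto)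
      also have "\<dots> \<le> integral {Y..Z - 3 * D} (forward_avg3 D p) + 2 * Y * \<delta>"
        using avg[of Y "Z - 3 * D"] Y' YZ D by linarith
      also have "integral {Y..Z - 3 * D} (forward_avg3 D p) \<le> integral {Y..Z - 3 * D + 3 * D} p"
        by (rule integral_forward_avg3_le[OF p]) (use Y' D in auto)
      finally show ?thesis by simp
    qed
    have "6 * D * s \<le> 24 * L * Y powr (- (21/20))"
    proof -
      have "(Y / 2) powr (- (39/20)) = Y powr (- (39/20)) * 2 powr (39/20)"
      proof -
        have "Y powr (- (39/20)) = (Y / 2 * 2) powr (- (39/20))" by simp
        also have "\<dots> = (Y / 2) powr (- (39/20)) * 2 powr (- (39/20))" using Y' by (intro powr_mult)
        finally have "Y powr (- (39/20)) * 2 powr (39/20) = (Y / 2) powr (- (39/20)) * (2 powr (- (39/20)) * 2 powr (39/20))"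
          by (simp only: mult.assoc)
        also have "2 powr (- (39/20)) * 2 powr (39/20 :: real) = (1 :: real)" unfolding powr_add[symmetric] by simp
        finally show ?thesis by simp
      qed
      also have "\<dots> \<le> Y powr (- (39/20)) * 2 powr 2" by (intro mult_left_mono powr_mono) auto
      finally have "(Y / 2) powr (- (39/20)) \<le> 4 * Y powr (- (39/20))" by simp
      then have "6 * D * s \<le> 6 * D * (L * (4 * Y powr (- (39/20))))"
        unfolding s_def using D L0 by (intro mult_left_mono) auto
      also have "\<dots> = 24 * L * (Y powr (9/10) * Y powr (- (39/20)))" by (simp add: D_def)
      also have "Y powr (9/10) * Y powr (- (39/20)) = Y powr (- (21/20))" unfolding powr_add[symmetric] by simp
      finally show ?thesis .
    qed
    moreover have "2 * Y * \<delta> \<le> 2 * K * Y powr (- (21/20))"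
    proof -
      have "2 * Y * \<delta> = 2 * K * (Y powr 1 * Y powr (9/10 * (- (5/2))))"
        using Y' by (simp add: \<delta>_def D_def powr_powr)
      also have "Y powr 1 * Y powr (9/10 * (- (5/2))) = Y powr (- (5/4))" unfolding powr_add[symmetric] by simp
      also have "2 * K * Y powr (- (5/4)) \<le> 2 * K * Y powr (- (21/20))"
        using K0 Y' by (intro mult_left_mono powr_mono) auto
      finally show ?thesis .
    qed
    ultimately have "6 * D * s + 2 * Y * \<delta> \<le> (24 * L + 2 * K) * Y powr (- (21/20))"
      by (simp add: distrib_right)
    then show ?thesis using upper lower by linarith
  qed
  have "Y0 \<ge> c" by (simp add: Y0_def)
  then show ?thesis using bound by blast
qed

text \<open>Partial integration against the primitive of f transfers the estimate to (1/4 + t^2) f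
  on a dyadic block, at the cost of a factor Y^2. Summation over the blocks keeps the exponent 19/20
  < 1, because the bounds grow geometrically.\<close>

lemma weighted_integral_small:
  fixes f :: "real \<Rightarrow> real"
  assumes f: "continuous_on {Y0..} f" and Y0: "Y0 \<ge> 1"
    and C: "\<And>Y Z. Y \<ge> Y0 \<Longrightarrow> Z \<in> {Y..2 * Y} \<Longrightarrow> \<bar>integral {Y..Z} f\<bar> \<le> C * Y powr (- (21/20))"
  shows "((\<lambda>T. integral {Y0..T} (\<lambda>t. (1/4 + t\<^sup>2) * f t) / T) \<longlongrightarrow> 0) at_top"
proof -
  define g where "g = (\<lambda>t. (1/4 + t\<^sup>2) * f t)"
  have C0: "C \<ge> 0" using C[of Y0 Y0] Y0 by (simp add: zero_le_mult_iff)
  have cf: "continuous_on {a..b} f" if "a \<ge> Y0" for a b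
    by (rule continuous_on_subset[OF f]) (use that in auto)
  have ig: "g integrable_on {a..b}" if "a \<ge> Y0" for a b
    unfolding g_def by (intro integrable_continuous_interval continuous_intros cf that)
  have step: "\<bar>integral {Y..Z} g\<bar> \<le> 9 * C * Y powr (19/20)" if Y: "Y \<ge> Y0" and Z: "Z \<in> {Y..2 * Y}" for Y Z
  proof -
    define q where "q = C * Y powr (- (21/20))"
    have q0: "q \<ge> 0" using C0 by (simp add: q_def)
    define Q where "Q = (\<lambda>t. integral {Y..t} f)"
    have Y1: "Y \<ge> 1" using Y Y0 by simp
    have YZ: "Y \<le> Z" "Z \<le> 2 * Y" using Z by auto
    have Qd: "(Q has_real_derivative f t) (at t within {Y..Z})" if "t \<in> {Y..Z}" for t
      unfolding Q_def by (rule integral_has_real_derivative[OF cf[OF Y] that])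
    have Qb: "\<bar>Q t\<bar> \<le> q" if "t \<in> {Y..Z}" for t
      unfolding Q_def q_def by (rule C[OF Y]) (use that YZ in auto)
    have cQ: "continuous_on {Y..Z} Q"
      using Qd by (meson DERIV_continuous continuous_on_eq_continuous_within)
    have i1: "(\<lambda>t. 2 * t * Q t) integrable_on {Y..Z}"
      by (intro integrable_continuous_interval continuous_intros cQ)
    have "((\<lambda>t. 2 * t * Q t + g t) has_integral ((1/4 + Z\<^sup>2) * Q Z - (1/4 + Y\<^sup>2) * Q Y)) {Y..Z}"
      by (rule fundamental_theorem_of_calculus[OF YZ(1)])
        (auto intro!: derivative_eq_intros Qd simp: has_real_derivative_iff_has_vector_derivative[symmetric] g_def)
    then have "integral {Y..Z} (\<lambda>t. 2 * t * Q t) + integral {Y..Z} g = (1/4 + Z\<^sup>2) * Q Z"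
      using Henstock_Kurzweil_Integration.integral_add[OF i1 ig[OF Y]] by (simp add: integral_unique Q_def)
    then have eq: "integral {Y..Z} g = (1/4 + Z\<^sup>2) * Q Z - integral {Y..Z} (\<lambda>t. 2 * t * Q t)" by simp
    have "norm (integral {Y..Z} (\<lambda>t. 2 * t * Q t)) \<le> integral {Y..Z} (\<lambda>_. 4 * Y * q)"
    proof (rule Henstock_Kurzweil_Integration.integral_norm_bound_integral[OF i1 integrable_const_ivl])
      fix t assume t: "t \<in> {Y..Z}"
      have "2 * t * \<bar>Q t\<bar> \<le> (4 * Y) * q" by (rule mult_mono) (use t Qb[OF t] YZ Y1 in auto)
      moreover have "\<bar>2 * t\<bar> = 2 * t" using t Y1 by simp
      ultimately show "norm (2 * t * Q t) \<le> 4 * Y * q" unfolding real_norm_def abs_mult[of "2 * t"] by simp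
    qed
    also have "\<dots> = (Z - Y) * (4 * Y * q)" using YZ by simp
    also have "\<dots> \<le> Y * (4 * Y * q)" using YZ Y1 q0 by (intro mult_right_mono) auto
    also have "\<dots> = 4 * (Y\<^sup>2 * q)" by (simp add: power2_eq_square)
    finally have 1: "\<bar>integral {Y..Z} (\<lambda>t. 2 * t * Q t)\<bar> \<le> 4 * (Y\<^sup>2 * q)" by simp
    have "\<bar>(1/4 + Z\<^sup>2) * Q Z\<bar> = (1/4 + Z\<^sup>2) * \<bar>Q Z\<bar>" by (simp add: abs_mult)
    also have "\<dots> \<le> (1/4 + Z\<^sup>2) * q" using Qb[of Z] YZ by (intro mult_left_mono) auto
    \<comment> \<open>The coefficients add up to 17/4: 4 for Z \<le> 2 Y and 1/4 for the constant,
      as Y \<ge> 1.\<close>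
    also have "\<dots> \<le> (Y\<^sup>2 / 4 + 3 * Y\<^sup>2 + Y\<^sup>2 / 2 + Y\<^sup>2 / 4) * q + Y\<^sup>2 / 4 * q"
    proof -
      have "Z\<^sup>2 \<le> (2 * Y)\<^sup>2" using YZ Y1 by (intro power_mono) auto
      moreover have "1 \<le> Y\<^sup>2" using Y1 by simp
      ultimately have "1/4 + Z\<^sup>2 \<le> Y\<^sup>2 / 4 + 3 * Y\<^sup>2 + Y\<^sup>2 / 2 + Y\<^sup>2 / 4 + Y\<^sup>2 / 4" by (simp add: power_mult_distrib)
      then show ?thesis using q0 unfolding distrib_right[symmetric] by (rule mult_right_mono)
    qed
    also have "\<dots> = 17/4 * (Y\<^sup>2 * q)" by (simp add: algebra_simps)
    finally have 2: "\<bar>(1/4 + Z\<^sup>2) * Q Z\<bar> \<le> 17/4 * (Y\<^sup>2 * q)" .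
    have Yq: "Y\<^sup>2 * q \<ge> 0" using q0 by simp
    have "\<bar>integral {Y..Z} g\<bar> \<le> 9 * (Y\<^sup>2 * q)" unfolding eq using 1 2 Yq by linarith
    also have "Y\<^sup>2 * q = C * (Y powr 2 * Y powr (- (21/20)))" using Y1 by (simp add: q_def powr_numeral)
    also have "Y powr 2 * Y powr (- (21/20)) = Y powr (19/20)" unfolding powr_add[symmetric] by simp
    finally show ?thesis by simp
  qed
  \<comment> \<open>Chosen to survive doubling: B + 9 C is (3/2) B, and 3/2 is at most
    2^(19/20).\<close>
  define B where "B = 18 * C"
  have dy: "\<bar>integral {Y0..T} g\<bar> \<le> B * T powr (19/20)" if "Y0 \<le> T" "T \<le> 2 ^ k * (2 * Y0)" for k T
    using that
  proof (induction k arbitrary: T)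
    case 0
    have "\<bar>integral {Y0..T} g\<bar> \<le> 9 * C * Y0 powr (19/20)" by (rule step) (use 0 in auto)
    also have "\<dots> \<le> B * T powr (19/20)"
      unfolding B_def using C0 0 Y0 by (intro mult_mono powr_mono2) auto
    finally show ?case .
  next
    case (Suc k)
    show ?case
    proof (cases "T \<le> 2 * Y0")
      case True
      have "\<bar>integral {Y0..T} g\<bar> \<le> 9 * C * Y0 powr (19/20)" by (rule step) (use Suc True in auto)
      also have "\<dots> \<le> B * T powr (19/20)"
        unfolding B_def using C0 Suc Y0 by (intro mult_mono powr_mono2) auto
      finally show ?thesis .
    next
      case False
      have T2: "Y0 \<le> T / 2" "T / 2 \<le> 2 ^ k * (2 * Y0)" "T / 2 \<le> T" using False Suc.prems Y0 by auto
      have "integral {Y0..T} g = integral {Y0..T/2} g + integral {T/2..T} g"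
        by (rule Henstock_Kurzweil_Integration.integral_combine[symmetric]) (use T2 ig in auto)
      moreover have "\<bar>integral {Y0..T/2} g\<bar> \<le> B * (T/2) powr (19/20)" by (rule Suc.IH[OF T2(1,2)])
      moreover have "\<bar>integral {T/2..T} g\<bar> \<le> 9 * C * (T/2) powr (19/20)" by (rule step) (use T2 in auto)
      ultimately have "\<bar>integral {Y0..T} g\<bar> \<le> (B + 9 * C) * (T/2) powr (19/20)"
        by (simp add: distrib_right)
      also have "(B + 9 * C) * (T/2) powr (19/20) \<le> B * T powr (19/20)"
      proof -
        have "(3/2 :: real) \<le> 2 powr (19/20)"
        proof -
          have "(3/2 :: real) ^ 20 \<le> 2 ^ 19" by (simp add: eval_nat_numeral)
          also have "(2 :: real) ^ 19 = (2 powr (19/20)) ^ 20"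
            by (simp add: powr_realpow[symmetric] powr_powr)
          finally show ?thesis by (rule power_le_imp_le_base[of _ 19, simplified]) auto
        qed
        moreover have "T powr (19/20) = (T/2) powr (19/20) * 2 powr (19/20)"
          using T2 Y0 by (simp add: powr_divide)
        ultimately have "(3/2) * (T/2) powr (19/20) \<le> T powr (19/20)"
          using mult_right_mono[of "3/2" "2 powr (19/20)" "(T/2) powr (19/20)"] by (simp add: mult.commute)
        then have "B * ((3/2) * (T/2) powr (19/20)) \<le> B * T powr (19/20)"
          using C0 by (intro mult_left_mono) (auto simp: B_def)
        then show ?thesis by (simp add: B_def algebra_simps)
      qed
      finally show ?thesis .
    qed
  qed
  have all: "\<bar>integral {Y0..T} g\<bar> \<le> B * T powr (19/20)" if "Y0 \<le> T" for T
  proof -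
    obtain k :: nat where "T < 2 ^ k" using real_arch_pow[of 2 T] by auto
    also have "(2::real) ^ k \<le> 2 ^ k * (2 * Y0)" using Y0 by simp
    finally have "T \<le> 2 ^ k * (2 * Y0)" by simp
    with that show ?thesis by (rule dy)
  qed
  have "((\<lambda>T. B * (T powr (19/20) / T)) \<longlongrightarrow> B * 0) at_top"
    by (intro tendsto_mult tendsto_const) real_asymp
  then have "((\<lambda>T. B * (T powr (19/20) / T)) \<longlongrightarrow> 0) at_top" by simp
  moreover have "eventually (\<lambda>T. norm (integral {Y0..T} g / T) \<le> B * (T powr (19/20) / T)) at_top"
    using eventually_ge_at_top[of Y0]
  proof eventually_elim
    case (elim T)
    then show ?case using all[OF elim] Y0 by (simp add: divide_right_mono)
  qed
  ultimately have "((\<lambda>T. integral {Y0..T} g / T) \<longlongrightarrow> 0) at_top"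
    by (rule Lim_null_comparison[rotated])
  then show ?thesis by (simp add: g_def)
qed

text \<open>l'Hospital's rule in the form where only the denominator has to tend to infinity; the
  integral itself may stay bounded, as it can when L = 0.\<close>

lemma integral_mean_tendsto:
  fixes h :: "real \<Rightarrow> real"
  assumes h: "continuous_on {a..} h" and lim: "(h \<longlongrightarrow> L) at_top"
  shows "((\<lambda>T. integral {a..T} h / T) \<longlongrightarrow> L) at_top"
proof (rule lhospital_at_top_at_top)
  show "LIM x at_top. x :: real :> at_top" by (rule filterlim_ident)
  show "eventually (\<lambda>x::real. (1::real) \<noteq> 0) at_top" by simp
  show "eventually (\<lambda>x. DERIV (\<lambda>x. x) x :> (1::real)) at_top" by simp
  show "eventually (\<lambda>T. DERIV (\<lambda>T. integral {a..T} h) T :> h T) at_top"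
    using eventually_gt_at_top[of a]
  proof eventually_elim
    case (elim T)
    have "((\<lambda>T. integral {a..T} h) has_real_derivative h T) (at T within {a..T + 1})"
      by (rule integral_has_real_derivative[OF continuous_on_subset[OF h]]) (use elim in auto)
    moreover have "at T within {a..T + 1} = at T"
      by (rule at_within_interior) (use elim in \<open>auto simp: interior_atLeastAtMost_real\<close>)
    ultimately show ?case by simp
  qed
  show "((\<lambda>x. h x / 1) \<longlongrightarrow> L) at_top" using lim by simp
qed

text \<open>The weighted model (1/4 + t^2) q(t) is ln t plus a function h that has a limit, which
  gives the shape of the main term. Averages of p - q are averages of the transform of r, hence
  small; nonnegativity turns this into closeness of integrals, and partial integration restores the
  weight.\<close>

theorem mean_square_zeta:
  "\<exists>A. ((\<lambda>T. (integral {0..T} critical_weight - (T * ln T + A * T)) / T) \<longlongrightarrow> 0) at_top"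
proof -
  obtain b1 b2 r C where r: "integrable lborel r" "\<And>u. \<bar>r u\<bar> \<le> C * \<bar>u\<bar> powr (3/2)"
    and m: "\<And>t. t \<noteq> 0 \<Longrightarrow> of_real (spectral_density t - (ln (1 + t\<^sup>2) / (2 * t\<^sup>2) + 2 * b1 / (1 + t\<^sup>2) + 4 * b2 / (4 + t\<^sup>2))) = fourier r t"
    using spectral_model by blast
  define p where "p = spectral_density"
  define q where "q = (\<lambda>t. ln (1 + t\<^sup>2) / (2 * t\<^sup>2) + 2 * b1 / (1 + t\<^sup>2) + 4 * b2 / (4 + t\<^sup>2))"
  have lims: "((\<lambda>t::real. (1/4 + t\<^sup>2) * (ln (1 + t\<^sup>2) / (2 * t\<^sup>2)) - ln t) \<longlongrightarrow> 0) at_top"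
    "((\<lambda>t::real. (1/4 + t\<^sup>2) * (1 / (1 + t\<^sup>2))) \<longlongrightarrow> 1) at_top"
    "((\<lambda>t::real. (1/4 + t\<^sup>2) * (1 / (4 + t\<^sup>2))) \<longlongrightarrow> 1) at_top"
    by real_asymp+
  define h where "h = (\<lambda>t. (1/4 + t\<^sup>2) * q t - ln t)"
  have "((\<lambda>t. ((1/4 + t\<^sup>2) * (ln (1 + t\<^sup>2) / (2 * t\<^sup>2)) - ln t) + 2 * b1 * ((1/4 + t\<^sup>2) * (1 / (1 + t\<^sup>2)))
    + 4 * b2 * ((1/4 + t\<^sup>2) * (1 / (4 + t\<^sup>2)))) \<longlongrightarrow> 0 + 2 * b1 * 1 + 4 * b2 * 1) at_top"
    by (intro tendsto_add tendsto_mult tendsto_const lims)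
  moreover have "((1/4 + t\<^sup>2) * (ln (1 + t\<^sup>2) / (2 * t\<^sup>2)) - ln t) + 2 * b1 * ((1/4 + t\<^sup>2) * (1 / (1 + t\<^sup>2)))
    + 4 * b2 * ((1/4 + t\<^sup>2) * (1 / (4 + t\<^sup>2))) = h t" for t
  proof -
    have "s * (a + 2 * b1 / x + 4 * b2 / y) - l = (s * a - l) + 2 * b1 * (s * (1 / x)) + 4 * b2 * (s * (1 / y))" for s a x y l :: real
      by (simp add: algebra_simps)
    then show ?thesis unfolding h_def q_def by (simp only:)
  qed
  ultimately have hl: "(h \<longlongrightarrow> 2 * b1 + 4 * b2) at_top" by simp
  define B where "B = \<bar>2 * b1 + 4 * b2\<bar> + 1"
  have e1: "eventually (\<lambda>t. \<bar>h t\<bar> < B) at_top"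
    using order_tendstoD(2)[OF tendsto_rabs[OF hl], of B] by (simp add: B_def)
  \<comment> \<open>The exponent 39/20 in place of 2 absorbs the logarithm of the model, which is of
    order ln t / t^2.\<close>
  have e2: "eventually (\<lambda>t::real. B + ln t \<le> (1/4 + t\<^sup>2) * t powr (- (39/20))) at_top"
    by real_asymp
  \<comment> \<open>The signs of b1 and b2 are not known; this makes h t + ln t, and with it the
    model q, nonnegative from some point on.\<close>
  have e3: "eventually (\<lambda>t::real. B \<le> ln t) at_top"
    by real_asymp
  obtain c0 where c0: "\<And>t. t \<ge> c0 \<Longrightarrow> \<bar>h t\<bar> < B \<and> B + ln t \<le> (1/4 + t\<^sup>2) * t powr (- (39/20)) \<and> B \<le> ln t"
    using eventually_conj[OF e1 eventually_conj[OF e2 e3]] by (auto simp: eventually_at_top_linorder)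
  define c where "c = max c0 1"
  have c: "c \<ge> 1" "\<And>t. t \<ge> c \<Longrightarrow> \<bar>h t\<bar> < B \<and> B + ln t \<le> (1/4 + t\<^sup>2) * t powr (- (39/20)) \<and> B \<le> ln t"
    using c0 by (auto simp: c_def)
  have w: "1/4 + t\<^sup>2 > 0" for t :: real by (intro add_pos_nonneg) auto
  have q0: "q t \<ge> 0" "q t \<le> 1 * t powr (- (39/20))" if "t \<ge> c" for t
  proof -
    have "(1/4 + t\<^sup>2) * q t = h t + ln t" by (simp add: h_def)
    then have "(1/4 + t\<^sup>2) * q t \<ge> 0" "(1/4 + t\<^sup>2) * q t \<le> (1/4 + t\<^sup>2) * t powr (- (39/20))"
      using c(2)[OF that] by linarith+
    then show "q t \<ge> 0" "q t \<le> 1 * t powr (- (39/20))"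
      using w[of t] by (simp_all add: zero_le_mult_iff)
  qed
  have nz: "1 + t\<^sup>2 \<noteq> 0" "4 + t\<^sup>2 \<noteq> 0" "1 + t\<^sup>2 > 0" for t :: real
    using zero_le_power2[of t] by linarith+
  have cq: "continuous_on {c..} q"
    unfolding q_def using c(1) nz by (intro continuous_intros) auto
  have cp: "continuous_on {c..} p" unfolding p_def by (rule continuous_on_subset[OF continuous_spectral_density]) auto
  have p0: "p t \<ge> 0" for t by (simp add: p_def spectral_density_nonneg)
  define g where "g = (\<lambda>u. complex_of_real (r u))"
  have g: "integrable lborel g" "\<And>u. norm (g u) \<le> C * \<bar>u\<bar> powr (3/2)" using r by (simp_all add: g_def)
  have gf: "cfourier g t = of_real (p t - q t)" if "t \<ge> c" for t
  proof -
    have "t \<noteq> 0" using that c(1) by auto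
    from m[OF this] show ?thesis unfolding p_def q_def cfourier_def fourier_def g_def by simp
  qed
  define K where "K = C * (\<integral>x. decay_profile x \<partial>lborel)"
  have K: "\<bar>forward_avg3 \<Delta> p T - forward_avg3 \<Delta> q T\<bar> \<le> K * \<Delta> powr (- (5/2))" if T: "T \<ge> c" and D: "\<Delta> > 0" for T \<Delta>
  proof -
    have "forward_avg3 \<Delta> (cfourier g) T = forward_avg3 \<Delta> (\<lambda>t. of_real (p t - q t)) T"
      by (rule forward_avg3_cong[OF _ D]) (use gf T in auto)
    also have "\<dots> = of_real (forward_avg3 \<Delta> (\<lambda>t. p t - q t) T)"
      by (rule forward_avg3_of_real[OF continuous_on_diff[OF cp cq] T D])
    also have "forward_avg3 \<Delta> (\<lambda>t. p t - q t) T = forward_avg3 \<Delta> p T - forward_avg3 \<Delta> q T"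
      by (rule forward_avg3_diff[OF cp cq T D])
    finally have "norm (forward_avg3 \<Delta> (cfourier g) T) = \<bar>forward_avg3 \<Delta> p T - forward_avg3 \<Delta> q T\<bar>"
      by (simp only: norm_of_real)
    then show ?thesis using forward_avg3_cfourier_bound[OF g D, of T] by (simp add: K_def)
  qed
  obtain Y0 C1 where Y0: "Y0 \<ge> c" and
    C1: "\<And>Y Z. Y \<ge> Y0 \<Longrightarrow> Z \<in> {Y..2 * Y} \<Longrightarrow> \<bar>integral {Y..Z} p - integral {Y..Z} q\<bar> \<le> C1 * Y powr (- (21/20))"
    using averages_imp_integrals_close[OF cp p0 cq q0(1) K q0(2)] by metis
  have sub: "{Y0..} \<subseteq> {c..}" "Y0 \<ge> 1" using Y0 c by auto
  have ip: "p integrable_on {a..b}" "q integrable_on {a..b}" if "a \<ge> Y0" for a b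
    by (auto intro!: integrable_continuous_interval continuous_on_subset[OF cp] continuous_on_subset[OF cq])
      (use that Y0 in auto)
  have 1: "((\<lambda>T. integral {Y0..T} (\<lambda>t. (1/4 + t\<^sup>2) * (p t - q t)) / T) \<longlongrightarrow> 0) at_top"
  proof (rule weighted_integral_small[OF continuous_on_subset[OF continuous_on_diff[OF cp cq] sub(1)] sub(2)])
    show "\<bar>integral {Y..Z} (\<lambda>t. p t - q t)\<bar> \<le> C1 * Y powr (- (21/20))" if "Y \<ge> Y0" "Z \<in> {Y..2 * Y}" for Y Z
      using C1[OF that] by (simp add: Henstock_Kurzweil_Integration.integral_diff[OF ip[OF that(1)]])
  qed
  have ch: "continuous_on {Y0..} h"
    unfolding h_def by (intro continuous_intros continuous_on_subset[OF cq sub(1)]) (use sub in auto)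
  have 2: "((\<lambda>T. integral {Y0..T} h / T) \<longlongrightarrow> 2 * b1 + 4 * b2) at_top"
    by (rule integral_mean_tendsto[OF ch hl])
  define I0 where "I0 = integral {0..Y0} critical_weight"
  \<comment> \<open>The -1 stems from the primitive t ln t - t of the logarithm.\<close>
  define A where "A = 2 * b1 + 4 * b2 - 1"
  have 3: "((\<lambda>T. (I0 - (Y0 * ln Y0 - Y0)) / T) \<longlongrightarrow> 0) at_top"
    by (rule real_tendsto_divide_at_top[OF tendsto_const filterlim_ident])
  have "((\<lambda>T. integral {Y0..T} (\<lambda>t. (1/4 + t\<^sup>2) * (p t - q t)) / T + integral {Y0..T} h / T + (I0 - (Y0 * ln Y0 - Y0)) / T - (1 + A)) \<longlongrightarrow>
     0 + (2 * b1 + 4 * b2) + 0 - (1 + A)) at_top"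
    by (intro tendsto_intros 1 2 3)
  then have "((\<lambda>T. integral {Y0..T} (\<lambda>t. (1/4 + t\<^sup>2) * (p t - q t)) / T + integral {Y0..T} h / T + (I0 - (Y0 * ln Y0 - Y0)) / T - (1 + A)) \<longlongrightarrow> 0) at_top"
    by (simp add: A_def)
  moreover have "eventually (\<lambda>T. integral {Y0..T} (\<lambda>t. (1/4 + t\<^sup>2) * (p t - q t)) / T + integral {Y0..T} h / T + (I0 - (Y0 * ln Y0 - Y0)) / T - (1 + A)
     = (integral {0..T} critical_weight - (T * ln T + A * T)) / T) at_top"
    using eventually_ge_at_top[of Y0]
  proof eventually_elim
    case (elim T)
    have T0: "T > 0" using elim sub by linarith
    have "integral {0..T} critical_weight = I0 + integral {Y0..T} critical_weight"
      unfolding I0_def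
      by (rule Henstock_Kurzweil_Integration.integral_combine[symmetric])
        (use elim sub in \<open>auto intro!: integrable_continuous_interval continuous_on_subset[OF continuous_critical_weight]\<close>)
    also have "integral {Y0..T} critical_weight = integral {Y0..T} (\<lambda>t. (1/4 + t\<^sup>2) * (p t - q t) + (h t + ln t))"
    proof (rule Henstock_Kurzweil_Integration.integral_cong)
      have "s * a = s * (a - x) + (s * x - l + l)" for s a x l :: real by (simp add: algebra_simps)
      then show "critical_weight t = (1/4 + t\<^sup>2) * (p t - q t) + (h t + ln t)" for t
        unfolding critical_weight_eq h_def p_def by (simp only:)
    qed
    also have "\<dots> = integral {Y0..T} (\<lambda>t. (1/4 + t\<^sup>2) * (p t - q t)) + integral {Y0..T} (\<lambda>t. h t + ln t)"
      by (intro Henstock_Kurzweil_Integration.integral_add integrable_continuous_interval continuous_intros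
          continuous_on_subset[OF cp] continuous_on_subset[OF cq] continuous_on_subset[OF ch]) (use sub Y0 in auto)
    also have "integral {Y0..T} (\<lambda>t. h t + ln t) = integral {Y0..T} h + integral {Y0..T} ln"
      by (intro Henstock_Kurzweil_Integration.integral_add integrable_continuous_interval continuous_intros
          continuous_on_subset[OF ch]) (use sub in auto)
    also have "integral {Y0..T} ln = (T * ln T - T) - (Y0 * ln Y0 - Y0)"
      by (rule integral_unique, rule fundamental_theorem_of_calculus[OF elim])
        (use sub in \<open>auto intro!: derivative_eq_intros simp: has_real_derivative_iff_has_vector_derivative[symmetric]\<close>)
    finally have "integral {0..T} critical_weight - (T * ln T + A * T) = integral {Y0..T} (\<lambda>t. (1/4 + t\<^sup>2) * (p t - q t)) + integral {Y0..T} h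
       + (I0 - (Y0 * ln Y0 - Y0)) - (1 + A) * T" by (simp add: algebra_simps)
    then show ?case using T0 by (simp add: add_divide_distrib diff_divide_distrib)
  qed
  ultimately have "((\<lambda>T. (integral {0..T} critical_weight - (T * ln T + A * T)) / T) \<longlongrightarrow> 0) at_top"
    by (rule Lim_transform_eventually)
  then show ?thesis by (rule exI)
qed

section \<open>The ladder and its inverse\<close>

lemma critical_weight_nonneg: "critical_weight t \<ge> 0"
  by (simp add: critical_weight_def)

text \<open>All terms of the series at 2 are positive. One nonzero value is what excludes, by the
  identity theorem, that zeta vanishes on a segment of the critical line.\<close>

lemma zeta_2_nonzero: "zeta 2 \<noteq> 0"
proof
  assume "zeta 2 = 0"
  then have "(\<lambda>n. 1 / (of_nat (Suc n) powr 2) :: complex) sums 0" using zeta_sums[of 2] by simp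
  then have "(\<lambda>n. Re (1 / (of_nat (Suc n) powr 2))) sums 0" using sums_Re by fastforce
  moreover have "Re (1 / (of_nat (Suc n) powr 2)) = 1 / (real (Suc n))\<^sup>2" for n
  proof -
    have "(of_nat (Suc n) powr 2 :: complex) = of_real (real (Suc n) powr 2)"
      using powr_of_real[of "real (Suc n)" 2] by simp
    then show ?thesis by (simp add: powr_numeral del: of_nat_Suc)
  qed
  ultimately have s: "(\<lambda>n. 1 / (real (Suc n))\<^sup>2) sums 0" by simp
  have "1 / (real (Suc 0))\<^sup>2 = 0"
    using suminf_eq_zero_iff[of "\<lambda>n. 1 / (real (Suc n))\<^sup>2"] s unfolding sums_iff by auto
  then show False by simp
qed

text \<open>Otherwise zeta would vanish on a segment of the critical line and hence at 2. The strict
  inequality is the source of the uniqueness of solutions of the ladder equation.\<close>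

lemma critical_weight_integral_pos:
  assumes "a < b"
  shows "integral {a..b} critical_weight > 0"
proof -
  have c: "continuous_on {a..b} critical_weight"
    by (rule continuous_on_subset[OF continuous_critical_weight]) auto
  have "integral {a..b} critical_weight \<noteq> 0"
  proof
    assume "integral {a..b} critical_weight = 0"
    then have z: "critical_weight t = 0" if "t \<in> {a..b}" for t
      using integral_eq_0_iff[OF c assms critical_weight_nonneg] that by blast
    define U where "U = (\<lambda>t. 1/2 + \<i> * complex_of_real t) ` {a..b}"
    have "zeta 2 = 0"
    proof (rule analytic_continuation[where S = "- {1}" and U = U and \<xi> = "1/2 + \<i> * complex_of_real a" and f = zeta])
      show "zeta holomorphic_on - {1}" by (rule zeta_holomorphic)
      show "connected (- {1::complex})" by (rule connected_punctured_universe) simp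
      show "U \<subseteq> - {1}" by (auto simp: U_def complex_eq_iff)
      \<comment> \<open>A connected set with more than one point has no isolated points.\<close>
      show "1/2 + \<i> * complex_of_real a islimpt U"
      proof (rule connected_imp_perfect)
        show "connected U"
          unfolding U_def by (intro connected_continuous_image continuous_intros) auto
        show "1/2 + \<i> * complex_of_real a \<in> U" using assms by (auto simp: U_def)
        have "1/2 + \<i> * complex_of_real a \<in> U" "1/2 + \<i> * complex_of_real b \<in> U"
          using assms by (auto simp: U_def)
        moreover have "1/2 + \<i> * complex_of_real a \<noteq> 1/2 + \<i> * complex_of_real b"
          using assms by (auto simp: complex_eq_iff)
        ultimately show "U \<noteq> {x}" for x by (metis singletonD)
      qed
      show "zeta x = 0" if "x \<in> U" for x
        using that z by (auto simp: U_def critical_weight_def)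
    qed (auto simp: complex_eq_iff)
    then show False using zeta_2_nonzero by simp
  qed
  moreover have "integral {a..b} critical_weight \<ge> 0"
    by (rule Henstock_Kurzweil_Integration.integral_nonneg) (auto intro: integrable_continuous_interval c critical_weight_nonneg)
  ultimately show ?thesis by simp
qed

definition zeta_moment :: "real \<Rightarrow> real" where
  "zeta_moment T = integral {0..T} critical_weight"

lemma integrable_critical_weight: "critical_weight integrable_on {a..b}"
  by (rule integrable_continuous_interval[OF continuous_on_subset[OF continuous_critical_weight]]) auto

lemma zeta_moment_strict_mono:
  assumes "0 \<le> S" "S < T"
  shows "zeta_moment S < zeta_moment T"
proof -
  have "zeta_moment T = zeta_moment S + integral {S..T} critical_weight"
    unfolding zeta_moment_def
    by (rule Henstock_Kurzweil_Integration.integral_combine[symmetric]) (use assms integrable_critical_weight in auto)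
  then show ?thesis using critical_weight_integral_pos[OF assms(2)] by simp
qed

lemma zeta_moment_0 [simp]: "zeta_moment 0 = 0"
  by (simp add: zeta_moment_def)

lemma zeta_moment_has_derivative:
  assumes "0 \<le> t" "t \<le> M"
  shows "(zeta_moment has_real_derivative critical_weight t) (at t within {0..M})"
  unfolding zeta_moment_def[abs_def]
  by (rule integral_has_real_derivative[OF continuous_on_subset[OF continuous_critical_weight]]) (use assms in auto)

lemma continuous_zeta_moment: "continuous_on {0..M} zeta_moment"
  by (rule DERIV_continuous_on) (use zeta_moment_has_derivative in auto)

text \<open>By the mean square formula the moment eventually exceeds T (ln T + A - 1). Together with
  continuity it attains every positive value, so the ladder equation can be solved for T.\<close>

lemma zeta_moment_at_top: "filterlim zeta_moment at_top at_top"
proof -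
  obtain A where A: "((\<lambda>T. (zeta_moment T - (T * ln T + A * T)) / T) \<longlongrightarrow> 0) at_top"
    using mean_square_zeta unfolding zeta_moment_def by blast
  have 1: "filterlim (\<lambda>T::real. T * (ln T + A - 1)) at_top at_top"
    by real_asymp
  have "eventually (\<lambda>T. (zeta_moment T - (T * ln T + A * T)) / T > -1) at_top"
    using order_tendstoD(1)[OF A, of "-1"] by simp
  then have "eventually (\<lambda>T. T * (ln T + A - 1) \<le> zeta_moment T) at_top"
    using eventually_gt_at_top[of 0]
  proof eventually_elim
    case (elim T)
    then have "-1 * T < zeta_moment T - (T * ln T + A * T)" by (simp only: pos_less_divide_eq)
    then show ?case by (simp add: algebra_simps)
  qed
  then show ?thesis by (rule filterlim_at_top_mono[OF 1])
qed

lemma zeta_moment_surj: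
  assumes "y > 0"
  shows "\<exists>T>0. zeta_moment T = y"
proof -
  obtain M where M: "zeta_moment M \<ge> y" "M \<ge> 0"
    using eventually_conj[OF filterlim_at_top[THEN iffD1, OF zeta_moment_at_top, rule_format, of y] eventually_ge_at_top[of 0]]
    unfolding eventually_at_top_linorder by auto
  obtain T where "0 \<le> T" "T \<le> M" "zeta_moment T = y"
    using IVT'[of zeta_moment 0 y M] M assms continuous_zeta_moment by auto
  moreover have "T \<noteq> 0" using \<open>zeta_moment T = y\<close> assms by auto
  ultimately show ?thesis by (auto intro!: exI[of _ T])
qed

section \<open>The smoothed moment and the inverse of the ladder\<close>

definition smoothed_moment :: "(real \<Rightarrow> real) \<Rightarrow> real \<Rightarrow> real" where
  "smoothed_moment \<mu> X = integral {0..\<mu> X} (\<lambda>t. critical_weight t * exp (- (2 * t / X)))"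

lemma smoothed_integrable: "(\<lambda>t. critical_weight t * exp (- (2 * t / X))) integrable_on {a..b}"
  unfolding divide_inverse
  by (intro integrable_continuous_interval continuous_intros continuous_on_subset[OF continuous_critical_weight]) auto

text \<open>A larger X gives at least the same interval and a larger factor exp (- 2 t / X);
  strictness comes from the factor. Positivity of the value guarantees \<mu> X > 0, since over an
  empty or degenerate interval the integral is 0.\<close>

lemma smoothed_moment_strict_mono:
  assumes m: "mono_on {y0..} \<mu>" and X: "0 < y0" "y0 \<le> X" "X < X'" and pos: "smoothed_moment \<mu> X > 0"
  shows "smoothed_moment \<mu> X < smoothed_moment \<mu> X'"
proof -
  define M where "M = \<mu> X"
  have M: "M > 0"
  proof (rule ccontr)
    assume "\<not> M > 0"
    then have "smoothed_moment \<mu> X = 0"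
      by (cases "M = 0") (simp_all add: smoothed_moment_def M_def)
    then show False using pos by simp
  qed
  have MX: "M \<le> \<mu> X'" unfolding M_def using m X by (auto simp: mono_on_def)
  define d where "d = (\<lambda>t. critical_weight t * exp (- (2 * t / X')) - critical_weight t * exp (- (2 * t / X)))"
  have ex: "exp (- (2 * t / X)) < exp (- (2 * t / X'))" if "t > 0" for t
    using that X by (simp add: frac_less2)
  have d0: "d t \<ge> 0" if "t \<in> {0..M}" for t
  proof (cases "t = 0")
    case False
    then show ?thesis unfolding d_def right_diff_distrib[symmetric]
      using ex[of t] that critical_weight_nonneg by (intro mult_nonneg_nonneg) auto
  qed (simp add: d_def)
  have cd: "continuous_on {0..M} d"
    unfolding d_def divide_inverse
    by (intro continuous_intros continuous_on_subset[OF continuous_critical_weight]) auto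
  have "integral {0..M} d \<noteq> 0"
  proof
    assume "integral {0..M} d = 0"
    then have "\<forall>t\<in>{0..M}. d t = 0" using integral_eq_0_iff[OF cd M d0] by simp
    moreover have "critical_weight t = 0" if "d t = 0" "t > 0" for t
      using that ex[of t] unfolding d_def right_diff_distrib[symmetric] mult_eq_0_iff by (metis less_irrefl eq_iff_diff_eq_0)
    ultimately have "integral {M/2..M} critical_weight = integral {M/2..M} (\<lambda>_. 0)"
      using M by (intro Henstock_Kurzweil_Integration.integral_cong) auto
    then show False using critical_weight_integral_pos[of "M/2" M] M by simp
  qed
  moreover have "integral {0..M} d \<ge> 0"
    by (rule Henstock_Kurzweil_Integration.integral_nonneg) (auto intro: integrable_continuous_interval cd d0)
  moreover have "integral {0..M} d = integral {0..M} (\<lambda>t. critical_weight t * exp (- (2 * t / X'))) - smoothed_moment \<mu> X"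
    unfolding d_def smoothed_moment_def M_def by (rule Henstock_Kurzweil_Integration.integral_diff[OF smoothed_integrable smoothed_integrable])
  moreover have "integral {0..M} (\<lambda>t. critical_weight t * exp (- (2 * t / X'))) \<le> smoothed_moment \<mu> X'"
    unfolding smoothed_moment_def
    by (rule integral_subset_le[OF _ smoothed_integrable smoothed_integrable]) (use MX critical_weight_nonneg in auto)
  ultimately show ?thesis by linarith
qed

lemma ladder_equation_iff:
  "ladder_equation y0 \<mu> T X \<longleftrightarrow> X \<ge> y0 \<and> smoothed_moment \<mu> X = zeta_moment T"
  by (simp add: ladder_equation_def smoothed_moment_def zeta_moment_def)

text \<open>Strict monotonicity of the smoothed moment makes 2 V the only solution X for this T, and
  that of \<open>zeta_moment\<close> makes T the only preimage of V. So exhibiting one T resolves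
  the definite descriptions behind \<open>reverse_iterate\<close>; the 2 undoes the halving in
  \<open>jacob_ladder\<close>.\<close>

lemma reverse_iterate_eq:
  assumes m: "mono_on {y0..} \<mu>" and y0: "0 < y0" and V: "2 * V \<ge> y0" and T: "T > 0" "zeta_moment T = smoothed_moment \<mu> (2 * V)"
  shows "reverse_iterate y0 \<mu> V = T"
proof -
  have pos: "smoothed_moment \<mu> (2 * V) > 0" using zeta_moment_strict_mono[of 0 T] T by simp
  have uniq: "X = 2 * V" if "X \<ge> y0" "smoothed_moment \<mu> X = smoothed_moment \<mu> (2 * V)" for X
    using smoothed_moment_strict_mono[OF m y0, of X "2 * V"] smoothed_moment_strict_mono[OF m y0 V, of X] that pos
    by (cases X "2 * V" rule: linorder_cases) auto
  have ex1: "\<exists>!X. ladder_equation y0 \<mu> T X"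
    unfolding ladder_equation_iff using uniq V T by metis
  have phi: "ladder_phi y0 \<mu> T = 2 * V"
    unfolding ladder_phi_def by (rule the1_equality[OF ex1]) (use V T in \<open>simp add: ladder_equation_iff\<close>)
  have dom: "T \<in> ladder_domain y0 \<mu>" using T ex1 by (simp add: ladder_domain_def)
  show ?thesis
    unfolding reverse_iterate_def the_inv_into_def
  proof (rule the_equality)
    show "T \<in> ladder_domain y0 \<mu> \<and> jacob_ladder y0 \<mu> T = V"
      using dom phi by (simp add: jacob_ladder_def)
    fix S assume S: "S \<in> ladder_domain y0 \<mu> \<and> jacob_ladder y0 \<mu> S = V"
    then have "ladder_phi y0 \<mu> S = 2 * V" by (simp add: jacob_ladder_def)
    moreover have "ladder_equation y0 \<mu> S (ladder_phi y0 \<mu> S)"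
      unfolding ladder_phi_def by (rule theI') (use S in \<open>simp add: ladder_domain_def\<close>)
    ultimately have "zeta_moment S = zeta_moment T" using T by (simp add: ladder_equation_iff)
    moreover have "S > 0" using S by (simp add: ladder_domain_def)
    ultimately show "S = T"
      using zeta_moment_strict_mono[of S T] zeta_moment_strict_mono[of T S] T by (cases S T rule: linorder_cases) auto
  qed
qed

section \<open>The Laplace transform of the moment\<close>

lemma integral_mul_ln_exp:
  "set_integrable lborel {0..} (\<lambda>y::real. y * ln y * exp (- y))"
  "(LINT y:{0..}|lborel. y * ln y * exp (- y :: real)) = 1 - euler_mascheroni"
proof -
  define G where "G = (\<lambda>x y :: real. y powr (x - 1) / exp y)"
  have hG: "(G x has_integral Gamma x) {0..}" if "x > 0" for x
    unfolding G_def by (rule Gamma_integral_real[OF that])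
  have sG: "set_integrable lborel {0..} (G x)" if "x > 0" for x
  proof -
    have "G x absolutely_integrable_on {0..}"
      by (rule nonnegative_absolutely_integrable_1) (use hG[OF that] in \<open>auto simp: integrable_on_def G_def\<close>)
    then show ?thesis unfolding set_integrable_def
      by (subst (asm) integrable_completion) (auto simp: G_def)
  qed
  have IG: "(LINT y:{0..}|lborel. G x y) = Gamma x" if "x > 0" for x
    using set_borel_integral_eq_integral(2)[OF sG[OF that]] integral_unique[OF hG[OF that]] by simp
  define f where "f = (\<lambda>y::real. y * ln y * exp (- y))"
  \<comment> \<open>Difference quotients of Gamma at 2 enclose the integral: ln z \<le> z - 1,
    applied to y^h and y^(-h), puts ln y between (1 - y^(-h)) / h and (y^h - 1) / h. This takes the
    place of differentiation under the integral sign.\<close>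
  have up: "f y \<le> (G (2 + h) y - G 2 y) / h" and lo: "(G 2 y - G (2 - h) y) / h \<le> f y"
    if h: "0 < h" "h < 1" and y: "y \<ge> 0" for h y
  proof -
    show "f y \<le> (G (2 + h) y - G 2 y) / h"
    proof (cases "y = 0")
      case False
      then have y: "y > 0" using y by simp
      have "h * ln y \<le> y powr h - 1" using ln_le_minus_one[of "y powr h"] y by (simp add: ln_powr)
      then have "ln y \<le> (y powr h - 1) / h" using h by (simp add: field_simps)
      then have "y * exp (- y) * ln y \<le> y * exp (- y) * ((y powr h - 1) / h)" using y by (intro mult_left_mono) auto
      also have "\<dots> = (G (2 + h) y - G 2 y) / h"
        using y by (simp add: G_def powr_add exp_minus field_simps)
      finally show ?thesis by (simp add: f_def mult_ac)
    qed (simp add: f_def G_def)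
    show "(G 2 y - G (2 - h) y) / h \<le> f y"
    proof (cases "y = 0")
      case False
      then have y: "y > 0" using y by simp
      have "- h * ln y \<le> y powr (- h) - 1" using ln_le_minus_one[of "y powr (- h)"] y by (simp add: ln_powr)
      then have "(1 - y powr (- h)) / h \<le> ln y" using h by (simp add: field_simps)
      then have "y * exp (- y) * ((1 - y powr (- h)) / h) \<le> y * exp (- y) * ln y" using y by (intro mult_left_mono) auto
      moreover have "y * exp (- y) * ((1 - y powr (- h)) / h) = (G 2 y - G (2 - h) y) / h"
      proof -
        have "y powr (1 - h) = y * y powr (- h)" using y by (simp add: powr_diff powr_minus divide_inverse)
        then show ?thesis using y h by (simp add: G_def exp_minus field_simps)
      qed
      ultimately have "(G 2 y - G (2 - h) y) / h \<le> y * exp (- y) * ln y" by (simp only:)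
      then show ?thesis by (simp add: f_def mult_ac)
    qed (simp add: f_def G_def)
  qed
  have sf: "set_integrable lborel {0..} f"
    unfolding set_integrable_def
  proof (rule Bochner_Integration.integrable_bound)
    \<comment> \<open>The two enclosing bounds at h = 1/2 provide this majorant.\<close>
    show "integrable lborel (\<lambda>y. indicator {0..} y *\<^sub>R (2 * (G (5/2) y + G 2 y + G (3/2) y)))"
      using set_integrable_mult_right[OF set_integral_add(1)[OF set_integral_add(1)[OF sG[of "5/2"] sG[of 2]] sG[of "3/2"]], of 2]
      unfolding set_integrable_def by simp
    show "(\<lambda>y. indicator {0..} y *\<^sub>R f y) \<in> borel_measurable lborel" unfolding f_def by measurable
    show "AE y in lborel. norm (indicator {0..} y *\<^sub>R f y) \<le> norm (indicator {0..} y *\<^sub>R (2 * (G (5/2) y + G 2 y + G (3/2) y)))"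
    proof (rule AE_I2)
      fix y :: real
      have "\<bar>f y\<bar> \<le> 2 * (G (5/2) y + G 2 y + G (3/2) y)" if "y \<ge> 0"
      proof -
        have G0: "G x y \<ge> 0" for x by (simp add: G_def)
        have "f y \<le> 2 * G (5/2) y - 2 * G 2 y" using up[of "1/2" y] that by simp
        moreover have "2 * G 2 y - 2 * G (3/2) y \<le> f y" using lo[of "1/2" y] that by simp
        moreover note G0[of 2] G0[of "5/2"] G0[of "3/2"]
        ultimately show ?thesis by (smt (verit))
      qed
      moreover have "G x y \<ge> 0" for x by (simp add: G_def)
      ultimately show "norm (indicator {0..} y *\<^sub>R f y) \<le> norm (indicator {0..} y *\<^sub>R (2 * (G (5/2) y + G 2 y + G (3/2) y)))"
        by (auto simp: indicator_def)
    qed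
  qed
  then show "set_integrable lborel {0..} (\<lambda>y::real. y * ln y * exp (- y))" by (simp add: f_def)
  define c where "c = (LINT y:{0..}|lborel. f y)"
  have c_up: "c \<le> (Gamma (2 + h) - Gamma 2) / h" if h: "0 < h" "h < 1" for h
  proof -
    have s: "set_integrable lborel {0..} (\<lambda>y. G (2 + h) y - G 2 y)"
      by (rule set_integral_diff(1)[OF sG sG]) (use h in auto)
    have "c \<le> (LINT y:{0..}|lborel. (G (2 + h) y - G 2 y) / h)"
      unfolding c_def
      by (rule set_integral_mono[OF sf]) (use set_integrable_divide[of h, OF s] h up in auto)
    also have "\<dots> = (Gamma (2 + h) - Gamma 2) / h"
      using h by (subst set_integral_divide_zero) (simp add: set_integral_diff(2)[OF sG sG] IG)
    finally show ?thesis .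
  qed
  have c_lo: "(Gamma 2 - Gamma (2 - h)) / h \<le> c" if h: "0 < h" "h < 1" for h
  proof -
    have s: "set_integrable lborel {0..} (\<lambda>y. G 2 y - G (2 - h) y)"
      by (rule set_integral_diff(1)[OF sG sG]) (use h in auto)
    have "(Gamma 2 - Gamma (2 - h)) / h = (LINT y:{0..}|lborel. (G 2 y - G (2 - h) y) / h)"
      using h by (subst set_integral_divide_zero) (simp add: set_integral_diff(2)[OF sG sG] IG)
    also have "\<dots> \<le> c"
      unfolding c_def
      by (rule set_integral_mono[OF _ sf]) (use set_integrable_divide[of h, OF s] h lo in auto)
    finally show ?thesis .
  qed
  have nz: "(2::real) \<notin> \<int>\<^sub>\<le>\<^sub>0" by (auto elim!: nonpos_Ints_cases)
  have "(Gamma has_real_derivative Gamma 2 * Digamma 2) (at (2::real))"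
    by (rule has_field_derivative_Gamma[OF nz])
  moreover have "Digamma (2::real) = 1 - euler_mascheroni"
    using Digamma_numeral[of "num.Bit0 num.One", where 'a = real] by (simp add: harm_def)
  moreover have "Gamma (2::real) = 1" using Gamma_fact[of 1, where 'a = real] by simp
  ultimately have D: "((\<lambda>h. (Gamma (2 + h) - Gamma 2) / h) \<longlongrightarrow> 1 - euler_mascheroni) (at (0::real))"
    by (simp add: DERIV_def)
  have "((\<lambda>h. (Gamma (2 + h) - Gamma 2) / h) \<longlongrightarrow> 1 - euler_mascheroni) (at_right (0::real))"
    by (rule filterlim_mono[OF D order_refl]) (simp add: at_le)
  then have "c \<le> 1 - euler_mascheroni"
    by (rule tendsto_lowerbound) (auto intro!: eventually_at_rightI[of 0 1] c_up)
  moreover have "((\<lambda>h. (Gamma (2 + h) - Gamma 2) / h) \<longlongrightarrow> 1 - euler_mascheroni) (at_left (0::real))"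
    by (rule filterlim_mono[OF D order_refl]) (simp add: at_le)
  then have "1 - euler_mascheroni \<le> c"
  proof (rule tendsto_upperbound)
    show "\<forall>\<^sub>F h in at_left (0::real). (Gamma (2 + h) - Gamma 2) / h \<le> c"
    proof (rule eventually_at_leftI[of "-1"])
      fix h :: real assume "h \<in> {-1<..<0}"
      then have "(Gamma 2 - Gamma (2 - (- h))) / (- h) \<le> c" by (intro c_lo) auto
      moreover have "(Gamma 2 - Gamma (2 - (- h))) / (- h) = (Gamma (2 + h) - Gamma 2) / h"
        by (simp add: minus_divide_left[symmetric] minus_divide_right diff_divide_distrib)
      ultimately show "(Gamma (2 + h) - Gamma 2) / h \<le> c" by simp
    qed simp
  qed simp
  ultimately have "c = 1 - euler_mascheroni" by (rule antisym)
  then show "(LINT y:{0..}|lborel. y * ln y * exp (- y :: real)) = 1 - euler_mascheroni"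
    unfolding c_def f_def .
qed

text \<open>Integration by parts passes from the weight, which is not controlled pointwise, to its
  primitive, whose asymptotics are known. With X = 2 V and t = V y the factor exp (- 2 t / X)
  becomes exp (- y); the boundary term at m is there because the integration stops at \<mu>
  X.\<close>

lemma smoothed_moment_by_parts:
  assumes V: "V > 0" and m: "m \<ge> 0" "\<mu> (2 * V) = m * V"
  shows "smoothed_moment \<mu> (2 * V) = zeta_moment (m * V) * exp (- m) + integral {0..m} (\<lambda>y. zeta_moment (V * y) * exp (- y))"
proof -
  define F where "F = (\<lambda>y. zeta_moment (V * y) * exp (- y))"
  have mV: "m * V \<ge> 0" using V m by simp
  have dF: "(F has_real_derivative V * critical_weight (V * y) * exp (- y) - F y) (at y within {0..m})" if y: "y \<in> {0..m}" for y
  proof -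
    have "(zeta_moment has_real_derivative critical_weight (V * y)) (at (V * y) within {0..m * V})"
      by (rule zeta_moment_has_derivative) (use V y in \<open>auto simp: mult.commute\<close>)
    then have "((zeta_moment \<circ> (\<lambda>y. V * y)) has_real_derivative critical_weight (V * y) * V) (at y within {0..m})"
    proof (rule DERIV_image_chain[OF has_field_derivative_subset])
      show "(\<lambda>y. V * y) ` {0..m} \<subseteq> {0..m * V}" using V by (auto simp: mult.commute)
      show "((\<lambda>y. V * y) has_real_derivative V) (at y within {0..m})" by (auto intro!: derivative_eq_intros)
    qed
    then show ?thesis unfolding F_def o_def
      by (auto intro!: derivative_eq_intros simp: algebra_simps)
  qed
  have cF: "continuous_on {0..m} F"
    using dF by (meson DERIV_continuous continuous_on_eq_continuous_within)
  have iF: "F integrable_on {0..m}" by (rule integrable_continuous_interval[OF cF])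
  have "((\<lambda>y. V * critical_weight (V * y) * exp (- y) - F y) has_integral (F m - F 0)) {0..m}"
    by (rule fundamental_theorem_of_calculus[OF m(1)]) (use dF in \<open>simp add: has_real_derivative_iff_has_vector_derivative\<close>)
  from has_integral_add[OF this integrable_integral[OF iF]]
  have 1: "((\<lambda>y. V * critical_weight (V * y) * exp (- y)) has_integral (F m + integral {0..m} F)) {0..m}"
    by (simp add: F_def)
  have "((\<lambda>t. critical_weight t * exp (- (2 * t / (2 * V)))) has_integral smoothed_moment \<mu> (2 * V)) {0..m * V}"
    unfolding smoothed_moment_def m by (rule integrable_integral[OF smoothed_integrable])
  from has_integral_stretch_real[OF this, of V]
  have "((\<lambda>y. critical_weight (V * y) * exp (- y)) has_integral (1 / V) * smoothed_moment \<mu> (2 * V)) ((\<lambda>x. x / V) ` {0..m * V})"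
    using V by simp
  moreover have "(\<lambda>x. x / V) ` {0..m * V} = {0..m}"
    using V by (auto simp: image_iff field_simps intro!: bexI[of _ "V * _"])
  ultimately have "((\<lambda>y. critical_weight (V * y) * exp (- y)) has_integral (1 / V) * smoothed_moment \<mu> (2 * V)) {0..m}" by simp
  from has_integral_mult_right[OF this, of V]
  have "((\<lambda>y. V * critical_weight (V * y) * exp (- y)) has_integral smoothed_moment \<mu> (2 * V)) {0..m}"
    using V by (simp add: mult.assoc)
  with 1 have "smoothed_moment \<mu> (2 * V) = F m + integral {0..m} F" by (rule has_integral_unique[symmetric])
  then show ?thesis by (simp add: F_def[abs_def] mult.commute)
qed

lemma integral_id_exp:
  assumes "m \<ge> 0"
  shows "((\<lambda>y::real. y * exp (- y)) has_integral (1 - (1 + m) * exp (- m))) {0..m}"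
proof -
  have "((\<lambda>y::real. y * exp (- y)) has_integral (- (1 + m) * exp (- m) - (- (1 + 0) * exp (- 0)))) {0..m}"
    by (rule fundamental_theorem_of_calculus[OF assms])
      (auto intro!: derivative_eq_intros simp: has_real_derivative_iff_has_vector_derivative[symmetric] algebra_simps)
  moreover have "- (1 + m) * exp (- m) - (- (1 + 0) * exp (- 0)) = 1 - (1 + m) * exp (- m)"
    by (simp add: algebra_simps)
  ultimately show ?thesis by (simp only:)
qed

text \<open>In zeta_moment (V y) / V = y ln V + y ln y + A y + error the first term integrates to ln
  V and the next two to Gamma'(2) + A. The lower bound on \<mu> controls the cut: m is at least 14
  ln V, so exp (- m) is at most V^(-14).\<close>

lemma smoothed_moment_asymptotic:
  assumes A: "((\<lambda>T. (zeta_moment T - (T * ln T + A * T)) / T) \<longlongrightarrow> 0) at_top"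
    and mu: "\<And>y. y \<ge> y0 \<Longrightarrow> \<mu> y \<ge> 7 * y * ln y"
  shows "((\<lambda>V. smoothed_moment \<mu> (2 * V) / V - ln V) \<longlongrightarrow> 1 - euler_mascheroni + A) at_top"
proof -
  define \<rho> where "\<rho> = (\<lambda>t. zeta_moment t - (t * ln t + A * t))"
  \<comment> \<open>A bound for all t \<ge> 0 is needed, since V y also runs through small values; C
    absorbs the initial range, and e is at disposal.\<close>
  have rho_small: "\<exists>C\<ge>0. \<forall>t\<ge>0. \<bar>\<rho> t\<bar> \<le> C + e * t" if e: "e > 0" for e
  proof -
    have "eventually (\<lambda>T. \<bar>\<rho> T / T\<bar> < e) at_top"
      using order_tendstoD(2)[OF tendsto_rabs_zero[OF A], of e] e by (simp add: \<rho>_def)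
    then have "eventually (\<lambda>T. T \<ge> 1 \<and> \<bar>\<rho> T / T\<bar> < e) at_top"
      using eventually_conj[OF eventually_ge_at_top[of 1]] by blast
    then obtain T0 where T0: "\<And>T. T \<ge> T0 \<Longrightarrow> T \<ge> 1 \<and> \<bar>\<rho> T / T\<bar> < e" by (auto simp: eventually_at_top_linorder)
    define T1 where "T1 = max T0 1"
    define C where "C = zeta_moment T1 + (1 + T1 * T1) + \<bar>A\<bar> * T1"
    have zm: "0 \<le> zeta_moment t" "t \<le> T1 \<Longrightarrow> zeta_moment t \<le> zeta_moment T1" if "t \<ge> 0" for t
      using zeta_moment_strict_mono[of 0 t] zeta_moment_strict_mono[of t T1] that by (cases "t = 0"; cases "t = T1"; force)+
    have C0: "C \<ge> 0" using zm[of T1] by (simp add: C_def T1_def)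
    have "\<bar>\<rho> t\<bar> \<le> C + e * t" if t: "t \<ge> 0" for t
    proof (cases "t \<ge> T1")
      case True
      then have "t \<ge> 1" "\<bar>\<rho> t / t\<bar> < e" using T0[of t] by (auto simp: T1_def)
      then have "\<bar>\<rho> t\<bar> \<le> e * t" by (simp add: abs_divide pos_divide_less_eq less_imp_le)
      then show ?thesis using C0 by simp
    next
      case False
      have "\<bar>t * ln t\<bar> \<le> 1 + T1 * T1"
      proof (cases "t = 0")
        case False
        then have t0: "t > 0" using t by simp
        have "t * ln t \<le> t * t" using ln_le_minus_one[OF t0] t0 by (intro mult_left_mono) auto
        also have "\<dots> \<le> T1 * T1" using t0 \<open>\<not> t \<ge> T1\<close> by (intro mult_mono) auto
        finally have 1: "t * ln t \<le> T1 * T1" .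
        have "t * (1 - 1 / t) \<le> t * ln t" 
          using ln_le_minus_one[of "1 / t"] t0 by (intro mult_left_mono) (auto simp: ln_div)
        then have "t * ln t \<ge> -1" using t0 by (simp add: right_diff_distrib)
        then show ?thesis using 1 T1_def by (smt (verit) mult_nonneg_nonneg)
      qed (simp add: T1_def)
      moreover have "\<bar>A * t\<bar> \<le> \<bar>A\<bar> * T1" unfolding abs_mult using False t by (intro mult_left_mono) auto
      moreover have "\<bar>zeta_moment t\<bar> \<le> zeta_moment T1" using zm[OF t] False by simp
      ultimately have "\<bar>\<rho> t\<bar> \<le> C" unfolding \<rho>_def C_def by linarith
      then show ?thesis using e t by (simp add: add_increasing2)
    qed
    then show ?thesis using C0 by blast
  qed
  define m where "m V = \<mu> (2 * V) / V" for V
  have m_large: "eventually (\<lambda>V. V \<ge> 1 \<and> m V \<ge> 14 * ln V \<and> m V \<ge> 0) at_top"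
    using eventually_ge_at_top[of "max 1 y0"]
  proof eventually_elim
    case (elim V)
    then have V: "V \<ge> 1" "2 * V \<ge> y0" by auto
    have "7 * (2 * V) * ln V \<le> 7 * (2 * V) * ln (2 * V)" using V by (intro mult_left_mono) auto
    also have "\<dots> \<le> \<mu> (2 * V)" by (rule mu[OF V(2)])
    finally have "14 * ln V \<le> m V" using V by (simp add: m_def field_simps)
    moreover have "ln V \<ge> 0" using V by simp
    ultimately show ?case using V by linarith
  qed
  \<comment> \<open>Only half of the exponent is spent on a power of V, hence 7 = 14 / 2. The other
    half is kept to beat powers of m, which has no upper bound in terms of V.\<close>
  have em: "exp (- (m V / 2)) \<le> V powr (- 7)" if "V \<ge> 1" "m V \<ge> 14 * ln V" for V
  proof -
    have "exp (- (m V / 2)) \<le> exp (- 7 * ln V)" using that by simp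
    also have "\<dots> = V powr (- 7)" using that by (simp add: powr_def)
    finally show ?thesis .
  qed
  \<comment> \<open>\<open>E1\<close> is the boundary term, \<open>E2\<close> what the cut takes
    away from ln V, \<open>E3\<close> the part with a nontrivial limit, and \<open>E4\<close> the
    contribution of the error in the mean square.\<close>
  define E1 where "E1 = (\<lambda>V. zeta_moment (m V * V) * exp (- m V) / V)"
  define E2 where "E2 = (\<lambda>V. ln V * ((1 + m V) * exp (- m V)))"
  define E3 where "E3 = (\<lambda>V. integral {0..m V} (\<lambda>y. y * ln y * exp (- y) + A * (y * exp (- y))))"
  define E4 where "E4 = (\<lambda>V. integral {0..m V} (\<lambda>y. \<rho> (V * y) / V * exp (- y)))"
  have m_top: "filterlim m at_top at_top"
  proof (rule filterlim_at_top_mono)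
    show "filterlim (\<lambda>V::real. 14 * ln V) at_top at_top" by real_asymp
    show "eventually (\<lambda>V. 14 * ln V \<le> m V) at_top" using m_large by eventually_elim auto
  qed
  have i1: "(\<lambda>y. y * ln y * exp (- y)) integrable_on {0..b}" for b :: real
    by (rule set_borel_integral_eq_integral(1)[OF set_integrable_subset[OF integral_mul_ln_exp(1)]]) auto
  have i2: "(\<lambda>y. y * exp (- y)) integrable_on {0..b}" for b :: real
    by (intro integrable_continuous_interval continuous_intros)
  have i3: "(\<lambda>y. zeta_moment (V * y) / V * exp (- y)) integrable_on {0..b}" if "V > 0" for V b
    by (intro integrable_continuous_interval continuous_intros continuous_on_compose2[OF continuous_zeta_moment[of "V * b"]])
      (use that in auto)
  have split: "zeta_moment (V * y) / V * exp (- y) =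
      ln V * (y * exp (- y)) + (y * ln y * exp (- y) + A * (y * exp (- y))) + \<rho> (V * y) / V * exp (- y)"
    if "V > 0" "y \<ge> 0" for V y
  proof (cases "y = 0")
    case False
    then have "ln (V * y) = ln V + ln y" using that by (simp add: ln_mult)
    then have "zeta_moment (V * y) = V * y * (ln V + ln y) + A * (V * y) + \<rho> (V * y)" by (simp add: \<rho>_def)
    then have "zeta_moment (V * y) / V = y * (ln V + ln y) + A * y + \<rho> (V * y) / V"
      using that by (simp add: add_divide_distrib)
    then show ?thesis by (simp only:) (simp add: algebra_simps)
  qed (simp add: \<rho>_def)
  have i4: "(\<lambda>y. \<rho> (V * y) / V * exp (- y)) integrable_on {0..b}" if "V > 0" for V b
  proof -
    have "(\<lambda>y. zeta_moment (V * y) / V * exp (- y) - (ln V * (y * exp (- y)) + (y * ln y * exp (- y) + A * (y * exp (- y)))))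
        integrable_on {0..b}"
      by (intro integrable_diff integrable_add integrable_on_mult_right i1 i2 i3 that)
    then show ?thesis
    proof (rule integrable_eq)
      fix y assume "y \<in> {0..b}"
      then have "y \<ge> 0" by simp
      from split[OF that this] show "zeta_moment (V * y) / V * exp (- y) - (ln V * (y * exp (- y)) + (y * ln y * exp (- y) + A * (y * exp (- y))))
          = \<rho> (V * y) / V * exp (- y)" by (simp only: add_diff_cancel_left')
    qed
  qed
  have decomp: "eventually (\<lambda>V. E1 V - E2 V + E3 V + E4 V = smoothed_moment \<mu> (2 * V) / V - ln V) at_top"
    using m_large
  proof eventually_elim
    case (elim V)
    then have V: "V > 0" "m V \<ge> 0" "\<mu> (2 * V) = m V * V" by (auto simp: m_def)
    have "integral {0..m V} (\<lambda>y. zeta_moment (V * y) * exp (- y)) / V = integral {0..m V} (\<lambda>y. zeta_moment (V * y) / V * exp (- y))"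
      by (simp flip: integral_divide)
    also have "\<dots> = integral {0..m V} (\<lambda>y. ln V * (y * exp (- y)) + (y * ln y * exp (- y) + A * (y * exp (- y))) + \<rho> (V * y) / V * exp (- y))"
      by (rule Henstock_Kurzweil_Integration.integral_cong) (rule split, use V in auto)
    also have "\<dots> = integral {0..m V} (\<lambda>y. ln V * (y * exp (- y)) + (y * ln y * exp (- y) + A * (y * exp (- y)))) + E4 V"
      unfolding E4_def
      by (intro Henstock_Kurzweil_Integration.integral_add integrable_add integrable_on_mult_right i1 i2 i4 V(1))
    also have "integral {0..m V} (\<lambda>y. ln V * (y * exp (- y)) + (y * ln y * exp (- y) + A * (y * exp (- y)))) =
        integral {0..m V} (\<lambda>y. ln V * (y * exp (- y))) + E3 V"
      unfolding E3_def
      by (intro Henstock_Kurzweil_Integration.integral_add integrable_add integrable_on_mult_right i1 i2)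
    also have "integral {0..m V} (\<lambda>y. ln V * (y * exp (- y))) = ln V - E2 V"
    proof -
      have "integral {0..m V} (\<lambda>y. ln V * (y * exp (- y))) = ln V * integral {0..m V} (\<lambda>y. y * exp (- y))"
        by (rule Henstock_Kurzweil_Integration.integral_mult_right)
      then show ?thesis
        unfolding integral_unique[OF integral_id_exp[OF V(2)]] E2_def by (simp only: right_diff_distrib mult_1_right)
    qed
    finally show ?case
      unfolding smoothed_moment_by_parts[of V "m V" \<mu>, OF V] by (simp add: E1_def add_divide_distrib)
  qed
  have half: "exp (- x) = exp (- (x / 2)) * exp (- (x / 2))" for x :: real by (simp add: exp_add[symmetric])
  have e_half: "x * exp (- (x / 2)) \<le> 2" "x\<^sup>2 * exp (- (x / 2)) \<le> 8" "exp (- (x / 2)) \<le> 1" if "x \<ge> 0" for x :: real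
  proof -
    have "1 + x / 2 \<le> exp (x / 2)" by (rule exp_ge_add_one_self)
    then have 1: "x \<le> 2 * exp (x / 2)" by linarith
    have "1 + x / 2 + (x / 2)\<^sup>2 / 2 \<le> exp (x / 2)" using exp_lower_Taylor_quadratic[of "x / 2"] that by simp
    then have 2: "x\<^sup>2 \<le> 8 * exp (x / 2)" unfolding power_divide using that by simp
    show "x * exp (- (x / 2)) \<le> 2" "x\<^sup>2 * exp (- (x / 2)) \<le> 8" "exp (- (x / 2)) \<le> 1"
      using 1 2 that by (simp_all add: exp_minus field_simps)
  qed
  have E1: "(E1 \<longlongrightarrow> 0) at_top"
  proof -
    obtain C where C: "C \<ge> 0" "\<And>t. t \<ge> 0 \<Longrightarrow> \<bar>\<rho> t\<bar> \<le> C + 1 * t" using rho_small[of 1] by auto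
    define K where "K = 8 + (\<bar>A\<bar> + 1) * 2 + C"
    have zb: "\<bar>zeta_moment t\<bar> \<le> t\<^sup>2 + (\<bar>A\<bar> + 1) * t + C" if t: "t \<ge> 0" for t
    proof -
      have "t * ln t \<le> t * t"
        using ln_le_minus_one[of t] t by (cases "t = 0") (auto intro!: mult_left_mono)
      moreover have "A * t \<le> \<bar>A\<bar> * t" using t by (intro mult_right_mono) auto
      moreover have "zeta_moment t \<ge> 0" using zeta_moment_strict_mono[of 0 t] t by (cases "t = 0") auto
      moreover have "zeta_moment t = t * ln t + A * t + \<rho> t" by (simp add: \<rho>_def)
      moreover have "\<rho> t \<le> C + t" using C(2)[OF t] by simp
      ultimately show ?thesis by (simp add: power2_eq_square algebra_simps)
    qed
    have "eventually (\<lambda>V. norm (E1 V) \<le> K * V powr (- 6)) at_top"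
      using m_large
    proof eventually_elim
      case (elim V)
      define x where "x = m V"
      have V: "V \<ge> 1" "x \<ge> 0" "x \<ge> 14 * ln V" using elim by (auto simp: x_def)
      have "\<bar>zeta_moment (x * V)\<bar> \<le> (x * V)\<^sup>2 + (\<bar>A\<bar> + 1) * (x * V) + C" using V by (intro zb) auto
      also have "\<dots> \<le> (x\<^sup>2 + (\<bar>A\<bar> + 1) * x + C) * V\<^sup>2"
      proof -
        have V2: "V \<le> V\<^sup>2" "1 \<le> V\<^sup>2" using V by (simp_all add: self_le_power one_le_power)
        have "0 \<le> (\<bar>A\<bar> + 1) * x" using V by simp
        from mult_left_mono[OF V2(1) this] mult_left_mono[OF V2(2) C(1)]
        have "(\<bar>A\<bar> + 1) * x * V \<le> (\<bar>A\<bar> + 1) * x * V\<^sup>2" "C * 1 \<le> C * V\<^sup>2" .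
        then show ?thesis by (simp add: power_mult_distrib distrib_right mult.assoc)
      qed
      finally have "norm (E1 V) \<le> (x\<^sup>2 + (\<bar>A\<bar> + 1) * x + C) * V\<^sup>2 * exp (- x) / V"
        unfolding E1_def x_def[symmetric] using V by (simp add: abs_mult divide_right_mono)
      also have "\<dots> = (x\<^sup>2 * exp (- (x / 2)) + (\<bar>A\<bar> + 1) * (x * exp (- (x / 2))) + C * exp (- (x / 2))) * (V * exp (- (x / 2)))"
        unfolding half[of x] using V by (simp add: power2_eq_square field_simps)
      also have "\<dots> \<le> K * (V * V powr (- 7))"
        unfolding K_def using V C e_half[of x] em[of V] elim
        by (intro mult_mono add_mono mult_left_le) (auto simp: x_def)
      also have "V * V powr (- 7) = V powr (- 6)" using V powr_add[of V 1 "-7"] by simp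
      finally show ?case .
    qed
    moreover have "((\<lambda>V::real. K * V powr (- 6)) \<longlongrightarrow> K * 0) at_top"
      by (intro tendsto_mult tendsto_const) real_asymp
    then have "((\<lambda>V::real. K * V powr (- 6)) \<longlongrightarrow> 0) at_top" by simp
    ultimately show ?thesis by (rule Lim_null_comparison)
  qed
  have E2: "(E2 \<longlongrightarrow> 0) at_top"
  proof -
    have "eventually (\<lambda>V. norm (E2 V) \<le> ln V * (3 * V powr (- 7))) at_top"
      using m_large
    proof eventually_elim
      case (elim V)
      have x: "m V \<ge> 0" "ln V \<ge> 0" using elim by auto
      have "(1 + m V) * exp (- m V) = (exp (- (m V / 2)) + m V * exp (- (m V / 2))) * exp (- (m V / 2))"
        unfolding half[of "m V"] by (simp add: algebra_simps)
      also have "\<dots> \<le> 3 * V powr (- 7)"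
      proof (rule mult_mono)
        show "exp (- (m V / 2)) + m V * exp (- (m V / 2)) \<le> 3" using e_half[OF x(1)] by linarith
        show "exp (- (m V / 2)) \<le> V powr (- 7)" using em[of V] elim by blast
      qed auto
      finally have "ln V * ((1 + m V) * exp (- m V)) \<le> ln V * (3 * V powr (- 7))"
        using x by (intro mult_left_mono)
      then show ?case using x by (simp add: E2_def)
    qed
    moreover have "((\<lambda>V::real. ln V * (3 * V powr (- 7))) \<longlongrightarrow> 0) at_top" by real_asymp
    ultimately show ?thesis by (rule Lim_null_comparison)
  qed
  have E3: "(E3 \<longlongrightarrow> 1 - euler_mascheroni + A) at_top"
  proof -
    have "((\<lambda>V. integral {0..m V} (\<lambda>y. y * ln y * exp (- y))) \<longlongrightarrow> 1 - euler_mascheroni) at_top"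
      using filterlim_compose[OF integral_halfline_tendsto[OF integral_mul_ln_exp(1)] m_top]
      unfolding integral_mul_ln_exp(2) .
    moreover have "((\<lambda>x::real. 1 - (1 + x) * exp (- x)) \<longlongrightarrow> 1) at_top" by real_asymp
    then have "((\<lambda>V. 1 - (1 + m V) * exp (- m V)) \<longlongrightarrow> 1) at_top"
      by (rule filterlim_compose[OF _ m_top])
    ultimately have "((\<lambda>V. integral {0..m V} (\<lambda>y. y * ln y * exp (- y)) + A * (1 - (1 + m V) * exp (- m V)))
        \<longlongrightarrow> 1 - euler_mascheroni + A * 1) at_top"
      by (intro tendsto_intros)
    moreover have "eventually (\<lambda>V. integral {0..m V} (\<lambda>y. y * ln y * exp (- y)) + A * (1 - (1 + m V) * exp (- m V)) = E3 V) at_top"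
      using m_large
    proof eventually_elim
      case (elim V)
      have "E3 V = integral {0..m V} (\<lambda>y. y * ln y * exp (- y)) + integral {0..m V} (\<lambda>y. A * (y * exp (- y)))"
        unfolding E3_def by (intro Henstock_Kurzweil_Integration.integral_add integrable_on_mult_right i1 i2)
      then show ?case using integral_unique[OF integral_id_exp[of "m V"]] elim by simp
    qed
    ultimately have "(E3 \<longlongrightarrow> 1 - euler_mascheroni + A * 1) at_top" by (rule Lim_transform_eventually)
    then show ?thesis by simp
  qed
  have E4: "(E4 \<longlongrightarrow> 0) at_top"
  proof (rule tendstoI)
    fix e :: real assume e: "e > 0"
    obtain C where C: "C \<ge> 0" "\<And>t. t \<ge> 0 \<Longrightarrow> \<bar>\<rho> t\<bar> \<le> C + e / 2 * t" using rho_small[of "e / 2"] e by auto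
    have "((\<lambda>V. C / V) \<longlongrightarrow> 0) at_top" by (rule real_tendsto_divide_at_top[OF tendsto_const filterlim_ident])
    then have "eventually (\<lambda>V. C / V < e / 2) at_top" by (rule order_tendstoD(2)) (use e in simp)
    with m_large show "eventually (\<lambda>V. dist (E4 V) 0 < e) at_top"
    proof eventually_elim
      case (elim V)
      then have V: "V > 0" "m V \<ge> 0" by auto
      have ie: "((\<lambda>y::real. exp (- y)) has_integral (- exp (- m V) - (- exp (- 0)))) {0..m V}"
        by (rule fundamental_theorem_of_calculus[OF V(2)])
          (auto intro!: derivative_eq_intros simp: has_real_derivative_iff_has_vector_derivative[symmetric])
      have "((\<lambda>y. C / V * exp (- y) + e / 2 * (y * exp (- y))) has_integral
          (C / V * (- exp (- m V) - (- exp (- 0))) + e / 2 * (1 - (1 + m V) * exp (- m V)))) {0..m V}"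
        by (intro has_integral_add has_integral_mult_right ie integral_id_exp[OF V(2)])
      moreover have "norm (E4 V) \<le> integral {0..m V} (\<lambda>y. C / V * exp (- y) + e / 2 * (y * exp (- y)))"
        unfolding E4_def
      proof (rule Henstock_Kurzweil_Integration.integral_norm_bound_integral[OF i4[OF V(1)]])
        show "(\<lambda>y. C / V * exp (- y) + e / 2 * (y * exp (- y))) integrable_on {0..m V}" using calculation by blast
        fix y assume y: "y \<in> {0..m V}"
        have "\<bar>\<rho> (V * y)\<bar> / V \<le> (C + e / 2 * (V * y)) / V" using C(2)[of "V * y"] V y by (intro divide_right_mono) auto
        also have "\<dots> = C / V + e / 2 * y" using V by (simp add: add_divide_distrib)
        finally have "\<bar>\<rho> (V * y)\<bar> / V * exp (- y) \<le> (C / V + e / 2 * y) * exp (- y)" by (intro mult_right_mono) auto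
        then show "norm (\<rho> (V * y) / V * exp (- y)) \<le> C / V * exp (- y) + e / 2 * (y * exp (- y))"
          using V by (simp add: abs_mult algebra_simps)
      qed
      ultimately have "norm (E4 V) \<le> C / V * (1 - exp (- m V)) + e / 2 * (1 - (1 + m V) * exp (- m V))"
        by (simp add: integral_unique)
      also have "\<dots> \<le> C / V * 1 + e / 2 * 1"
        using C V e by (intro add_mono mult_left_mono) auto
      finally have "norm (E4 V) \<le> C / V + e / 2" by (simp only: mult_1_right)
      moreover have "C / V < e / 2" by (rule elim)
      ultimately show ?case unfolding dist_norm diff_0_right by linarith
    qed
  qed
  have "((\<lambda>V. E1 V - E2 V + E3 V + E4 V) \<longlongrightarrow> 0 - 0 + (1 - euler_mascheroni + A) + 0) at_top"
    by (intro tendsto_intros E1 E2 E3 E4)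
  from Lim_transform_eventually[OF this decomp] show ?thesis by simp
qed

text \<open>At the test points V (1 + c / ln V) the moment is V ln V + (c + A) V + o(V), while the
  smoothed moment at 2 V is V ln V + (g + A) V + o(V); the unknown A cancels. Taking c = g - e and c
  = g + e traps the value of the inverse between two test points.\<close>

lemma reverse_iterate_asymptotic:
  assumes m: "mono_on {y0..} \<mu>" and y0: "0 < y0" and mu: "\<And>y. y \<ge> y0 \<Longrightarrow> \<mu> y \<ge> 7 * y * ln y"
  shows "((\<lambda>V. (reverse_iterate y0 \<mu> V - V) * ln V / V) \<longlongrightarrow> 1 - euler_mascheroni) at_top"
proof -
  obtain A where A: "((\<lambda>T. (zeta_moment T - (T * ln T + A * T)) / T) \<longlongrightarrow> 0) at_top"
    using mean_square_zeta unfolding zeta_moment_def by blast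
  define g :: real where "g = 1 - euler_mascheroni"
  have g: "g > 0" using euler_mascheroni_less_13_over_22 by (simp add: g_def)
  have G: "((\<lambda>V. smoothed_moment \<mu> (2 * V) / V - ln V) \<longlongrightarrow> g + A) at_top"
    unfolding g_def by (rule smoothed_moment_asymptotic[OF A]) (rule mu)
  have pt: "((\<lambda>V. zeta_moment (V * (1 + c / ln V)) / V - ln V) \<longlongrightarrow> c + A) at_top" if c: "c > 0" for c
  proof -
    have inf: "filterlim (\<lambda>V. V * (1 + c / ln V)) at_top at_top" using c by real_asymp
    have 1: "((\<lambda>V. V * (1 + c / ln V) * ln (V * (1 + c / ln V)) / V - ln V) \<longlongrightarrow> c) at_top"
      using c by real_asymp
    have 2: "((\<lambda>V. V * (1 + c / ln V) / V) \<longlongrightarrow> 1) at_top"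
      using c by real_asymp
    have "((\<lambda>V. (V * (1 + c / ln V) * ln (V * (1 + c / ln V)) / V - ln V) + A * (V * (1 + c / ln V) / V)
        + ((zeta_moment (V * (1 + c / ln V)) - (V * (1 + c / ln V) * ln (V * (1 + c / ln V)) + A * (V * (1 + c / ln V)))) / (V * (1 + c / ln V)))
          * (V * (1 + c / ln V) / V)) \<longlongrightarrow> c + A * 1 + 0 * 1) at_top"
      by (intro tendsto_add tendsto_mult tendsto_const 1 2 filterlim_compose[OF A inf])
    moreover have "eventually (\<lambda>V. (V * (1 + c / ln V) * ln (V * (1 + c / ln V)) / V - ln V) + A * (V * (1 + c / ln V) / V)
        + ((zeta_moment (V * (1 + c / ln V)) - (V * (1 + c / ln V) * ln (V * (1 + c / ln V)) + A * (V * (1 + c / ln V)))) / (V * (1 + c / ln V)))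
          * (V * (1 + c / ln V) / V) = zeta_moment (V * (1 + c / ln V)) / V - ln V) at_top"
      using eventually_gt_at_top[of 1]
    proof eventually_elim
      case (elim V)
      define W where "W = V * (1 + c / ln V)"
      have W: "W > 0" using elim c unfolding W_def by (intro mult_pos_pos add_pos_nonneg) auto
      have "(W * l / V - k) + A * (W / V) + ((z - (W * l + A * W)) / W) * (W / V) = z / V - k" for l k z
        using W elim by (simp add: field_simps)
      then show ?case unfolding W_def[symmetric] by simp
    qed
    ultimately have "((\<lambda>V. zeta_moment (V * (1 + c / ln V)) / V - ln V) \<longlongrightarrow> c + A * 1 + 0 * 1) at_top"
      by (rule Lim_transform_eventually)
    then show ?thesis by simp
  qed
  \<comment> \<open>The condition e < g keeps both parameters g - e and g + e positive, as
    \<open>pt\<close> requires.\<close>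
  have bracket: "eventually (\<lambda>V. (reverse_iterate y0 \<mu> V - V) * ln V / V \<in> {g - e<..<g + e}) at_top" if e: "0 < e" "e < g" for e
  proof -
    have "eventually (\<lambda>V. zeta_moment (V * (1 + (g - e) / ln V)) / V - ln V < g - e/2 + A) at_top"
      by (rule order_tendstoD(2)[OF pt]) (use e in auto)
    moreover have "eventually (\<lambda>V. g + e/2 + A < zeta_moment (V * (1 + (g + e) / ln V)) / V - ln V) at_top"
      by (rule order_tendstoD(1)[OF pt]) (use e g in auto)
    moreover have "eventually (\<lambda>V. g - e/2 + A < smoothed_moment \<mu> (2 * V) / V - ln V) at_top"
      by (rule order_tendstoD(1)[OF G]) (use e in auto)
    moreover have "eventually (\<lambda>V. smoothed_moment \<mu> (2 * V) / V - ln V < g + e/2 + A) at_top"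
      by (rule order_tendstoD(2)[OF G]) (use e in auto)
    ultimately show ?thesis
      using eventually_gt_at_top[of "max 1 y0"]
    proof eventually_elim
      case (elim V)
      then have V: "V > 1" "2 * V \<ge> y0" by auto
      have l: "ln V > 0" using V by simp
      define S where "S = smoothed_moment \<mu> (2 * V)"
      have lo: "zeta_moment (V * (1 + (g - e) / ln V)) < S" and hi: "S < zeta_moment (V * (1 + (g + e) / ln V))"
        using elim V unfolding S_def by (smt (verit) divide_less_cancel)+
      have p1: "V * (1 + (g - e) / ln V) > 0" using V l e by (intro mult_pos_pos add_pos_nonneg) auto
      have p2: "V * (1 + (g + e) / ln V) > 0" using V l e g by (intro mult_pos_pos add_pos_nonneg) auto
      have "S > 0" using lo zeta_moment_strict_mono[OF order_refl p1] by simp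
      \<comment> \<open>The equation is solved for T at the given X = 2 V; the moment attains every
        positive value.\<close>
      then obtain T where T: "T > 0" "zeta_moment T = S" using zeta_moment_surj by blast
      have R: "reverse_iterate y0 \<mu> V = T"
        by (rule reverse_iterate_eq[OF m y0 V(2) T(1)]) (use T(2) S_def in simp)
      have "V * (1 + (g - e) / ln V) < T"
        using lo T p1 zeta_moment_strict_mono[of T "V * (1 + (g - e) / ln V)"] by (cases T "V * (1 + (g - e) / ln V)" rule: linorder_cases) auto
      moreover have "T < V * (1 + (g + e) / ln V)"
        using hi T p2 zeta_moment_strict_mono[of "V * (1 + (g + e) / ln V)" T] by (cases T "V * (1 + (g + e) / ln V)" rule: linorder_cases) auto
      moreover have eq: "V * (1 + x / ln V) = V + x * (V / ln V)" for x by (simp add: algebra_simps)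
      ultimately have a: "(g - e) * (V / ln V) < T - V" "T - V < (g + e) * (V / ln V)" by (simp_all add: eq)
      have p: "ln V / V > 0" using V l by simp
      from mult_strict_right_mono[OF a(1) p] mult_strict_right_mono[OF a(2) p]
      have "(g - e) * (V / ln V) * (ln V / V) < (T - V) * (ln V / V)" "(T - V) * (ln V / V) < (g + e) * (V / ln V) * (ln V / V)" .
      moreover have "x * (V / ln V) * (ln V / V) = x" for x using V l by simp
      ultimately show ?case unfolding R by (simp only: greaterThanLessThan_iff times_divide_eq_right)
    qed
  qed
  have "((\<lambda>V. (reverse_iterate y0 \<mu> V - V) * ln V / V) \<longlongrightarrow> g) at_top"
  proof (rule order_tendstoI)
    fix a assume a: "a < g"
    define e where "e = min (g - a) (g / 2)"
    have e: "0 < e" "e < g" "a \<le> g - e" using a g by (auto simp: e_def)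
    show "eventually (\<lambda>V. a < (reverse_iterate y0 \<mu> V - V) * ln V / V) at_top"
      using bracket[OF e(1,2)] by eventually_elim (use e in auto)
  next
    fix a assume a: "g < a"
    define e where "e = min (a - g) (g / 2)"
    have e: "0 < e" "e < g" "g + e \<le> a" using a g by (auto simp: e_def)
    show "eventually (\<lambda>V. (reverse_iterate y0 \<mu> V - V) * ln V / V < a) at_top"
      using bracket[OF e(1,2)] by eventually_elim (use e in auto)
  qed
  then show ?thesis by (simp add: g_def)
qed

text \<open>By convexity the secant slope of ln Gamma over [x, y] lies between those over [x - 1, x]
  and [y, y + 1], and the functional equation evaluates these two as ln (x - 1) and ln y.\<close>

lemma ln_Gamma_increment_bounds:
  fixes x y :: real
  assumes "1 < x" "x < y"
  shows "(y - x) * ln (x - 1) \<le> ln (Gamma y) - ln (Gamma x)" "ln (Gamma y) - ln (Gamma x) \<le> (y - x) * ln y"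
proof -
  define f where "f = (\<lambda>x::real. ln (Gamma x))"
  have conv: "convex_on {0<..} f" using log_convex_Gamma_real by (simp add: f_def o_def)
  have step: "f (z + 1) - f z = ln z" if "z > 0" for z
  proof -
    have "Gamma (z + 1) = z * Gamma z"
      using that by (intro Gamma_plus1) (auto elim!: nonpos_Ints_cases)
    then show ?thesis by (simp only: f_def ln_mult_pos[OF that Gamma_real_pos[OF that]] add_diff_cancel_right')
  qed
  have "(f (x - 1) - f x) / ((x - 1) - x) \<le> (f (x - 1) - f y) / ((x - 1) - y)"
    "(f (x - 1) - f y) / ((x - 1) - y) \<le> (f x - f y) / (x - y)"
    by (rule convex_on_slope_le[OF conv]; use assms in auto)+
  then have "f x - f (x - 1) \<le> (f x - f y) / (x - y)" by simp
  then have "ln (x - 1) \<le> (f y - f x) / (y - x)"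
    using step[of "x - 1"] assms by (simp add: minus_divide_divide[of "f x - f y", symmetric])
  then show "(y - x) * ln (x - 1) \<le> ln (Gamma y) - ln (Gamma x)"
    using assms by (simp add: f_def pos_le_divide_eq mult.commute)
  have "(f x - f y) / (x - y) \<le> (f x - f (y + 1)) / (x - (y + 1))"
    "(f x - f (y + 1)) / (x - (y + 1)) \<le> (f y - f (y + 1)) / (y - (y + 1))"
    by (rule convex_on_slope_le[OF conv]; use assms in auto)+
  then have "(f x - f y) / (x - y) \<le> f (y + 1) - f y" by simp
  then have "(f y - f x) / (y - x) \<le> ln y"
    using step[of y] assms by (simp add: minus_divide_divide[of "f x - f y", symmetric])
  then show "ln (Gamma y) - ln (Gamma x) \<le> (y - x) * ln y"
    using assms by (simp add: f_def pos_divide_le_eq mult.commute)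
qed

text \<open>The increment lies between (R V - V) ln (V - 1) and (R V - V) ln (2 V). Both logarithms
  are asymptotic to ln V, so (R V - V) ln V, which is asymptotic to g V, decides.\<close>

lemma ln_Gamma_ladder_increment:
  fixes R :: "real \<Rightarrow> real"
  assumes R: "((\<lambda>V. (R V - V) * ln V / V) \<longlongrightarrow> g) at_top" and g: "g > 0"
  shows "((\<lambda>V. (ln (Gamma (R V)) - ln (Gamma V)) / V) \<longlongrightarrow> g) at_top"
    and "eventually (\<lambda>V. 1 < V \<and> V < R V) at_top"
proof -
  have ev: "eventually (\<lambda>V. 0 < (R V - V) * ln V / V \<and> (R V - V) * ln V / V < 2 * g) at_top"
    using order_tendstoD(1)[OF R g] order_tendstoD(2)[OF R, of "2 * g"] g by (intro eventually_conj) auto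
  \<comment> \<open>From here on (R V - V) ln V < 2 g V \<le> V ln V, which yields the crude bound R
    V \<le> 2 V.\<close>
  have le: "eventually (\<lambda>V::real. 2 * g \<le> ln V) at_top" by real_asymp
  have both: "eventually (\<lambda>V. 2 < V \<and> V < R V \<and> R V \<le> 2 * V) at_top"
    using ev le eventually_gt_at_top[of 2]
  proof eventually_elim
    case (elim V)
    have l: "ln V > 0" using elim by simp
    have "0 < (R V - V) * ln V" using elim by (simp add: zero_less_divide_iff)
    then have 1: "R V - V > 0" using l by (simp add: zero_less_mult_iff)
    have "(R V - V) * ln V < 2 * g * V" using elim by (simp add: pos_divide_less_eq)
    also have "\<dots> \<le> ln V * V" using elim by (intro mult_right_mono) auto
    finally have "(R V - V) * ln V < V * ln V" by (simp add: mult.commute)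
    then have "R V - V < V" using l by (simp add: mult_less_cancel_right)
    then show ?case using 1 elim by simp
  qed
  then show "eventually (\<lambda>V. 1 < V \<and> V < R V) at_top" by (rule eventually_mono) auto
  have "((\<lambda>V::real. ln (V - 1) / ln V) \<longlongrightarrow> 1) at_top" by real_asymp
  from tendsto_mult[OF R this] have lo: "((\<lambda>V. (R V - V) * ln V / V * (ln (V - 1) / ln V)) \<longlongrightarrow> g) at_top" by simp
  have "((\<lambda>V::real. ln (2 * V) / ln V) \<longlongrightarrow> 1) at_top" by real_asymp
  from tendsto_mult[OF R this] have hi: "((\<lambda>V. (R V - V) * ln V / V * (ln (2 * V) / ln V)) \<longlongrightarrow> g) at_top" by simp
  show "((\<lambda>V. (ln (Gamma (R V)) - ln (Gamma V)) / V) \<longlongrightarrow> g) at_top"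
  proof (rule tendsto_sandwich[OF _ _ lo hi])
    show "eventually (\<lambda>V. (R V - V) * ln V / V * (ln (V - 1) / ln V) \<le> (ln (Gamma (R V)) - ln (Gamma V)) / V) at_top"
      using both
    proof eventually_elim
      case (elim V)
      have l: "ln V > 0" using elim by simp
      have "(R V - V) * ln V / V * (ln (V - 1) / ln V) = (R V - V) * ln (V - 1) / V" using l by simp
      also have "\<dots> \<le> (ln (Gamma (R V)) - ln (Gamma V)) / V"
        using elim by (intro divide_right_mono ln_Gamma_increment_bounds) auto
      finally show ?case .
    qed
    show "eventually (\<lambda>V. (ln (Gamma (R V)) - ln (Gamma V)) / V \<le> (R V - V) * ln V / V * (ln (2 * V) / ln V)) at_top"
      using both
    proof eventually_elim
      case (elim V)
      have l: "ln V > 0" using elim by simp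
      have "ln (Gamma (R V)) - ln (Gamma V) \<le> (R V - V) * ln (R V)"
        using elim by (intro ln_Gamma_increment_bounds) auto
      also have "\<dots> \<le> (R V - V) * ln (2 * V)" using elim by (intro mult_left_mono) auto
      finally have "(ln (Gamma (R V)) - ln (Gamma V)) / V \<le> (R V - V) * ln (2 * V) / V"
        using elim by (intro divide_right_mono) auto
      also have "\<dots> = (R V - V) * ln V / V * (ln (2 * V) / ln V)" using l by simp
      finally show ?case .
    qed
  qed
qed

text \<open>At V = q \<tau> / g the exponent 1/\<tau> equals (q / g) / V, and the increment divided
  by V tends to g. The normalisation by 1 - c is thus what makes the limit equal to q.\<close>

lemma ladder_Gamma_limit:
  assumes m: "mono_on {y0..} \<mu>" and y0: "0 < y0" and mu: "\<And>y. y \<ge> y0 \<Longrightarrow> \<mu> y \<ge> 7 * y * ln y" and q: "q > 0"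
  shows "((\<lambda>\<tau>. ln ((Gamma (reverse_iterate y0 \<mu> (q * (\<tau> / (1 - euler_mascheroni)))) /
             Gamma (q * (\<tau> / (1 - euler_mascheroni)))) powr (1 / \<tau>))) \<longlongrightarrow> q) at_top"
proof -
  define g :: real where "g = 1 - euler_mascheroni"
  have g: "g > 0" using euler_mascheroni_less_13_over_22 by (simp add: g_def)
  define R where "R = reverse_iterate y0 \<mu>"
  have R: "((\<lambda>V. (R V - V) * ln V / V) \<longlongrightarrow> g) at_top"
    unfolding R_def g_def by (rule reverse_iterate_asymptotic[OF m y0]) (rule mu)
  have inf: "filterlim (\<lambda>\<tau>. q * (\<tau> / g)) at_top at_top"
    using q g by real_asymp
  have "((\<lambda>\<tau>. (q / g) * ((ln (Gamma (R (q * (\<tau> / g)))) - ln (Gamma (q * (\<tau> / g)))) / (q * (\<tau> / g)))) \<longlongrightarrow> (q / g) * g) at_top"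
    by (intro tendsto_mult tendsto_const filterlim_compose[OF ln_Gamma_ladder_increment(1)[OF R g] inf])
  moreover have "eventually (\<lambda>\<tau>. (q / g) * ((ln (Gamma (R (q * (\<tau> / g)))) - ln (Gamma (q * (\<tau> / g)))) / (q * (\<tau> / g))) =
      ln ((Gamma (R (q * (\<tau> / g))) / Gamma (q * (\<tau> / g))) powr (1 / \<tau>))) at_top"
    using eventually_gt_at_top[of 0] filterlim_iff[THEN iffD1, OF inf, rule_format, OF ln_Gamma_ladder_increment(2)[OF R g]]
  proof eventually_elim
    case (elim \<tau>)
    define V where "V = q * (\<tau> / g)"
    \<comment> \<open>Positivity of both values lets the logarithm of the power split into a
      difference of logarithms.\<close>
    have "Gamma (R V) > 0" "Gamma V > 0" using elim unfolding V_def by (auto intro!: Gamma_real_pos)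
    then have "ln ((Gamma (R V) / Gamma V) powr (1 / \<tau>)) = (1 / \<tau>) * (ln (Gamma (R V)) - ln (Gamma V))"
      by (simp add: ln_powr ln_div)
    also have "\<dots> = (q / g) * ((ln (Gamma (R V)) - ln (Gamma V)) / V)"
      using q g elim by (simp add: V_def)
    finally show ?case unfolding V_def by simp
  qed
  ultimately have "((\<lambda>\<tau>. ln ((Gamma (R (q * (\<tau> / g))) / Gamma (q * (\<tau> / g))) powr (1 / \<tau>))) \<longlongrightarrow> (q / g) * g) at_top"
    by (rule Lim_transform_eventually)
  then show ?thesis using g by (simp add: R_def g_def)
qed

theorem theorem1:
  fixes \<mu> :: "real \<Rightarrow> real" and y0 :: real
  assumes "y0 > 0"
    and "smooth_on_halfline y0 \<mu>"
    and "mono_on {y0..} \<mu>"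
    and "\<not> bdd_above (\<mu> ` {y0..})"
    and "\<And>y. y \<ge> y0 \<Longrightarrow> \<mu> y \<ge> 7 * y * ln y"
  shows "(\<forall>(x::nat) (y::nat) (z::nat) (n::nat). x \<ge> 1 \<and> y \<ge> 1 \<and> z \<ge> 1 \<and> n \<ge> 3 \<longrightarrow> x ^ n + y ^ n \<noteq> z ^ n) \<longleftrightarrow>
    (\<forall>(x::nat) (y::nat) (z::nat) (n::nat). x \<ge> 1 \<and> y \<ge> 1 \<and> z \<ge> 1 \<and> n \<ge> 3 \<longrightarrow>
       (\<exists>L. ((\<lambda>\<tau>. ln ((Gamma (reverse_iterate y0 \<mu>
                              (fermat_rational x y z n * (\<tau> / (1 - euler_mascheroni)))) /
                       Gamma (fermat_rational x y z n * (\<tau> / (1 - euler_mascheroni))))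
                      powr (1 / \<tau>)))
              \<longlongrightarrow> L) at_top \<and> L \<noteq> (1 :: real)))"
proof -
  define F where "F = (\<lambda>q \<tau>. ln ((Gamma (reverse_iterate y0 \<mu> (q * (\<tau> / (1 - euler_mascheroni)))) /
    Gamma (q * (\<tau> / (1 - euler_mascheroni)))) powr (1 / \<tau>)))"
  \<comment> \<open>The equivalence holds for each quadruple separately: the limit exists and is q,
    so by uniqueness of limits the existential statement says q \<noteq> 1, which is the inequality
    of the powers after multiplication by z^n.\<close>
  have key: "(\<exists>L. (F (fermat_rational x y z n) \<longlongrightarrow> L) at_top \<and> L \<noteq> 1) \<longleftrightarrow> x ^ n + y ^ n \<noteq> z ^ n"
    if "x \<ge> 1" "y \<ge> 1" "z \<ge> 1" for x y z n :: nat
  proof -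
    define q where "q = fermat_rational x y z n"
    have z: "real z ^ n > 0" using that by simp
    have q: "q > 0" using that unfolding q_def fermat_rational_def by (intro divide_pos_pos add_pos_pos) auto
    have lim: "(F q \<longlongrightarrow> q) at_top"
      unfolding F_def by (rule ladder_Gamma_limit[OF assms(3,1) _ q]) (rule assms(5))
    have "(\<exists>L. (F q \<longlongrightarrow> L) at_top \<and> L \<noteq> 1) \<longleftrightarrow> q \<noteq> 1"
      using lim tendsto_unique[OF trivial_limit_at_top_linorder lim] by blast
    also have "q \<noteq> 1 \<longleftrightarrow> real x ^ n + real y ^ n \<noteq> real z ^ n"
      using z by (auto simp: q_def fermat_rational_def)
    also have "\<dots> \<longleftrightarrow> x ^ n + y ^ n \<noteq> z ^ n"
      by (metis of_nat_add of_nat_eq_iff of_nat_power)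
    finally show ?thesis by (simp add: q_def)
  qed
  then show ?thesis unfolding F_def by blast
qed

end
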